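(* Suppose that there exist $a,b\in(0,1)$ such that: (1) $a<b$; (2) $f_1$ is strictly concave on $[0,a]$ and strictly convex on $[a,1]$, and $f_2$ is strictly convex on $[0,b]$ and strictly concave on $[b,1]$; (3) $f_i,g_i\in C^2[0,1]$ for $i=1,2$; (4) for all $(x,y)\in[0,a]\times[b,1]$ there exists $(\hat x,\hat y)\in(0,a]\times[b,1)$ with $f_1(\hat x)>g_1(y)\frac{\hat x}{y}$ and $f_2(\hat y)>g_2(x)\frac{1-\hat y}{1-x}$. Suppose moreover that $$f_1''(x)\le-2\,\frac{f_1(x)+f_1'(x)(y-x)-g_1(y)}{(y-x)^2}\quad\forall(x,y)\in(0,a)\times[b,1],$$ $$f_2''(y)\le-2\,\frac{f_2(y)-f_2'(y)(y-x)-g_2(x)}{(y-x)^2}\quad\forall(x,y)\in[0,a]\times(b,1),$$ and that there exists $(r_1,r_2)\in[0,\infty)\times[0,\infty)$ such that for all $(x,y)\in[0,a]\times[b,1]$, $$4r_1r_2H_1(x,y)H_2(x,y)-\big(r_1H_3(x,y)+r_2H_4(x,y)\big)^2>0,$$ where $$H_1(x,y)=f_1''(x)(y-x)^2+2[f_1(x)+f_1'(x)(y-x)-g_1(y)],$$ $$H_2(x,y)=f_2''(y)(y-x)^2+2[f_2(y)-f_2'(y)(y-x)-g_2(x)],$$ $$H_3(x,y)=2[g_1(y)-f_1(x)]-(f_1'(x)+g_1'(y))(y-x),$$ $$H_4(x,y)=2[g_2(x)-f_2(y)]+(g_2'(x)+f_2'(y))(y-x).$$ Then there exists a unique solution $(\ell_*,r_*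 )\in[0,a]\times[b,1]$ to the generalised Nash equilibrium problem (GNEP), and therefore $(D_{[0,\ell_*]},D_{[r_*,1]})$ is the unique solution to the Dynkin problem (DP) in the class of Markovian strategies $(D_{S_1},D_{S_2})$ with closed stopping sets $S_1\subseteq[0,a]$ and $S_2\subseteq[b,1]$.
   Context: Process. Let $W=(W_t)_{t\ge0}$ be a one-dimensional standard Brownian motion on a filtered probability space with universally completed filtration $\mathbb F=(\mathcal F_t)_{t\ge0}$. Let $E=(0,1)$, $\zeta=\inf\{t\ge0: W_t\notin E\}$, and let $X_t=W_t$ for $0\le t<\zeta$ and $X_t=\Delta$ for $t\ge\zeta$ (including $t=\infty$), where $\Delta$ is a cemetery state. $\mathbb P^x,\mathbb E^x$ denote probability and expectation when the process starts at $x$. Every function $\phi$ is extended by $\phi(\Delta)=0$. $\mathcal T$ is the set of $\mathbb F$-stopping times with values in $[0,\infty]$. For a measurable set $A$, $D_A=\inf\{t\ge0: X_t\in A\}$ with $\inf\emptyset=\zeta$. Rewards. For $i=1,2$, $f_i,g_i,h_i$ are bounded continuous real functions on $[0,1]$ with $f_i\le h_i\le g_i$, vanishing at $0$ and $1$ (and at $\Delta$). Game (DP). Writing $-i$ for the player other than $i$, for $\tau_1,\tau_2\in\mathcal T$, $$M_i^x(\tau_1,\tau_2)=\mathbb E^x\big[f_i(X_{\tau_i})1_{\{\tau_i<\tau_{-i}\}}+g_i(X_{\tau_{-i}})1_{\{\tau_{-i}<\tau_i\}}+h_i(X_{\tau_i})1_{\{\tau_i=\tau_{-i}\}}\big].$$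 A pair $(\tau_1^*,\tau_2^* )\in\mathcal T\times\mathcal T$ is a solution to the DP if for every $x\in E$, $M_1^x(\tau_1^*,\tau_2^* )=\sup_{\tau_1\in\mathcal T}M_1^x(\tau_1,\tau_2^* )$ and $M_2^x(\tau_1^*,\tau_2^* )=\sup_{\tau_2\in\mathcal T}M_2^x(\tau_1^*,\tau_2)$. Uniqueness is understood for the pair of stopping times: any solution $(D_{S_1},D_{S_2})$ in the stated class satisfies $D_{S_1}=D_{[0,\ell_*]}$ and $D_{S_2}=D_{[r_*,1]}$ $\mathbb P^x$-a.s. for every $x\in E$. GNEP. For $0\le x<y\le1$, $$U_1(x,y)=\frac{f_1(x)-g_1(y)\frac{x}{y}}{y-x},\qquad U_2(x,y)=\frac{f_2(y)-g_2(x)\frac{1-y}{1-x}}{y-x}.$$ Let $\mathcal C=\{(x,y)\in[0,a]\times[b,1]: x\le y\}$, which equals $[0,a]\times[b,1]$ since $a<b$. A solution to the GNEP is a point $(s_1^*,s_2^* )\in\mathcal C$ with $U_1(s_1^*,s_2^* )=\sup_{(s_1,s_2^* )\in\mathcal C}U_1(s_1,s_2^* )$ and $U_2(s_1^*,s_2^* )=\sup_{(s_1^*,s_2)\in\mathcal C}U_2(s_1^*,s_2)$. *)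

theory Defs
  imports "HOL-Probability.Probability"
begin

section \<open>Calculus on the unit interval\<close>

definition strictly_convex_on :: "real set \<Rightarrow> (real \<Rightarrow> real) \<Rightarrow> bool" where
  "strictly_convex_on S \<phi> \<longleftrightarrow> convex S \<and>
     (\<forall>u x y. 0 < u \<and> u < 1 \<and> x \<in> S \<and> y \<in> S \<and> x \<noteq> y \<longrightarrow>
        \<phi> ((1 - u) * x + u * y) < (1 - u) * \<phi> x + u * \<phi> y)"

definition strictly_concave_on :: "real set \<Rightarrow> (real \<Rightarrow> real) \<Rightarrow> bool" where
  "strictly_concave_on S \<phi> \<longleftrightarrow> strictly_convex_on S (\<lambda>x. - \<phi> x)"

text \<open>The derivative of a function on \<open>[0,1]\<close>, one-sided at the two endpoints.\<close>

definition D01 :: "(real \<Rightarrow> real) \<Rightarrow> real \<Rightarrow> real" where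
  "D01 \<phi> x = vector_derivative \<phi> (at x within {0..1})"

definition C2_01 :: "(real \<Rightarrow> real) \<Rightarrow> bool" where
  "C2_01 \<phi> \<longleftrightarrow> \<phi> differentiable_on {0..1} \<and> D01 \<phi> differentiable_on {0..1} \<and>
     continuous_on {0..1} (D01 (D01 \<phi>))"

definition rewards :: "(real \<Rightarrow> real) \<Rightarrow> (real \<Rightarrow> real) \<Rightarrow> (real \<Rightarrow> real) \<Rightarrow> bool" where
  "rewards f g h \<longleftrightarrow>
     (\<forall>\<phi>\<in>{f, g, h}. continuous_on {0..1} \<phi> \<and> bounded (\<phi> ` {0..1}) \<and> \<phi> 0 = 0 \<and> \<phi> 1 = 0) \<and>
     (\<forall>x\<in>{0..1}. f x \<le> h x \<and> h x \<le> g x)"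

section \<open>Brownian motion\<close>

text \<open>
  A Brownian motion \<open>W\<close> relative to a filtration \<open>G\<close>, under probabilities \<open>P x\<close> indexed by the
  starting point \<open>x\<close>. The measure \<open>M\<close> only carries the underlying measurable space. Filtrations
  are indexed by \<open>[0,\<infinity>]\<close> so that the library's \<open>stopping_time\<close> applies to times with
  values in \<open>[0,\<infinity>]\<close>; the condition it imposes at \<open>\<infinity>\<close> is void.
  Here \<open>G\<close> is a raw filtration, not yet completed: \<open>x \<mapsto> P x\<close> can be a Borel kernel
  only on the uncompleted sigma-algebra.
\<close>

locale brownian_family = filtration "space M" G
  for M :: "'w measure" and P :: "real \<Rightarrow> 'w measure" and G :: "ennreal \<Rightarrow> 'w measure"
    and W :: "real \<Rightarrow> 'w \<Rightarrow> real" +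
  assumes kernel: "P \<in> borel \<rightarrow>\<^sub>M prob_algebra M"
    and sub: "\<And>t. subalgebra M (G t)"
    and adapted: "\<And>t. 0 \<le> t \<Longrightarrow> W t \<in> borel_measurable (G (ennreal t))"
    and continuous_paths: "\<And>\<omega>. \<omega> \<in> space M \<Longrightarrow> continuous_on {0..} (\<lambda>t. W t \<omega>)"
    and start: "\<And>x. AE \<omega> in P x. W 0 \<omega> = x"
    and increments_normal: "\<And>x s t. 0 \<le> s \<Longrightarrow> s < t \<Longrightarrow>
      distributed (P x) lborel (\<lambda>\<omega>. W t \<omega> - W s \<omega>) (\<lambda>z. ennreal (normal_density 0 (sqrt (t - s)) z))"
    and increments_indep: "\<And>x s t. 0 \<le> s \<Longrightarrow> s < t \<Longrightarrow>
      prob_space.indep_set (P x) (sets (G (ennreal s)))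
        (sets (vimage_algebra (space M) (\<lambda>\<omega>. W t \<omega> - W s \<omega>) borel))"

text \<open>
  The universal completion: the intersection, over all initial laws \<open>\<mu>\<close>, of the augmentations of
  the sigma-algebra by the null sets of \<open>P\<^sup>\<mu> = \<integral> P x \<mu>(dx)\<close>, which is \<open>\<mu> \<bind> P\<close>.
\<close>

definition universal_completion :: "(real \<Rightarrow> 'w measure) \<Rightarrow> 'w measure \<Rightarrow> 'w measure" where
  "universal_completion P A = sigma (space A)
     (\<Inter>\<mu>\<in>space (prob_algebra borel).
        sigma_sets (space A) (sets A \<union> null_sets (completion (\<mu> \<bind> P))))"

definition stopping_times ::
  "(real \<Rightarrow> 'w measure) \<Rightarrow> (ennreal \<Rightarrow> 'w measure) \<Rightarrow> ('w \<Rightarrow> ennreal) set" where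
  "stopping_times P G = {\<tau>. stopping_time (\<lambda>t. universal_completion P (G t)) \<tau>}"

text \<open>The process killed on leaving \<open>E = (0,1)\<close>; \<open>None\<close> is the cemetery state.\<close>

definition lifetime :: "(real \<Rightarrow> 'w \<Rightarrow> real) \<Rightarrow> 'w \<Rightarrow> ennreal" where
  "lifetime W \<omega> = Inf {ennreal t |t. 0 \<le> t \<and> W t \<omega> \<notin> {0<..<1}}"

definition killed :: "(real \<Rightarrow> 'w \<Rightarrow> real) \<Rightarrow> ennreal \<Rightarrow> 'w \<Rightarrow> real option" where
  "killed W t \<omega> = (if t < lifetime W \<omega> then Some (W (enn2real t) \<omega>) else None)"

definition entry_time :: "(real \<Rightarrow> 'w \<Rightarrow> real) \<Rightarrow> real set \<Rightarrow> 'w \<Rightarrow> ennreal" where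
  "entry_time W A \<omega> =
     (if \<exists>t. killed W t \<omega> \<in> Some ` A then Inf {t. killed W t \<omega> \<in> Some ` A} else lifetime W \<omega>)"

definition extend :: "(real \<Rightarrow> real) \<Rightarrow> real option \<Rightarrow> real" where
  "extend \<phi> = case_option 0 \<phi>"

section \<open>The Dynkin game\<close>

text \<open>
  Expected payoff, from the starting point \<open>x\<close>, of a player with rewards \<open>f, g, h\<close> who uses
  \<open>\<tau>\<close> while the opponent uses \<open>\<sigma>\<close>. Since \<open>\<tau>\<close> and \<open>\<sigma>\<close> are measurable only for the completed
  sigma-algebras, the expectation is taken under the completion of \<open>P x\<close>.
\<close>

definition payoff :: "(real \<Rightarrow> 'w measure) \<Rightarrow> (real \<Rightarrow> 'w \<Rightarrow> real) \<Rightarrow>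
    (real \<Rightarrow> real) \<Rightarrow> (real \<Rightarrow> real) \<Rightarrow> (real \<Rightarrow> real) \<Rightarrow>
    real \<Rightarrow> ('w \<Rightarrow> ennreal) \<Rightarrow> ('w \<Rightarrow> ennreal) \<Rightarrow> real" where
  "payoff P W f g h x \<tau> \<sigma> =
     (\<integral>\<omega>. extend f (killed W (\<tau> \<omega>) \<omega>) * of_bool (\<tau> \<omega> < \<sigma> \<omega>)
         + extend g (killed W (\<sigma> \<omega>) \<omega>) * of_bool (\<sigma> \<omega> < \<tau> \<omega>)
         + extend h (killed W (\<tau> \<omega>) \<omega>) * of_bool (\<tau> \<omega> = \<sigma> \<omega>) \<partial>completion (P x))"

text \<open>Suprema are taken in the extended reals, where they always exist.\<close>

definition dp_solution :: "(real \<Rightarrow> 'w measure) \<Rightarrow> (ennreal \<Rightarrow> 'w measure) \<Rightarrow> (real \<Rightarrow> 'w \<Rightarrow> real) \<Rightarrow>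
    (real \<Rightarrow> real) \<Rightarrow> (real \<Rightarrow> real) \<Rightarrow> (real \<Rightarrow> real) \<Rightarrow>
    (real \<Rightarrow> real) \<Rightarrow> (real \<Rightarrow> real) \<Rightarrow> (real \<Rightarrow> real) \<Rightarrow>
    ('w \<Rightarrow> ennreal) \<Rightarrow> ('w \<Rightarrow> ennreal) \<Rightarrow> bool" where
  "dp_solution P G W f1 g1 h1 f2 g2 h2 \<tau>1 \<tau>2 \<longleftrightarrow>
     \<tau>1 \<in> stopping_times P G \<and> \<tau>2 \<in> stopping_times P G \<and>
     (\<forall>x\<in>{0<..<1}.
        ereal (payoff P W f1 g1 h1 x \<tau>1 \<tau>2)
          = (SUP \<tau>\<in>stopping_times P G. ereal (payoff P W f1 g1 h1 x \<tau> \<tau>2)) \<and>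
        ereal (payoff P W f2 g2 h2 x \<tau>2 \<tau>1)
          = (SUP \<tau>\<in>stopping_times P G. ereal (payoff P W f2 g2 h2 x \<tau> \<tau>1)))"

section \<open>The generalised Nash equilibrium problem\<close>

definition U1 :: "(real \<Rightarrow> real) \<Rightarrow> (real \<Rightarrow> real) \<Rightarrow> real \<Rightarrow> real \<Rightarrow> real" where
  "U1 f1 g1 x y = (f1 x - g1 y * (x / y)) / (y - x)"

definition U2 :: "(real \<Rightarrow> real) \<Rightarrow> (real \<Rightarrow> real) \<Rightarrow> real \<Rightarrow> real \<Rightarrow> real" where
  "U2 f2 g2 x y = (f2 y - g2 x * ((1 - y) / (1 - x))) / (y - x)"

definition gnep_set :: "real \<Rightarrow> real \<Rightarrow> (real \<times> real) set" where
  "gnep_set a b = {(x, y). x \<in> {0..a} \<and> y \<in> {b..1} \<and> x \<le> y}"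

definition gnep_solution :: "real \<Rightarrow> real \<Rightarrow> (real \<Rightarrow> real) \<Rightarrow> (real \<Rightarrow> real) \<Rightarrow>
    (real \<Rightarrow> real) \<Rightarrow> (real \<Rightarrow> real) \<Rightarrow> real \<times> real \<Rightarrow> bool" where
  "gnep_solution a b f1 g1 f2 g2 = (\<lambda>(s1, s2).
     (s1, s2) \<in> gnep_set a b \<and>
     ereal (U1 f1 g1 s1 s2) = (SUP s\<in>{s. (s, s2) \<in> gnep_set a b}. ereal (U1 f1 g1 s s2)) \<and>
     ereal (U2 f2 g2 s1 s2) = (SUP s\<in>{s. (s1, s) \<in> gnep_set a b}. ereal (U2 f2 g2 s1 s)))"

text \<open>
  On \<open>x < y\<close>, dividing by \<open>(y - x)\<^sup>3\<close> turns \<open>H1\<close>, \<open>H2\<close>, \<open>H3\<close>, \<open>H4\<close> into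
  \<open>\<partial>\<^sub>x\<^sub>x U1\<close>, \<open>\<partial>\<^sub>y\<^sub>y U2\<close>, \<open>\<partial>\<^sub>x\<^sub>y U1\<close>, \<open>\<partial>\<^sub>x\<^sub>y U2\<close>.
\<close>

definition H1 :: "(real \<Rightarrow> real) \<Rightarrow> (real \<Rightarrow> real) \<Rightarrow> real \<Rightarrow> real \<Rightarrow> real" where
  "H1 f1 g1 x y = D01 (D01 f1) x * (y - x)\<^sup>2 + 2 * (f1 x + D01 f1 x * (y - x) - g1 y)"

definition H2 :: "(real \<Rightarrow> real) \<Rightarrow> (real \<Rightarrow> real) \<Rightarrow> real \<Rightarrow> real \<Rightarrow> real" where
  "H2 f2 g2 x y = D01 (D01 f2) y * (y - x)\<^sup>2 + 2 * (f2 y - D01 f2 y * (y - x) - g2 x)"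

definition H3 :: "(real \<Rightarrow> real) \<Rightarrow> (real \<Rightarrow> real) \<Rightarrow> real \<Rightarrow> real \<Rightarrow> real" where
  "H3 f1 g1 x y = 2 * (g1 y - f1 x) - (D01 f1 x + D01 g1 y) * (y - x)"

definition H4 :: "(real \<Rightarrow> real) \<Rightarrow> (real \<Rightarrow> real) \<Rightarrow> real \<Rightarrow> real \<Rightarrow> real" where
  "H4 f2 g2 x y = 2 * (g2 x - f2 y) + (D01 g2 x + D01 f2 y) * (y - x)"

end

theory Submission
  imports Defs "HOL-Real_Asymp.Real_Asymp"
begin

text \<open>
  Against an opponent who stops on \<open>[y,1]\<close>, the first player faces an optimal stopping problem on
  \<open>(0,y)\<close> whose value function is the smallest concave majorant of \<open>f1\<close> that equals \<open>g1 y\<close>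
  at \<open>y\<close>: it follows \<open>f1\<close> up to the point \<open>l\<close> whose tangent passes through \<open>(y, g1 y)\<close>, and then
  that tangent. The tangency condition says exactly that \<open>l\<close> maximises \<open>U1(\<cdot>, y)\<close>. Symmetrically
  for the second player, so equilibria in threshold strategies are the solutions of the two
  tangency equations. These have a solution by Brouwer's theorem, and at most one because the
  diagonal condition makes the weighted pseudogradient strictly monotone.

  Optimality follows because a concave function of the stopped Brownian motion is a supermartingale
  and an affine one is a martingale. Conversely, a best response must stop wherever the
  value function is strictly concave, since its payoff is affine across any gap of the
  stopping sets, and must not stop where the value exceeds \<open>f1\<close>; so every equilibrium has
  threshold form.
\<close>

section \<open>Hitting times\<close>

text \<open>Two obstacles shape the probabilistic half. Admissible times live on the universal
  completion, whereas increments are independent of the raw sigma-algebras; so each event is traded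
  for a raw one that agrees with it almost surely under the single law \<open>P x\<close> in use.
  And optional stopping is derived from the increments alone, on time grids: the indicator attached
  to each step must be known at its left end, which forces the random time to be rounded up, so the
  discretised path may overshoot the interval. The analytic half treats one player only: w -> 1 - w
  carries the second player's problem into the first's, and \<open>value_function\<close> collects
  what the probabilistic half needs to know of either. Killing is absorbed into the targets, so that
  all times become hitting times of the unkilled path.\<close>

definition hit_time :: "(real \<Rightarrow> 'w \<Rightarrow> real) \<Rightarrow> real set \<Rightarrow> 'w \<Rightarrow> ennreal" where
  "hit_time W F \<omega> = Inf {ennreal t |t. 0 \<le> t \<and> W t \<omega> \<in> F}"

lemma lifetime_eq_hit_time: "lifetime W = hit_time W (- {0<..<1})"
  by (auto simp: lifetime_def hit_time_def fun_eq_iff)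

lemma hit_time_le: "0 \<le> t \<Longrightarrow> W t \<omega> \<in> F \<Longrightarrow> hit_time W F \<omega> \<le> ennreal t"
  unfolding hit_time_def by (rule Inf_lower) auto

lemma not_in_before_hit_time: "0 \<le> t \<Longrightarrow> ennreal t < hit_time W F \<omega> \<Longrightarrow> W t \<omega> \<notin> F"
  by (meson hit_time_le[where W=W and \<omega>=\<omega>] leD)

lemma hit_time_antimono: "F \<subseteq> F' \<Longrightarrow> hit_time W F' \<omega> \<le> hit_time W F \<omega>"
  unfolding hit_time_def by (rule Inf_superset_mono) auto

text \<open>The visit times of a closed set by a continuous path form a closed subset of the
  half-line, which contains its infimum.\<close>

lemma hit_time_attained:
  assumes F: "closed F" and cont: "continuous_on {0..} (\<lambda>t. W t \<omega>)"
    and fin: "hit_time W F \<omega> < \<infinity>"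
  obtains t where "0 \<le> t" "hit_time W F \<omega> = ennreal t" "W t \<omega> \<in> F"
proof -
  define A where "A = {t\<in>{0..}. W t \<omega> \<in> F}"
  have "A \<noteq> {}"
  proof
    assume "A = {}"
    then have *: "{ennreal t |t. 0 \<le> t \<and> W t \<omega> \<in> F} = {}"
      by (auto simp: A_def)
    have "hit_time W F \<omega> = \<infinity>"
      unfolding hit_time_def * by simp
    then show False using fin by simp
  qed
  moreover have "closed A"
    using continuous_closed_preimage[OF cont _ F] by (simp add: A_def vimage_def Int_def)
  moreover have bdd: "bdd_below A"
    by (rule bdd_belowI[of _ 0]) (simp add: A_def)
  ultimately have "Inf A \<in> A"
    by (intro closed_contains_Inf)
  moreover have "hit_time W F \<omega> = ennreal (Inf A)"
  proof (rule antisym)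
    show "hit_time W F \<omega> \<le> ennreal (Inf A)"
      using \<open>Inf A \<in> A\<close> by (intro hit_time_le) (auto simp: A_def)
    show "ennreal (Inf A) \<le> hit_time W F \<omega>"
      unfolding hit_time_def
      by (rule Inf_greatest) (auto intro!: ennreal_leI cInf_lower bdd simp: A_def)
  qed
  ultimately show thesis
    by (intro that[of "Inf A"]) (auto simp: A_def)
qed

lemma hit_time_le_iff:
  assumes "closed F" and "continuous_on {0..} (\<lambda>t. W t \<omega>)" and "0 \<le> t"
  shows "hit_time W F \<omega> \<le> ennreal t \<longleftrightarrow> (\<exists>s\<in>{0..t}. W s \<omega> \<in> F)"
proof
  assume le: "hit_time W F \<omega> \<le> ennreal t"
  then have "hit_time W F \<omega> < \<infinity>"
    by (rule order.strict_trans1) simp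
  then obtain s where "0 \<le> s" "hit_time W F \<omega> = ennreal s" "W s \<omega> \<in> F"
    by (rule hit_time_attained[where W=W and \<omega>=\<omega>, OF assms(1,2)])
  then show "\<exists>s\<in>{0..t}. W s \<omega> \<in> F"
    using le assms(3) by (intro bexI[of _ s]) auto
next
  assume "\<exists>s\<in>{0..t}. W s \<omega> \<in> F"
  then obtain s where s: "0 \<le> s" "s \<le> t" "W s \<omega> \<in> F" by auto
  then have "hit_time W F \<omega> \<le> ennreal s" by (intro hit_time_le)
  also have "\<dots> \<le> ennreal t" using s by (intro ennreal_leI)
  finally show "hit_time W F \<omega> \<le> ennreal t" .
qed

lemma killed_in_iff:
  "killed W t \<omega> \<in> Some ` S \<longleftrightarrow> t < lifetime W \<omega> \<and> W (enn2real t) \<omega> \<in> S"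
  by (auto simp: killed_def)

text \<open>Death is the hitting of the complement of (0,1), and it is also the default value for a
  set that is never entered. Adding that complement to the target therefore absorbs both the killing
  and the convention for an empty infimum.\<close>

lemma entry_time_eq_hit_time: "entry_time W S \<omega> = hit_time W (S \<union> - {0<..<1}) \<omega>"
proof -
  let ?z = "lifetime W \<omega>"
  let ?A = "{t. killed W t \<omega> \<in> Some ` S}"
  let ?T = "hit_time W (S \<union> - {0<..<1}) \<omega>"
  have T_le: "?T \<le> ?z"
    unfolding lifetime_eq_hit_time by (rule hit_time_antimono) auto
  have split: "ennreal t \<in> ?A \<or> ?z \<le> ennreal t" if "0 \<le> t" "W t \<omega> \<in> S \<union> - {0<..<1}" for t
    using that hit_time_le[of t W \<omega> "- {0<..<1}"]
    by (auto simp: killed_in_iff lifetime_eq_hit_time not_le)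
  have A_real: "?T \<le> t" if "t \<in> ?A" for t
  proof -
    have "t < ?z" using that by (simp add: killed_in_iff)
    then have "t < top" by (rule order.strict_trans2) simp
    then have t: "t = ennreal (enn2real t)" by simp
    have "W (enn2real t) \<omega> \<in> S" using that by (simp add: killed_in_iff)
    then have "?T \<le> ennreal (enn2real t)" by (intro hit_time_le) auto
    then show ?thesis using t by simp
  qed
  show ?thesis
  proof (cases "?A = {}")
    case True
    then have "?z \<le> ?T"
      using split unfolding hit_time_def by (intro Inf_greatest) auto
    then show ?thesis
      using True T_le by (auto simp: entry_time_def)
  next
    case False
    then obtain t0 where t0: "t0 \<in> ?A" by auto
    have "Inf ?A \<le> ?T"
      unfolding hit_time_def
    proof (rule Inf_greatest, clarify)
      fix t assume "0 \<le> t" "W t \<omega> \<in> S \<union> - {0<..<1}"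
      then consider "ennreal t \<in> ?A" | "?z \<le> ennreal t" using split by blast
      then show "Inf ?A \<le> ennreal t"
      proof cases
        case 1
        then show ?thesis by (rule Inf_lower)
      next
        case 2
        have "Inf ?A \<le> t0" using t0 by (rule Inf_lower)
        also have "t0 \<le> ?z" using t0 by (simp add: killed_in_iff less_imp_le)
        finally show ?thesis using 2 by simp
      qed
    qed
    moreover have "?T \<le> Inf ?A" using A_real by (intro Inf_greatest) auto
    ultimately have "Inf ?A = ?T" by (rule antisym)
    moreover have "entry_time W S \<omega> = Inf ?A"
      unfolding entry_time_def using t0 by (intro if_P) (simp, blast)
    ultimately show ?thesis by simp
  qed
qed

text \<open>By the intermediate value theorem, a path outside [c,d] at time t met an end point
  strictly earlier, and would have exited then.\<close>

lemma hit_time_interval: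
  assumes cont: "continuous_on {0..} (\<lambda>t. W t \<omega>)" and start: "W 0 \<omega> \<in> {c<..<d}"
    and t: "0 \<le> t" "ennreal t \<le> hit_time W (- {c<..<d}) \<omega>"
  shows "W t \<omega> \<in> {c..d}"
proof (rule ccontr)
  assume out: "W t \<omega> \<notin> {c..d}"
  have "\<exists>s. 0 \<le> s \<and> s < t \<and> (W s \<omega> = c \<or> W s \<omega> = d)"
  proof (cases "W t \<omega> < c")
    case True
    then have "\<exists>s\<ge>0. s \<le> t \<and> W s \<omega> = c"
      using start t cont by (intro IVT2') (auto intro: continuous_on_subset)
    then obtain s where "0 \<le> s" "s \<le> t" "W s \<omega> = c" by auto
    then show ?thesis using True by (intro exI[of _ s]) (auto simp: order_less_le)
  next
    case False
    then have "\<exists>s\<ge>0. s \<le> t \<and> W s \<omega> = d"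
      using start t cont out by (intro IVT') (auto intro: continuous_on_subset)
    then obtain s where "0 \<le> s" "s \<le> t" "W s \<omega> = d" by auto
    then show ?thesis using False out by (intro exI[of _ s]) (auto simp: order_less_le)
  qed
  then obtain s where s: "0 \<le> s" "s < t" "W s \<omega> \<in> - {c<..<d}" by auto
  then have "hit_time W (- {c<..<d}) \<omega> \<le> ennreal s" by (intro hit_time_le)
  also have "\<dots> < ennreal t" using s by (simp add: ennreal_less_iff)
  finally show False using t by simp
qed

lemma closed_Compl_Ioo: "closed (- {c<..<d::real})"
  by (simp add: closed_Compl)

lemma exit_position:
  assumes cont: "continuous_on {0..} (\<lambda>t. W t \<omega>)" and start: "W 0 \<omega> \<in> {c<..<d}"
    and fin: "hit_time W (- {c<..<d}) \<omega> < \<infinity>"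
  obtains t where "0 \<le> t" "hit_time W (- {c<..<d}) \<omega> = ennreal t" "W t \<omega> = c \<or> W t \<omega> = d"
proof -
  obtain t where t: "0 \<le> t" "hit_time W (- {c<..<d}) \<omega> = ennreal t" "W t \<omega> \<in> - {c<..<d}"
    by (rule hit_time_attained[where W=W and \<omega>=\<omega>, OF closed_Compl_Ioo cont fin])
  then have "W t \<omega> \<in> {c..d}" by (intro hit_time_interval[where W=W and \<omega>=\<omega>, OF cont start]) auto
  then show thesis using t by (intro that[of t]) auto
qed

text \<open>A continuous path cannot jump over c or d, so of F only the two ends of the gap around
  the starting point matter.\<close>

lemma hit_time_eq_exit:
  assumes cont: "continuous_on {0..} (\<lambda>t. W t \<omega>)" and start: "W 0 \<omega> \<in> {c<..<d}"
    and F: "c \<in> F" "d \<in> F" "F \<inter> {c<..<d} = {}"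
  shows "hit_time W F \<omega> = hit_time W (- {c<..<d}) \<omega>"
proof (rule antisym)
  show "hit_time W (- {c<..<d}) \<omega> \<le> hit_time W F \<omega>"
    using F by (intro hit_time_antimono) auto
  show "hit_time W F \<omega> \<le> hit_time W (- {c<..<d}) \<omega>"
  proof (cases "hit_time W (- {c<..<d}) \<omega> < \<infinity>")
    case True
    then obtain t where t: "0 \<le> t" "hit_time W (- {c<..<d}) \<omega> = ennreal t" "W t \<omega> = c \<or> W t \<omega> = d"
      by (rule exit_position[where W=W and \<omega>=\<omega>, OF cont start])
    then show ?thesis using F by (auto intro!: hit_time_le)
  qed (simp add: not_less top_unique)
qed

section \<open>Brownian motion and the completed filtration\<close>

context brownian_family
begin

lemma P_in_prob_algebra: "P x \<in> space (prob_algebra M)"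
  using kernel by (rule measurable_space) simp

lemma prob_space_P: "prob_space (P x)" and sets_P: "sets (P x) = sets M"
  using P_in_prob_algebra[of x] by (auto simp: space_prob_algebra)

lemma space_P: "space (P x) = space M"
  using sets_P by (rule sets_eq_imp_space_eq)

lemma sets_G_le: "sets (G t) \<subseteq> sets M" and space_G: "space (G t) = space M"
  using sub[of t] by (auto simp: subalgebra_def)

lemma measurable_G_imp_P: "f \<in> G t \<rightarrow>\<^sub>M N \<Longrightarrow> f \<in> P x \<rightarrow>\<^sub>M N"
  unfolding measurable_cong_sets[OF sets_P refl] by (rule measurable_from_subalg[OF sub])

lemma measurable_W: "0 \<le> t \<Longrightarrow> W t \<in> borel_measurable (P x)"
  by (rule measurable_G_imp_P[OF adapted])

section \<open>Universal completion and raw events\<close>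

lemma augmentation_subset:
  assumes "\<mu> \<in> space (prob_algebra borel)"
  shows "sets (G t) \<union> null_sets (completion (\<mu> \<bind> P)) \<subseteq> Pow (space M)"
proof -
  have "sets (\<mu> \<bind> P) = sets M"
    using assms kernel by (rule sets_bind')
  then have "space (completion (\<mu> \<bind> P)) = space M"
    unfolding space_completion by (rule sets_eq_imp_space_eq)
  then show ?thesis
    using sets.space_closed[of "G t"] sets.space_closed[of "completion (\<mu> \<bind> P)"]
    by (auto simp only: space_G null_sets_def)
qed

lemma return_in_prob_algebra: "return borel x \<in> space (prob_algebra borel)" for x :: real
  by (simp add: space_prob_algebra prob_space_return)

lemma bind_return_P: "return borel x \<bind> P = P x"
  using kernel by (intro bind_return measurable_prob_algebraD) auto

lemma space_universal_completion: "space (universal_completion P (G t)) = space M"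
  by (simp add: universal_completion_def space_measure_of_conv space_G)

lemma sets_universal_completion:
  "sets (universal_completion P (G t)) = sigma_sets (space M)
     (\<Inter>\<mu>\<in>space (prob_algebra borel).
        sigma_sets (space M) (sets (G t) \<union> null_sets (completion (\<mu> \<bind> P))))"
proof -
  \<comment> \<open>It suffices that one member of the intersection consists of subsets of the
    space; the law of the start at 0 serves.\<close>
  have "sigma_sets (space M) (sets (G t) \<union> null_sets (completion (return borel 0 \<bind> P))) \<subseteq> Pow (space M)"
    using sigma_sets_into_sp[OF augmentation_subset[OF return_in_prob_algebra]] by auto
  then show ?thesis
    unfolding universal_completion_def space_G
    using return_in_prob_algebra[of 0] by (intro sets_measure_of) blast
qed

lemma sets_G_le_universal_completion: "sets (G t) \<subseteq> sets (universal_completion P (G t))"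
  unfolding sets_universal_completion by (auto intro!: sigma_sets.Basic)

text \<open>The law of a single starting point is one of the laws over which the completion is intersected.\<close>

lemma universal_completion_AE:
  assumes "B \<in> sets (universal_completion P (G t))"
  shows "\<exists>B'\<in>sets (G t). AE \<omega> in P x. \<omega> \<in> B \<longleftrightarrow> \<omega> \<in> B'"
proof -
  have "sets (universal_completion P (G t)) \<subseteq>
      sigma_sets (space M) (sets (G t) \<union> null_sets (completion (return borel x \<bind> P)))"
    unfolding sets_universal_completion
    by (rule sigma_sets_mono) (use return_in_prob_algebra in blast)
  then have "B \<in> sigma_sets (space M) (sets (G t) \<union> null_sets (completion (P x)))"
    using assms by (auto simp: bind_return_P)
  then show ?thesis
  proof induction
    case (Basic B)
    then consider "B \<in> sets (G t)" | "B \<in> null_sets (completion (P x))" by auto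
    then show ?case
    proof cases
      case 2
      have "AE \<omega> in P x. \<omega> \<notin> B"
        using AE_not_in[OF 2] unfolding AE_completion_iff .
      then show ?thesis by (intro bexI[of _ "{}"]) auto
    qed auto
  next
    case Empty
    then show ?case by (intro bexI[of _ "{}"]) auto
  next
    case (Compl B)
    then obtain B' where B': "B' \<in> sets (G t)" "AE \<omega> in P x. \<omega> \<in> B \<longleftrightarrow> \<omega> \<in> B'" by auto
    then show ?case
      using sets.compl_sets[OF B'(1)] by (intro bexI[of _ "space M - B'"]) (auto simp: space_G)
  next
    case (Union B)
    then have "\<forall>i. \<exists>B'\<in>sets (G t). AE \<omega> in P x. \<omega> \<in> B i \<longleftrightarrow> \<omega> \<in> B'" by auto
    then obtain B' where B': "\<And>i. B' i \<in> sets (G t)" "\<And>i. AE \<omega> in P x. \<omega> \<in> B i \<longleftrightarrow> \<omega> \<in> B' i"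
      by metis
    have "AE \<omega> in P x. \<forall>i::nat. \<omega> \<in> B i \<longleftrightarrow> \<omega> \<in> B' i"
      using B'(2) by (simp add: AE_all_countable)
    then show ?case
      using B'(1) by (intro bexI[of _ "\<Union>i. B' i"]) auto
  qed
qed

text \<open>Gives the admissible stopping times their measurability under
  \<open>completion (P x)\<close>, the measure that \<open>payoff\<close> integrates
  against.\<close>

lemma universal_completion_subset_completion:
  "sets (universal_completion P (G t)) \<subseteq> sets (completion (P x))"
proof
  fix B assume B: "B \<in> sets (universal_completion P (G t))"
  obtain B' where B': "B' \<in> sets (G t)" "AE \<omega> in P x. \<omega> \<in> B \<longleftrightarrow> \<omega> \<in> B'"
    using universal_completion_AE[OF B] by auto
  show "B \<in> sets (completion (P x))"
  proof (rule completion.in_sets_AE)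
    show "AE \<omega> in completion (P x). \<omega> \<in> B' \<longleftrightarrow> \<omega> \<in> B"
      unfolding AE_completion_iff using B'(2) by eventually_elim auto
    show "B' \<in> sets (completion (P x))"
      using B'(1) sets_G_le[of t] by (auto simp: sets_P intro!: sets_completionI_sets)
    show "B \<subseteq> space (completion (P x))"
      using sets.sets_into_space[OF B] by (simp add: space_P space_universal_completion)
  qed
qed

section \<open>Increments as martingale differences\<close>

lemma increment_moments:
  assumes "0 \<le> s" "s < t"
  shows "integrable (P x) (\<lambda>\<omega>. W t \<omega> - W s \<omega>)" "(\<integral>\<omega>. (W t \<omega> - W s \<omega>) \<partial>P x) = 0"
    "integrable (P x) (\<lambda>\<omega>. (W t \<omega> - W s \<omega>)\<^sup>2)" "(\<integral>\<omega>. (W t \<omega> - W s \<omega>)\<^sup>2 \<partial>P x) = t - s"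
proof -
  interpret N: prob_space "P x" by (rule prob_space_P)
  have pos: "0 < sqrt (t - s)" using assms by simp
  note D = increments_normal[OF assms, of x]
  show *: "(\<integral>\<omega>. (W t \<omega> - W s \<omega>) \<partial>P x) = 0"
    using N.normal_distributed_expectation[OF pos D] .
  show "(\<integral>\<omega>. (W t \<omega> - W s \<omega>)\<^sup>2 \<partial>P x) = t - s"
    using N.normal_distributed_variance[OF pos D] assms by (simp add: *)
  show "integrable (P x) (\<lambda>\<omega>. W t \<omega> - W s \<omega>)"
    using distributed_integrable[OF D, of "\<lambda>z. z"] integrable_normal_moment_nz_1[OF pos, of 0] by simp
  show "integrable (P x) (\<lambda>\<omega>. (W t \<omega> - W s \<omega>)\<^sup>2)"
    using distributed_integrable[OF D, of "\<lambda>z. z\<^sup>2"] integrable_normal_moment[OF pos, of 0 2] by simp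
qed

text \<open>The martingale property in the form used by grid sums: a bounded factor known at time s
  is uncorrelated with the increment after s. The bound on q is asked only on B, because q will be
  an unbounded slope and B the event that the path is still inside a bounded interval.\<close>

lemma increment_orthogonal:
  assumes st: "0 \<le> s" "s < t" and B: "B \<in> sets (universal_completion P (G (ennreal s)))"
    and q[measurable]: "q \<in> borel_measurable borel"
    and bound: "\<And>\<omega>. \<omega> \<in> B \<Longrightarrow> \<bar>q (W s \<omega>)\<bar> \<le> K"
  shows "integrable (completion (P x)) (\<lambda>\<omega>. q (W s \<omega>) * indicator B \<omega> * (W t \<omega> - W s \<omega>))" (is "integrable ?C ?f")
    and "(\<integral>\<omega>. q (W s \<omega>) * indicator B \<omega> * (W t \<omega> - W s \<omega>) \<partial>completion (P x)) = 0"
proof -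
  interpret N: prob_space "P x" by (rule prob_space_P)
  obtain B' where B': "B' \<in> sets (G (ennreal s))" "AE \<omega> in P x. \<omega> \<in> B \<longleftrightarrow> \<omega> \<in> B'"
    using universal_completion_AE[OF B] by auto
  \<comment> \<open>Clipping at K makes the factor bounded everywhere and changes nothing on B;
    using \<open>B'\<close> makes it measurable for the raw \<open>G\<close>, for which independence
    is assumed.\<close>
  define X where "X \<omega> = max (- K) (min K (q (W s \<omega>))) * indicator B' \<omega>" for \<omega>
  define Y where "Y \<omega> = W t \<omega> - W s \<omega>" for \<omega>
  have Ws[measurable]: "W s \<in> borel_measurable (G (ennreal s))"
    using st by (intro adapted)
  note B'(1)[measurable]
  have X_G: "X \<in> borel_measurable (G (ennreal s))"
    unfolding X_def by measurable
  have X: "X \<in> borel_measurable (P x)"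
    using X_G by (rule measurable_G_imp_P)
  have Y: "Y \<in> borel_measurable (P x)"
    unfolding Y_def using st by (intro borel_measurable_diff measurable_W) auto
  have indep: "N.indep_var borel X borel Y"
    unfolding N.indep_var_eq
  proof (intro conjI X Y)
    have "N.indep_set (sets (G (ennreal s))) (sets (vimage_algebra (space M) Y borel))"
      using increments_indep[OF st] by (simp add: Y_def[abs_def])
    moreover have "sigma_sets (space (P x)) {X -` A \<inter> space (P x) |A. A \<in> sets borel} \<subseteq> sets (G (ennreal s))"
      using measurable_sets[OF X_G] unfolding space_P space_G[of "ennreal s", symmetric]
      by (intro sets.sigma_sets_subset) auto
    moreover have "sigma_sets (space (P x)) {Y -` A \<inter> space (P x) |A. A \<in> sets borel} \<subseteq> sets (vimage_algebra (space M) Y borel)"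
      by (simp add: sets_vimage_algebra space_P)
    ultimately show "N.indep_set (sigma_sets (space (P x)) {X -` A \<inter> space (P x) |A. A \<in> sets borel})
        (sigma_sets (space (P x)) {Y -` A \<inter> space (P x) |A. A \<in> sets borel})"
      unfolding N.indep_sets2_eq by (meson subset_iff order_trans)
  qed
  have X_int: "integrable (P x) X"
  proof (rule N.integrable_const_bound)
    show "AE \<omega> in P x. norm (X \<omega>) \<le> \<bar>K\<bar>"
      by (auto simp: X_def indicator_def)
  qed (rule X)
  have Y_int: "integrable (P x) Y" "integral\<^sup>L (P x) Y = 0"
    unfolding Y_def using increment_moments[OF st] by auto
  have XY: "integrable (P x) (\<lambda>\<omega>. X \<omega> * Y \<omega>)" "(\<integral>\<omega>. X \<omega> * Y \<omega> \<partial>P x) = 0"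
    using N.indep_var_integrable[OF indep X_int Y_int(1)]
      N.indep_var_lebesgue_integral[OF indep X_int Y_int(1)] Y_int(2) by auto
  have [measurable]: "B \<in> sets ?C"
    using B universal_completion_subset_completion by blast
  have [measurable]: "W s \<in> borel_measurable ?C" "W t \<in> borel_measurable ?C"
    "X \<in> borel_measurable ?C" "Y \<in> borel_measurable ?C"
    using st X Y by (auto intro!: measurable_completion measurable_W)
  have eq: "AE \<omega> in ?C. X \<omega> * Y \<omega> = ?f \<omega>"
    unfolding AE_completion_iff using B'(2)
    by eventually_elim (use bound in \<open>fastforce simp: X_def Y_def indicator_def abs_le_iff\<close>)
  have "integrable ?C ?f \<longleftrightarrow> integrable ?C (\<lambda>\<omega>. X \<omega> * Y \<omega>)"
    using eq by (intro integrable_cong_AE) (measurable, auto elim: eventually_mono)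
  then show "integrable ?C ?f"
    using XY(1) X Y by (simp add: integrable_completion)
  have "integral\<^sup>L ?C (\<lambda>\<omega>. X \<omega> * Y \<omega>) = integral\<^sup>L ?C ?f"
    using eq by (intro integral_cong_AE) measurable
  then show "integral\<^sup>L ?C ?f = 0"
    using XY X Y by (simp add: integral_completion)
qed


section \<open>Hitting times as stopping times\<close>

text \<open>The distance to F attains its minimum along a path on a compact time interval, and the
  minimum is 0 as soon as a dense set of times brings it arbitrarily close to 0. This replaces an
  uncountable union of events by countable operations.\<close>

lemma hit_set_countable:
  fixes w :: "real \<Rightarrow> real"
  assumes cont: "continuous_on {0..t} w" and F: "closed F" "F \<noteq> {}"
    and D: "D \<subseteq> {0..t}" "{0..t} \<subseteq> closure D"
  shows "(\<exists>s\<in>{0..t}. w s \<in> F) \<longleftrightarrow> (\<forall>n. \<exists>s\<in>D. infdist (w s) F < inverse (real (Suc n)))"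
    (is "?L = ?R")
proof
  have cont': "continuous_on {0..t} (\<lambda>s. infdist (w s) F)"
    using cont by (intro continuous_on_infdist)
  {
    assume ?L
    then obtain s where s: "s \<in> {0..t}" "infdist (w s) F = 0"
      by (auto simp: in_closed_iff_infdist_zero[OF F])
    show ?R
    proof
      fix n
      obtain \<delta> where \<delta>: "\<delta> > 0" "\<And>s'. s' \<in> {0..t} \<Longrightarrow> dist s' s < \<delta> \<Longrightarrow>
          dist (infdist (w s') F) (infdist (w s) F) < inverse (real (Suc n))"
        using cont' s(1) unfolding continuous_on_iff by (metis inverse_positive_iff_positive of_nat_0_less_iff zero_less_Suc)
      obtain s' where "s' \<in> D" "dist s' s < \<delta>"
        using s(1) D(2) \<delta>(1) by (meson closure_approachable subsetD)
      then show "\<exists>s\<in>D. infdist (w s) F < inverse (real (Suc n))"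
        using \<delta>(2)[of s'] D(1) s(2) by (auto simp: dist_real_def intro!: bexI[of _ s'])
    qed
  }
  assume R: ?R
  then have "{0..t} \<noteq> {}" using D(1) by fastforce
  then obtain s where s: "s \<in> {0..t}" "\<And>s'. s' \<in> {0..t} \<Longrightarrow> infdist (w s) F \<le> infdist (w s') F"
    using continuous_attains_inf[OF _ _ cont'] by auto
  have "infdist (w s) F < inverse (real (Suc n))" for n
    using R[rule_format, of n] s(2) D(1) by (meson order.strict_trans1 subsetD)
  then have "\<not> 0 < infdist (w s) F"
    using reals_Archimedean by (metis not_less_iff_gr_or_eq)
  then have "infdist (w s) F = 0"
    using infdist_nonneg[of "w s" F] by simp
  then show ?L
    using s(1) by (auto simp: in_closed_iff_infdist_zero[OF F])
qed

text \<open>The events at finite times are already raw. The set must be nonempty for the distance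
  criterion, since \<open>infdist\<close> to the empty set is 0 by convention.\<close>

lemma stopping_time_hit:
  assumes F: "closed F" "F \<noteq> {}"
  shows "hit_time W F \<in> stopping_times P G"
proof -
  have "{\<omega> \<in> space M. hit_time W F \<omega> \<le> t} \<in> sets (universal_completion P (G t))" for t
  proof (cases t)
    case (real r)
    obtain D where D: "countable D" "D \<subseteq> {0..r}" "{0..r} \<subseteq> closure D"
      using separable[of "{0..r}"] by auto
    have "{\<omega> \<in> space M. hit_time W F \<omega> \<le> t}
        = {\<omega> \<in> space (G t). \<forall>n. \<exists>s\<in>D. infdist (W s \<omega>) F < inverse (real (Suc n))}"
    proof -
      have "hit_time W F \<omega> \<le> t \<longleftrightarrow> (\<forall>n. \<exists>s\<in>D. infdist (W s \<omega>) F < inverse (real (Suc n)))"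
        if "\<omega> \<in> space M" for \<omega>
        using hit_time_le_iff[where W=W and \<omega>=\<omega>, OF F(1) continuous_paths[OF that] real(1)]
          hit_set_countable[OF continuous_on_subset[OF continuous_paths[OF that]] F D(2,3)] real
        by auto
      then show ?thesis by (auto simp: space_G)
    qed
    also have "\<dots> \<in> sets (G t)"
    proof -
      have [measurable]: "W s \<in> borel_measurable (G t)" if "s \<in> D" for s
      proof (rule measurable_from_subalg)
        have "0 \<le> s" "s \<le> r" using that D(2) by auto
        then show "W s \<in> borel_measurable (G (ennreal s))" by (intro adapted)
        show "subalgebra (G t) (G (ennreal s))"
          using \<open>s \<le> r\<close> real sets_F_mono[of "ennreal s" t]
          by (auto simp: subalgebra_def space_G ennreal_leI)
      qed
      have [measurable]: "(\<lambda>y. infdist y F) \<in> borel_measurable borel"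
        by (intro borel_measurable_continuous_onI continuous_intros)
      show ?thesis using D(1) by measurable
    qed
    finally show ?thesis using sets_G_le_universal_completion by blast
  next
    case top
    then show ?thesis
      using sets.top[of "universal_completion P (G t)"] by (simp add: space_universal_completion)
  qed
  then show ?thesis
    by (auto simp: stopping_times_def stopping_time_def pred_def space_universal_completion)
qed

lemma stopping_time_entry:
  assumes "closed S"
  shows "entry_time W S \<in> stopping_times P G"
proof -
  have "entry_time W S = hit_time W (S \<union> - {0<..<1})"
    by (intro ext entry_time_eq_hit_time)
  moreover have "closed (S \<union> - {0<..<1})"
    using assms by (intro closed_Un closed_Compl_Ioo)
  moreover have "(2::real) \<in> S \<union> - {0<..<1}" by simp
  ultimately show ?thesis
    using stopping_time_hit by (metis empty_iff)
qed

lemma stopping_times_sets: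
  assumes "\<rho> \<in> stopping_times P G"
  shows "{\<omega> \<in> space M. t < \<rho> \<omega>} \<in> sets (universal_completion P (G t))"
  using stopping_timeD2[of "\<lambda>t. universal_completion P (G t)" \<rho> t] assms
  by (simp add: stopping_times_def pred_def space_universal_completion)

lemma measurable_stopping_times:
  assumes "\<rho> \<in> stopping_times P G"
  shows "\<rho> \<in> borel_measurable (completion (P x))"
  using assms unfolding stopping_times_def
  by (intro measurable_stopping_time[OF _ universal_completion_subset_completion])
    (simp_all add: space_universal_completion space_P)

lemma stopping_times_min:
  "\<rho> \<in> stopping_times P G \<Longrightarrow> \<sigma> \<in> stopping_times P G \<Longrightarrow> (\<lambda>\<omega>. min (\<rho> \<omega>) (\<sigma> \<omega>)) \<in> stopping_times P G"
  by (auto simp: stopping_times_def intro: stopping_time_min)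

text \<open>The random time is approximated from below by times with countably many values, at which
  the position is measurable; continuity of the paths passes to the limit.\<close>

lemma measurable_random_time:
  assumes r[measurable]: "r \<in> borel_measurable (completion (P x))" and nonneg: "\<And>\<omega>. 0 \<le> r \<omega>"
  shows "(\<lambda>\<omega>. W (r \<omega>) \<omega>) \<in> borel_measurable (completion (P x))" (is "_ \<in> borel_measurable ?C")
proof (rule borel_measurable_LIMSEQ_real)
  define g where "g n \<omega> = nat \<lfloor>real (Suc n) * r \<omega>\<rfloor>" for n \<omega>
  have [measurable]: "g n \<in> ?C \<rightarrow>\<^sub>M count_space UNIV" for n
    unfolding g_def by measurable
  show "(\<lambda>\<omega>. W (real (g n \<omega>) / real (Suc n)) \<omega>) \<in> borel_measurable ?C" for n
    by (rule measurable_compose_countable[where f="\<lambda>k \<omega>. W (real k / real (Suc n)) \<omega>" and g="g n"])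
      (auto intro!: measurable_completion measurable_W)
  fix \<omega> assume "\<omega> \<in> space ?C"
  then have cont: "continuous_on {0..} (\<lambda>t. W t \<omega>)"
    by (intro continuous_paths) (simp add: space_P)
  have "(\<lambda>n. real (g n \<omega>) / real (Suc n)) \<longlonglongrightarrow> r \<omega>"
  proof (rule tendsto_sandwich)
    have bounds: "real (Suc n) * r \<omega> - 1 \<le> real (g n \<omega>)" "real (g n \<omega>) \<le> real (Suc n) * r \<omega>" for n
    proof -
      have "0 \<le> real (Suc n) * r \<omega>" using nonneg by simp
      then have "real (g n \<omega>) = of_int \<lfloor>real (Suc n) * r \<omega>\<rfloor>" by (simp add: g_def)
      then show "real (Suc n) * r \<omega> - 1 \<le> real (g n \<omega>)" "real (g n \<omega>) \<le> real (Suc n) * r \<omega>"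
        by linarith+
    qed
    show "\<forall>\<^sub>F n in sequentially. r \<omega> - inverse (real (Suc n)) \<le> real (g n \<omega>) / real (Suc n)"
    proof (intro always_eventually allI)
      fix n
      have "(real (Suc n) * r \<omega> - 1) / real (Suc n) \<le> real (g n \<omega>) / real (Suc n)"
        using bounds(1) by (intro divide_right_mono) auto
      then show "r \<omega> - inverse (real (Suc n)) \<le> real (g n \<omega>) / real (Suc n)"
        by (simp add: diff_divide_distrib inverse_eq_divide del: of_nat_Suc)
    qed
    show "\<forall>\<^sub>F n in sequentially. real (g n \<omega>) / real (Suc n) \<le> r \<omega>"
      using bounds(2) by (intro always_eventually allI) (simp add: field_simps del: of_nat_Suc)
    show "(\<lambda>n. r \<omega> - inverse (real (Suc n))) \<longlonglongrightarrow> r \<omega>"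
      using tendsto_diff[OF tendsto_const LIMSEQ_inverse_real_of_nat, of "r \<omega>"] by simp
  qed simp
  then show "(\<lambda>n. W (real (g n \<omega>) / real (Suc n)) \<omega>) \<longlonglongrightarrow> W (r \<omega>) \<omega>"
    by (rule continuous_on_tendsto_compose[OF cont]) (use nonneg in auto)
qed

text \<open>The density of an increment over time n + 1 is at most 1 / sqrt (2 \<pi> (n + 1)), so
  the probability of lying in a window of fixed length tends to 0. Almost surely some integer time
  thus finds the path outside (c,d).\<close>

lemma AE_exit_finite: "AE \<omega> in completion (P x). hit_time W (- {c<..<d}) \<omega> < \<infinity>"
proof -
  interpret N: prob_space "P x" by (rule prob_space_P)
  have [measurable]: "W t \<in> borel_measurable (P x)" if "0 \<le> t" for t
    using that by (rule measurable_W)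
  define A where "A n = {\<omega> \<in> space (P x). W (real (Suc n)) \<omega> - W 0 \<omega> \<in> {c - x..d - x}}" for n
  have [measurable]: "A n \<in> sets (P x)" for n unfolding A_def by measurable
  \<comment> \<open>The absolute value makes the bound valid also when d < c.\<close>
  define L where "L = \<bar>d - c\<bar>"
  have A_le: "emeasure (P x) (A n) \<le> ennreal (L / sqrt (2 * pi * real (Suc n)))" for n
  proof -
    let ?\<sigma> = "sqrt (real (Suc n) - 0)"
    have "emeasure (P x) (A n) = (\<integral>\<^sup>+z. ennreal (normal_density 0 ?\<sigma> z) * indicator {c - x..d - x} z \<partial>lborel)"
      using distributed_emeasure[OF increments_normal[of 0 "real (Suc n)" x], of "{c - x..d - x}"]
      by (simp add: A_def vimage_def Int_def conj_commute)
    also have "\<dots> \<le> (\<integral>\<^sup>+z. ennreal (1 / sqrt (2 * pi * real (Suc n))) * indicator {c - x..d - x} z \<partial>lborel)"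
      by (intro nn_integral_mono mult_right_mono ennreal_leI)
        (auto simp: normal_density_def divide_simps)
    also have "\<dots> = ennreal (1 / sqrt (2 * pi * real (Suc n))) * emeasure lborel {c - x..d - x}"
      by (simp add: nn_integral_cmult_indicator)
    also have "\<dots> \<le> ennreal (1 / sqrt (2 * pi * real (Suc n))) * ennreal L"
      by (intro mult_left_mono) (auto simp: L_def emeasure_lborel_Icc_eq intro!: ennreal_leI)
    also have "\<dots> = ennreal (L / sqrt (2 * pi * real (Suc n)))"
      by (simp add: L_def flip: ennreal_mult)
    finally show ?thesis .
  qed
  have lim: "(\<lambda>n. ennreal (L / sqrt (2 * pi * real (Suc n)))) \<longlonglongrightarrow> 0"
  proof -
    have "(\<lambda>n. L / sqrt (2 * pi * real (Suc n))) \<longlonglongrightarrow> 0"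
      by real_asymp
    then show ?thesis using tendsto_ennrealI by fastforce
  qed
  have "emeasure (P x) (\<Inter>n. A n) \<le> ennreal (L / sqrt (2 * pi * real (Suc n)))" for n
    by (rule order_trans[OF emeasure_mono A_le]) auto
  then have "emeasure (P x) (\<Inter>n. A n) \<le> 0"
    by (intro LIMSEQ_le_const[OF lim]) auto
  then have "(\<Inter>n. A n) \<in> null_sets (P x)" by auto
  from AE_not_in[OF this] start[of x] AE_space show ?thesis
    unfolding AE_completion_iff
  proof eventually_elim
    case (elim \<omega>)
    then obtain n where "\<omega> \<notin> A n" by auto
    then have "W (real (Suc n)) \<omega> \<in> - {c<..<d}"
      using elim by (auto simp: A_def)
    then have "hit_time W (- {c<..<d}) \<omega> \<le> ennreal (real (Suc n))"
      by (intro hit_time_le) auto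
    also have "\<dots> < \<infinity>" by simp
    finally show ?case .
  qed
qed

end

section \<open>Optional stopping of concave functions\<close>

text \<open>The increments over steps that begin before \<rho> telescope to the grid point j to
  which \<rho>, capped at m h, is rounded up. Rounding up is what makes each indicator depend only
  on the past of its step.\<close>

lemma grid_telescope:
  fixes \<rho> :: ennreal and h :: real
  assumes h: "0 < h"
  shows "\<exists>j. min \<rho> (ennreal (real m * h)) \<le> ennreal (real j * h) \<and>
      ennreal (real j * h) \<le> min \<rho> (ennreal (real m * h)) + ennreal h \<and> j \<le> m \<and>
      (\<forall>Y::nat \<Rightarrow> real. Y j = Y 0 + (\<Sum>k<m. (Y (Suc k) - Y k) * of_bool (ennreal (real k * h) < \<rho>)))"
    (is "\<exists>j. ?A m j \<and> ?B m j \<and> j \<le> m \<and> ?C m j")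
proof (induction m)
  case 0
  show ?case by (intro exI[of _ 0]) auto
next
  case (Suc m)
  then obtain j where j: "?A m j" "?B m j" "j \<le> m" "?C m j" by auto
  show ?case
  proof (cases "ennreal (real m * h) < \<rho>")
    case True
    then have "ennreal (real m * h) \<le> ennreal (real j * h)"
      using j(1) by simp
    then have jm: "j = m"
      using h j(3) by (auto simp: ennreal_le_iff)
    have "ennreal (real (Suc m) * h) = ennreal (real m * h) + ennreal h"
      using h by (simp add: distrib_right flip: ennreal_plus)
    also have "\<dots> \<le> min \<rho> (ennreal (real (Suc m) * h)) + ennreal h"
      using True h by (intro add_right_mono) (auto intro!: ennreal_leI mult_right_mono)
    finally have "?B (Suc m) (Suc m)" .
    moreover have "?C (Suc m) (Suc m)"
    proof
      fix Y :: "nat \<Rightarrow> real"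
      have "Y m = Y 0 + (\<Sum>k<m. (Y (Suc k) - Y k) * of_bool (ennreal (real k * h) < \<rho>))"
        using j(4) jm by blast
      then show "Y (Suc m) = Y 0 + (\<Sum>k<Suc m. (Y (Suc k) - Y k) * of_bool (ennreal (real k * h) < \<rho>))"
        using True by simp
    qed
    ultimately show ?thesis by (intro exI[of _ "Suc m"]) simp
  next
    case False
    then have \<rho>: "\<rho> \<le> ennreal (real m * h)" by simp
    also have "\<dots> \<le> ennreal (real (Suc m) * h)"
      using h by (intro ennreal_leI mult_right_mono) auto
    finally have "min \<rho> (ennreal (real (Suc m) * h)) = min \<rho> (ennreal (real m * h))"
      using \<rho> by (simp add: min_absorb1)
    then show ?thesis
      using j False by (intro exI[of _ j]) auto
  qed
qed

text \<open>The rounded time differs from the true one by at most the mesh T / (n + 1), so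
  continuity of the path gives the limit. The range statement hands every lower bound of v on to the
  discretised process.\<close>

lemma grid_limit:
  fixes \<rho> :: ennreal and w :: "real \<Rightarrow> real" and v :: "real \<Rightarrow> real"
  assumes cont: "continuous_on {0..} w" and v: "continuous_on UNIV v" and T: "0 < T"
  defines "h n \<equiv> T / real (Suc n)"
  defines "Y n \<equiv> v (w 0) + (\<Sum>k<Suc n. (v (w (real (Suc k) * h n)) - v (w (real k * h n)))
      * of_bool (ennreal (real k * h n) < \<rho>))"
  shows "Y \<longlonglongrightarrow> v (w (enn2real (min \<rho> (ennreal T))))" and "\<And>n. Y n \<in> range v"
proof -
  let ?r = "enn2real (min \<rho> (ennreal T))"
  have "\<forall>n. \<exists>j. \<bar>real j * h n - ?r\<bar> \<le> h n \<and> Y n = v (w (real j * h n))"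
  proof
    fix n
    have h: "0 < h n" and T_eq: "real (Suc n) * h n = T" using T by (auto simp: h_def)
    obtain j where j: "min \<rho> (ennreal T) \<le> ennreal (real j * h n)"
        "ennreal (real j * h n) \<le> min \<rho> (ennreal T) + ennreal (h n)"
        "\<And>Y::nat \<Rightarrow> real. Y j = Y 0 + (\<Sum>k<Suc n. (Y (Suc k) - Y k) * of_bool (ennreal (real k * h n) < \<rho>))"
      using grid_telescope[OF h, of \<rho> "Suc n"] unfolding T_eq by blast
    have r: "min \<rho> (ennreal T) = ennreal ?r"
      by (cases \<rho>) (auto simp: min_def ennreal_enn2real_if top_unique)
    have "?r \<le> real j * h n"
      using j(1) h by (subst (asm) r) (simp add: ennreal_le_iff)
    moreover have "real j * h n \<le> ?r + h n"
      using j(2) h by (subst (asm) r) (simp flip: ennreal_plus add: ennreal_le_iff)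
    moreover have "Y n = v (w (real j * h n))"
      unfolding Y_def using j(3)[of "\<lambda>k. v (w (real k * h n))"] by simp
    ultimately show "\<exists>j. \<bar>real j * h n - ?r\<bar> \<le> h n \<and> Y n = v (w (real j * h n))"
      using h by (intro exI[of _ j]) auto
  qed
  then obtain j where j: "\<And>n. \<bar>real (j n) * h n - ?r\<bar> \<le> h n" "\<And>n. Y n = v (w (real (j n) * h n))"
    by metis
  show "\<And>n. Y n \<in> range v" using j(2) by auto
  have "h \<longlonglongrightarrow> 0"
    unfolding h_def by real_asymp
  then have "(\<lambda>n. real (j n) * h n - ?r) \<longlonglongrightarrow> 0"
    by (rule Lim_null_comparison[rotated]) (use j(1) in auto)
  then have "(\<lambda>n. real (j n) * h n) \<longlonglongrightarrow> ?r"
    by (simp add: LIM_zero_iff)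
  moreover have "continuous_on {0..} (\<lambda>t. v (w t))"
    using cont v by (intro continuous_on_compose2[OF v]) auto
  moreover have "0 \<le> real (j n) * h n" for n
    using T by (simp add: h_def)
  ultimately have "(\<lambda>n. v (w (real (j n) * h n))) \<longlonglongrightarrow> v (w ?r)"
    by (intro continuous_on_tendsto_compose[of "{0..}" "\<lambda>t. v (w t)"]) auto
  moreover have "Y = (\<lambda>n. v (w (real (j n) * h n)))"
    using j(2) by (rule ext)
  ultimately show "Y \<longlonglongrightarrow> v (w ?r)" by simp
qed

context brownian_family
begin

text \<open>
  The quadratic term makes it possible to choose \<open>v\<close> bounded below although the discretised
  process overshoots the interval, so that Fatou's lemma applies.
\<close>

lemma stopped_supermartingale_bound:
  assumes \<rho>: "\<rho> \<in> stopping_times P G" and T: "0 < T"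
    and exit: "\<And>\<omega>. \<omega> \<in> space M \<Longrightarrow> \<rho> \<omega> \<le> hit_time W (- {c<..<d}) \<omega>"
    and v: "continuous_on UNIV v" and m: "\<And>w. m \<le> v w"
    and q[measurable]: "q \<in> borel_measurable borel" and K: "\<And>w. w \<in> {c<..<d} \<Longrightarrow> \<bar>q w\<bar> \<le> K"
    and \<epsilon>: "0 \<le> \<epsilon>"
    and step: "\<And>w w'. w \<in> {c<..<d} \<Longrightarrow> v w' - v w \<le> q w * (w' - w) + \<epsilon> * (w' - w)\<^sup>2"
  shows "(\<integral>\<^sup>+\<omega>. ennreal (v (W (enn2real (min (\<rho> \<omega>) (ennreal T))) \<omega>) - m) \<partial>completion (P x))
    \<le> ennreal (v x - m + \<epsilon> * T)"
proof -
  let ?C = "completion (P x)"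
  interpret N: prob_space "P x" by (rule prob_space_P)
  define h where "h n = T / real (Suc n)" for n
  define B where "B n k = {\<omega> \<in> space M. ennreal (real k * h n) < \<rho> \<omega>}" for n k
  define Y where "Y n \<omega> = v (W 0 \<omega>) + (\<Sum>k<Suc n. (v (W (real (Suc k) * h n) \<omega>) - v (W (real k * h n) \<omega>))
      * of_bool (ennreal (real k * h n) < \<rho> \<omega>))" for n \<omega>
  define I where "I n k \<omega> = q (W (real k * h n) \<omega>) * indicator (B n k) \<omega> * (W (real (Suc k) * h n) \<omega> - W (real k * h n) \<omega>)" for n k \<omega>
  define Q where "Q n k \<omega> = (W (real (Suc k) * h n) \<omega> - W (real k * h n) \<omega>)\<^sup>2" for n k \<omega>
  \<comment> \<open>An upper bound for \<open>Y n - m\<close> with the same integral for every n: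
    the terms \<open>I\<close> integrate to 0, and the n + 1 squares \<open>Q\<close> contribute
    \<epsilon> (n + 1) (T / (n + 1)) = \<epsilon> T.\<close>
  define R where "R n \<omega> = v (W 0 \<omega>) - m + (\<Sum>k<Suc n. I n k \<omega> + \<epsilon> * Q n k \<omega>)" for n \<omega>
  have h: "0 < h n" for n using T by (simp add: h_def)
  have grid: "0 \<le> real k * h n" "real k * h n < real (Suc k) * h n" for n k
    using h[of n] by (auto simp: mult_less_cancel_right)
  have B_sets: "B n k \<in> sets (universal_completion P (G (ennreal (real k * h n))))" for n k
    unfolding B_def by (rule stopping_times_sets[OF \<rho>])
  \<comment> \<open>Steps that count begin inside (c,d), the only place where \<open>step\<close>
    and the bound on q are assumed; where they end is unrestricted.\<close>
  have inside: "W (real k * h n) \<omega> \<in> {c<..<d}" if "\<omega> \<in> B n k" for n k \<omega>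
  proof -
    have "ennreal (real k * h n) < hit_time W (- {c<..<d}) \<omega>"
      using that exit[of \<omega>] by (auto simp: B_def)
    then show ?thesis
      using not_in_before_hit_time[where W=W and \<omega>=\<omega>, OF grid(1)] by blast
  qed
  have I: "integrable ?C (I n k)" "integral\<^sup>L ?C (I n k) = 0" for n k
    unfolding I_def
    by (rule increment_orthogonal[OF grid B_sets q K[OF inside]]; assumption)+
  have Q_meas: "Q n k \<in> borel_measurable (P x)" for n k
    unfolding Q_def using grid[of k n] grid[of "Suc k" n]
    by (intro borel_measurable_power borel_measurable_diff measurable_W)
  have Q: "integrable ?C (Q n k)" "integral\<^sup>L ?C (Q n k) = h n" for n k
    using increment_moments(3,4)[OF grid[of k n], of x] Q_meas[of n k]
    by (simp_all add: integrable_completion integral_completion Q_def[abs_def] algebra_simps)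
  have v_meas[measurable]: "v \<in> borel_measurable borel"
    using v by (rule borel_measurable_continuous_onI)
  have W_meas[measurable]: "W t \<in> borel_measurable ?C" if "0 \<le> t" for t
    using that by (intro measurable_completion measurable_W)
  have Wgrid_meas[measurable]: "W (real k * h n) \<in> borel_measurable ?C" for k n
    using grid(1) by (rule W_meas)
  have [measurable]: "\<rho> \<in> borel_measurable ?C"
    by (rule measurable_stopping_times[OF \<rho>])
  have Y_meas[measurable]: "Y n \<in> borel_measurable ?C" for n
    unfolding Y_def by measurable
  have v0: "AE \<omega> in ?C. v (W 0 \<omega>) - m = v x - m"
    unfolding AE_completion_iff using start[of x] by eventually_elim simp
  have v0_meas: "(\<lambda>\<omega>. v (W 0 \<omega>) - m) \<in> borel_measurable ?C" by measurable
  have C1: "emeasure ?C (space ?C) = 1" using N.emeasure_space_1 by simp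
  interpret C: prob_space ?C by (rule prob_spaceI) (rule C1)
  have v0_int: "integrable ?C (\<lambda>\<omega>. v (W 0 \<omega>) - m)" "integral\<^sup>L ?C (\<lambda>\<omega>. v (W 0 \<omega>) - m) = v x - m"
    using integrable_cong_AE[OF v0_meas _ v0] integral_cong_AE[OF v0_meas _ v0]
    by (simp_all add: N.prob_space)
  have R: "integrable ?C (R n)" "integral\<^sup>L ?C (R n) = v x - m + \<epsilon> * T" for n
  proof -
    have s: "integrable ?C (\<lambda>\<omega>. \<Sum>k<Suc n. I n k \<omega> + \<epsilon> * Q n k \<omega>)"
      by (intro Bochner_Integration.integrable_sum Bochner_Integration.integrable_add integrable_mult_right I Q)
    show "integrable ?C (R n)"
      unfolding R_def by (intro Bochner_Integration.integrable_add v0_int s)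
    have "integral\<^sup>L ?C (R n) = v x - m + (\<Sum>k<Suc n. 0 + \<epsilon> * h n)"
      unfolding R_def using I Q
      by (subst Bochner_Integration.integral_add[OF v0_int(1) s], subst Bochner_Integration.integral_sum)
        (auto simp: v0_int)
    then show "integral\<^sup>L ?C (R n) = v x - m + \<epsilon> * T"
      by (simp add: h_def del: sum.lessThan_Suc)
  qed
  have Y_lim: "(\<lambda>n. Y n \<omega>) \<longlonglongrightarrow> v (W (enn2real (min (\<rho> \<omega>) (ennreal T))) \<omega>)"
    and Y_ge: "m \<le> Y n \<omega>" if "\<omega> \<in> space M" for n \<omega>
  proof -
    note gl = grid_limit[OF continuous_paths[OF that] v T, where \<rho>="\<rho> \<omega>", folded h_def, folded Y_def]
    show "(\<lambda>n. Y n \<omega>) \<longlonglongrightarrow> v (W (enn2real (min (\<rho> \<omega>) (ennreal T))) \<omega>)" by (rule gl(1))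
    show "m \<le> Y n \<omega>" using gl(2)[of n] m by auto
  qed
  have Y_le: "Y n \<omega> - m \<le> R n \<omega>" if "\<omega> \<in> space M" for n \<omega>
  proof -
    have "(v (W (real (Suc k) * h n) \<omega>) - v (W (real k * h n) \<omega>)) * of_bool (ennreal (real k * h n) < \<rho> \<omega>)
        \<le> I n k \<omega> + \<epsilon> * Q n k \<omega>" for k
    proof (cases "\<omega> \<in> B n k")
      case True
      then show ?thesis
        using step[OF inside[OF True]] by (simp add: I_def Q_def B_def)
    next
      case False
      then show ?thesis
        using that \<epsilon> by (simp add: I_def Q_def B_def)
    qed
    from sum_mono[of "{..<Suc n}" "\<lambda>k. _ k" "\<lambda>k. I n k \<omega> + \<epsilon> * Q n k \<omega>", OF this] show ?thesis
      unfolding Y_def R_def by linarith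
  qed
  have "(\<integral>\<^sup>+\<omega>. ennreal (v (W (enn2real (min (\<rho> \<omega>) (ennreal T))) \<omega>) - m) \<partial>?C)
      = (\<integral>\<^sup>+\<omega>. liminf (\<lambda>n. ennreal (Y n \<omega> - m)) \<partial>?C)"
  proof (rule nn_integral_cong)
    fix \<omega> assume "\<omega> \<in> space ?C"
    then have "(\<lambda>n. ennreal (Y n \<omega> - m)) \<longlonglongrightarrow> ennreal (v (W (enn2real (min (\<rho> \<omega>) (ennreal T))) \<omega>) - m)"
      by (intro tendsto_ennrealI tendsto_diff Y_lim tendsto_const) (simp add: space_P)
    then show "ennreal (v (W (enn2real (min (\<rho> \<omega>) (ennreal T))) \<omega>) - m) = liminf (\<lambda>n. ennreal (Y n \<omega> - m))"
      by (simp add: lim_imp_Liminf)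
  qed
  also have "\<dots> \<le> liminf (\<lambda>n. \<integral>\<^sup>+\<omega>. ennreal (Y n \<omega> - m) \<partial>?C)"
    by (rule nn_integral_liminf) measurable
  also have "\<dots> \<le> liminf (\<lambda>n. ennreal (v x - m + \<epsilon> * T))"
  proof (intro Liminf_mono always_eventually allI)
    fix n
    have "(\<integral>\<^sup>+\<omega>. ennreal (Y n \<omega> - m) \<partial>?C) \<le> (\<integral>\<^sup>+\<omega>. ennreal (R n \<omega>) \<partial>?C)"
      using Y_le by (intro nn_integral_mono ennreal_leI) (auto simp: space_P)
    also have "\<dots> = ennreal (v x - m + \<epsilon> * T)"
    proof (subst nn_integral_eq_integral)
      have "0 \<le> R n \<omega>" if "\<omega> \<in> space M" for \<omega>
        using Y_le[OF that, of n] Y_ge[OF that, of n] by linarith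
      then show "AE \<omega> in ?C. 0 \<le> R n \<omega>" by (auto simp: space_P)
    qed (use R[of n] in auto)
    finally show "(\<integral>\<^sup>+\<omega>. ennreal (Y n \<omega> - m) \<partial>?C) \<le> ennreal (v x - m + \<epsilon> * T)" .
  qed
  also have "\<dots> = ennreal (v x - m + \<epsilon> * T)"
    by (simp add: Liminf_const)
  finally show ?thesis .
qed

end

lemma superdifferential_Lipschitz:
  fixes u p :: "real \<Rightarrow> real"
  assumes super: "\<And>w w'. u w' - u w \<le> p w * (w' - w)" and K: "\<And>w. \<bar>p w\<bar> \<le> K"
  shows "\<bar>u w' - u w\<bar> \<le> K * \<bar>w' - w\<bar>"
proof -
  have "u w' - u w \<le> K * \<bar>w' - w\<bar>" for w w'
  proof -
    have "p w * (w' - w) \<le> \<bar>p w\<bar> * \<bar>w' - w\<bar>" by (simp flip: abs_mult)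
    also have "\<dots> \<le> K * \<bar>w' - w\<bar>" using K by (intro mult_right_mono) auto
    finally show ?thesis using super[of w' w] by linarith
  qed
  from this[of w' w] this[of w w'] show ?thesis by (simp add: abs_minus_commute abs_le_iff)
qed

lemma superdifferential_continuous:
  fixes u p :: "real \<Rightarrow> real"
  assumes "\<And>w w'. u w' - u w \<le> p w * (w' - w)" "\<And>w. \<bar>p w\<bar> \<le> K"
  shows "continuous_on UNIV u"
proof -
  have "K-lipschitz_on UNIV u"
    using superdifferential_Lipschitz[of u p K, OF assms] assms(2)[of 0]
    by (intro lipschitz_onI) (auto simp: dist_real_def)
  then show ?thesis by (rule lipschitz_on_continuous_on)
qed

context brownian_family
begin

lemma prob_space_completion_P: "prob_space (completion (P x))"
  using prob_space.emeasure_space_1[OF prob_space_P] by (intro prob_spaceI) simp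

lemma AE_start: "AE \<omega> in completion (P x). \<omega> \<in> space M \<and> W 0 \<omega> = x"
  unfolding AE_completion_iff using start[of x] AE_space by eventually_elim (simp add: space_P)

lemma stopped_in_interval:
  assumes "\<omega> \<in> space M" "W 0 \<omega> \<in> {c<..<d}" "r \<le> hit_time W (- {c<..<d}) \<omega>" "r < \<infinity>"
  shows "W (enn2real r) \<omega> \<in> {c..d}"
  using assms by (intro hit_time_interval[where W=W and \<omega>=\<omega>, OF continuous_paths]) auto

text \<open>A concave u may tend to minus infinity, but only linearly, so u + \<epsilon> w^2 is
  bounded below and the grid estimate applies to it. The price is an error \<epsilon> (x^2 + T),
  removed by letting \<epsilon> tend to 0.\<close>

lemma supermartingale_bounded_time:
  assumes \<rho>: "\<rho> \<in> stopping_times P G" and T: "0 < T"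
    and exit: "\<And>\<omega>. \<omega> \<in> space M \<Longrightarrow> \<rho> \<omega> \<le> hit_time W (- {c<..<d}) \<omega>"
    and x: "x \<in> {c<..<d}"
    and super: "\<And>w w'. u w' - u w \<le> p w * (w' - w)"
    and p[measurable]: "p \<in> borel_measurable borel" and K: "\<And>w. \<bar>p w\<bar> \<le> K"
  shows "integrable (completion (P x)) (\<lambda>\<omega>. u (W (enn2real (min (\<rho> \<omega>) (ennreal T))) \<omega>))"
    and "(\<integral>\<omega>. u (W (enn2real (min (\<rho> \<omega>) (ennreal T))) \<omega>) \<partial>completion (P x)) \<le> u x"
proof -
  let ?C = "completion (P x)"
  let ?X = "\<lambda>\<omega>. W (enn2real (min (\<rho> \<omega>) (ennreal T))) \<omega>"
  interpret C: prob_space ?C by (rule prob_space_completion_P)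
  have [measurable]: "\<rho> \<in> borel_measurable ?C" by (rule measurable_stopping_times[OF \<rho>])
  have X_meas[measurable]: "?X \<in> borel_measurable ?C"
    by (rule measurable_random_time) auto
  have u_cont: "continuous_on UNIV u"
    using super K by (rule superdifferential_continuous)
  then have u_meas[measurable]: "u \<in> borel_measurable borel"
    by (rule borel_measurable_continuous_onI)
  define b where "b = max \<bar>c\<bar> \<bar>d\<bar>"
  have X_in: "AE \<omega> in ?C. ?X \<omega> \<in> {c..d}"
    using AE_start
  proof eventually_elim
    case (elim \<omega>)
    then show ?case
      using exit[of \<omega>] x by (intro stopped_in_interval) (auto simp: min.coboundedI1 min_less_iff_disj)
  qed
  have u_bound: "\<bar>u w\<bar> \<le> \<bar>u 0\<bar> + K * b" if "w \<in> {c..d}" for w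
  proof -
    have "\<bar>u w - u 0\<bar> \<le> K * \<bar>w - 0\<bar>"
      using superdifferential_Lipschitz[of u p K, OF super K] by blast
    also have "\<dots> \<le> K * b"
      using that K[of 0] by (intro mult_left_mono) (auto simp: b_def)
    finally show ?thesis by linarith
  qed
  show int: "integrable ?C (\<lambda>\<omega>. u (?X \<omega>))"
    by (rule C.integrable_const_bound[of _ "\<bar>u 0\<bar> + K * b"])
      (use X_in in eventually_elim, auto intro: u_bound)
  have bound: "(\<integral>\<omega>. u (?X \<omega>) \<partial>?C) \<le> u x + \<epsilon> * (x\<^sup>2 + T)" if \<epsilon>: "0 < \<epsilon>" for \<epsilon>
  proof -
    define v where "v w = u w + \<epsilon> * w\<^sup>2" for w
    \<comment> \<open>The minimum of u 0 - K |w| + \<epsilon> w^2 over w, obtained by completing the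
      square.\<close>
    define m where "m = u 0 - K\<^sup>2 / (4 * \<epsilon>)"
    have m: "m \<le> v w" for w
    proof -
      have "\<bar>u w - u 0\<bar> \<le> K * \<bar>w - 0\<bar>"
        using superdifferential_Lipschitz[of u p K, OF super K] by blast
      then have "u 0 - K * \<bar>w\<bar> \<le> u w" by simp
      moreover have "0 \<le> \<epsilon> * (\<bar>w\<bar> - K / (2 * \<epsilon>))\<^sup>2" using \<epsilon> by simp
      moreover have "\<epsilon> * (\<bar>w\<bar> - K / (2 * \<epsilon>))\<^sup>2 = \<epsilon> * w\<^sup>2 - K * \<bar>w\<bar> + K\<^sup>2 / (4 * \<epsilon>)"
        using \<epsilon> by (simp add: power2_diff power_divide field_simps power2_eq_square)
      ultimately show ?thesis by (simp add: v_def m_def)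
    qed
    have v_meas[measurable]: "v \<in> borel_measurable borel" unfolding v_def by measurable
    have "(\<integral>\<^sup>+\<omega>. ennreal (v (?X \<omega>) - m) \<partial>?C) \<le> ennreal (v x - m + \<epsilon> * T)"
    \<comment> \<open>The slope is that of u plus that of \<epsilon> w^2, whose Taylor remainder is
      exactly \<epsilon> (w' - w)^2.\<close>
    proof (rule stopped_supermartingale_bound[where q="\<lambda>w. p w + 2 * \<epsilon> * w" and K="K + 2 * \<epsilon> * b", OF \<rho> T exit _ m])
      show "continuous_on UNIV v"
        unfolding v_def using u_cont by (intro continuous_intros)
      show "\<bar>p w + 2 * \<epsilon> * w\<bar> \<le> K + 2 * \<epsilon> * b" if "w \<in> {c<..<d}" for w
      proof -
        have "\<bar>p w + 2 * \<epsilon> * w\<bar> \<le> \<bar>p w\<bar> + 2 * \<epsilon> * \<bar>w\<bar>"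
          using \<epsilon> abs_triangle_ineq[of "p w" "2 * \<epsilon> * w"] by (simp add: abs_mult)
        also have "\<dots> \<le> K + 2 * \<epsilon> * b"
          using that \<epsilon> K by (intro add_mono mult_left_mono) (auto simp: b_def)
        finally show ?thesis .
      qed
      show "v w' - v w \<le> (p w + 2 * \<epsilon> * w) * (w' - w) + \<epsilon> * (w' - w)\<^sup>2" for w w'
        using super[of w' w] by (simp add: v_def power2_eq_square algebra_simps)
    qed (use \<epsilon> in auto)
    also have "(\<integral>\<^sup>+\<omega>. ennreal (v (?X \<omega>) - m) \<partial>?C) = ennreal (\<integral>\<omega>. v (?X \<omega>) - m \<partial>?C)"
    proof (rule nn_integral_eq_integral)
      have "AE \<omega> in ?C. norm (v (?X \<omega>) - m) \<le> \<bar>u 0\<bar> + K * b + \<epsilon> * b\<^sup>2 + \<bar>m\<bar>"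
        using X_in
      proof eventually_elim
        case (elim \<omega>)
        then have "\<bar>?X \<omega>\<bar> \<le> b" by (auto simp: b_def)
        then have "(?X \<omega>)\<^sup>2 \<le> b\<^sup>2" by (simp add: abs_le_square_iff[symmetric] b_def)
        then have "\<epsilon> * (?X \<omega>)\<^sup>2 \<le> \<epsilon> * b\<^sup>2" "0 \<le> \<epsilon> * (?X \<omega>)\<^sup>2" using \<epsilon> by auto
        then show ?case using u_bound[OF elim] unfolding v_def by (simp add: abs_le_iff) linarith
      qed
      then show "integrable ?C (\<lambda>\<omega>. v (?X \<omega>) - m)"
        by (rule C.integrable_const_bound) measurable
    qed (use m in simp)
    finally have "(\<integral>\<omega>. v (?X \<omega>) - m \<partial>?C) \<le> v x - m + \<epsilon> * T"
      using m[of x] \<epsilon> T by (subst (asm) ennreal_le_iff) (auto intro!: add_nonneg_nonneg)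
    moreover have "(\<integral>\<omega>. u (?X \<omega>) - m \<partial>?C) \<le> (\<integral>\<omega>. v (?X \<omega>) - m \<partial>?C)"
    proof (rule integral_mono_AE)
      show "integrable ?C (\<lambda>\<omega>. v (?X \<omega>) - m)"
        unfolding v_def
      proof (intro Bochner_Integration.integrable_diff Bochner_Integration.integrable_add int integrable_mult_right)
        show "integrable ?C (\<lambda>\<omega>. (?X \<omega>)\<^sup>2)"
          by (rule C.integrable_const_bound[of _ "b\<^sup>2"])
            (use X_in in eventually_elim, auto simp: abs_le_square_iff[symmetric] b_def)
      qed simp
    qed (use int \<epsilon> in \<open>auto simp: v_def\<close>)
    moreover have "(\<integral>\<omega>. u (?X \<omega>) - m \<partial>?C) = (\<integral>\<omega>. u (?X \<omega>) \<partial>?C) - m"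
      using int prob_space.prob_space[OF prob_space_P] by simp
    ultimately show ?thesis by (simp add: v_def algebra_simps)
  qed
  show "(\<integral>\<omega>. u (?X \<omega>) \<partial>?C) \<le> u x"
  proof (rule field_le_epsilon)
    fix e :: real assume e: "0 < e"
    have "0 < x\<^sup>2 + T" using T by (simp add: add_nonneg_pos)
    then show "(\<integral>\<omega>. u (?X \<omega>) \<partial>?C) \<le> u x + e"
      using bound[of "e / (x\<^sup>2 + T)"] e by simp
  qed
qed

text \<open>Since \<rho> is at most the almost surely finite exit time, the truncation at n + 1 is
  eventually void, and the stopped values stay in [c,d]: dominated convergence. For affine u, the
  bounds for u and -u together give the martingale identity.\<close>

lemma supermartingale_stopped:
  assumes \<rho>: "\<rho> \<in> stopping_times P G"
    and exit: "\<And>\<omega>. \<omega> \<in> space M \<Longrightarrow> \<rho> \<omega> \<le> hit_time W (- {c<..<d}) \<omega>"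
    and x: "x \<in> {c<..<d}"
    and super: "\<And>w w'. u w' - u w \<le> p w * (w' - w)"
    and p: "p \<in> borel_measurable borel" and K: "\<And>w. \<bar>p w\<bar> \<le> K"
  shows "integrable (completion (P x)) (\<lambda>\<omega>. u (W (enn2real (\<rho> \<omega>)) \<omega>))"
    and "(\<integral>\<omega>. u (W (enn2real (\<rho> \<omega>)) \<omega>) \<partial>completion (P x)) \<le> u x"
proof -
  let ?C = "completion (P x)"
  let ?X = "\<lambda>\<omega>. W (enn2real (\<rho> \<omega>)) \<omega>"
  let ?Z = "\<lambda>n \<omega>. W (enn2real (min (\<rho> \<omega>) (ennreal (real (Suc n))))) \<omega>"
  interpret C: prob_space ?C by (rule prob_space_completion_P)
  have [measurable]: "\<rho> \<in> borel_measurable ?C" by (rule measurable_stopping_times[OF \<rho>])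
  have u_cont: "continuous_on UNIV u"
    using super K by (rule superdifferential_continuous)
  then have u_meas[measurable]: "u \<in> borel_measurable borel"
    by (rule borel_measurable_continuous_onI)
  have X_meas[measurable]: "?X \<in> borel_measurable ?C" "?Z n \<in> borel_measurable ?C" for n
    by (rule measurable_random_time; simp)+
  obtain B where "\<forall>w\<in>{c..d}. \<bar>u w\<bar> \<le> B"
    using compact_imp_bounded[OF compact_continuous_image[OF continuous_on_subset[OF u_cont] compact_Icc], of c d]
    by (auto simp: bounded_iff)
  then have B: "\<bar>u w\<bar> \<le> B" if "w \<in> {c..d}" for w
    using that by blast
  have lim: "AE \<omega> in ?C. (\<lambda>n. u (?Z n \<omega>)) \<longlonglongrightarrow> u (?X \<omega>)"
    using AE_start AE_exit_finite[of c d x]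
  proof eventually_elim
    case (elim \<omega>)
    then have "\<rho> \<omega> < \<infinity>" using exit[of \<omega>] by auto
    then obtain r where r: "\<rho> \<omega> = ennreal r" "0 \<le> r" by (cases "\<rho> \<omega>") auto
    obtain n0 where "r \<le> real n0" using real_arch_simple by blast
    then have "min (\<rho> \<omega>) (ennreal (real (Suc n))) = \<rho> \<omega>" if "n0 \<le> n" for n
      unfolding r(1) using that \<open>r \<le> real n0\<close> by (intro min_absorb1 ennreal_leI) simp
    then have "\<forall>\<^sub>F n in sequentially. u (?Z n \<omega>) = u (?X \<omega>)"
      by (auto simp: eventually_sequentially intro!: exI[of _ n0])
    then show ?case by (rule tendsto_eventually)
  qed
  have bound: "AE \<omega> in ?C. norm (u (?Z n \<omega>)) \<le> B" for n
    using AE_start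
  proof eventually_elim
    case (elim \<omega>)
    then have "?Z n \<omega> \<in> {c..d}"
      using exit[of \<omega>] x by (intro stopped_in_interval) (auto simp: min.coboundedI1 min_less_iff_disj)
    then show ?case using B by simp
  qed
  have meas: "(\<lambda>\<omega>. u (?X \<omega>)) \<in> borel_measurable ?C" "\<And>n. (\<lambda>\<omega>. u (?Z n \<omega>)) \<in> borel_measurable ?C"
    by measurable
  note dc = meas(1) meas(2) C.integrable_const lim bound
  show "integrable ?C (\<lambda>\<omega>. u (?X \<omega>))"
    by (rule integrable_dominated_convergence[OF dc])
  have "(\<lambda>n. \<integral>\<omega>. u (?Z n \<omega>) \<partial>?C) \<longlonglongrightarrow> (\<integral>\<omega>. u (?X \<omega>) \<partial>?C)"
    by (rule integral_dominated_convergence[OF dc])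
  then show "(\<integral>\<omega>. u (?X \<omega>) \<partial>?C) \<le> u x"
    by (rule LIMSEQ_le_const2)
      (use supermartingale_bounded_time(2)[OF \<rho> _ exit x super p K] in \<open>auto simp del: of_nat_Suc\<close>)
qed

end

section \<open>Payoffs of hitting strategies\<close>

definition gap :: "real set \<Rightarrow> real \<Rightarrow> real \<Rightarrow> bool" where
  "gap S c d \<longleftrightarrow> 0 \<le> c \<and> d \<le> 1 \<and> c \<in> S \<union> {0, 1} \<and> d \<in> S \<union> {0, 1} \<and> S \<inter> {c<..<d} = {}"

definition reward_at :: "(real \<Rightarrow> 'w \<Rightarrow> real) \<Rightarrow> (real \<Rightarrow> real) \<Rightarrow> (real \<Rightarrow> real) \<Rightarrow> (real \<Rightarrow> real) \<Rightarrow>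
    ennreal \<Rightarrow> ennreal \<Rightarrow> 'w \<Rightarrow> real" where
  "reward_at W f g h s t \<omega> = extend f (killed W s \<omega>) * of_bool (s < t)
     + extend g (killed W t \<omega>) * of_bool (t < s) + extend h (killed W s \<omega>) * of_bool (s = t)"

lemma reward_at_cases:
  "s < t \<Longrightarrow> reward_at W f g h s t \<omega> = extend f (killed W s \<omega>)"
  "t < s \<Longrightarrow> reward_at W f g h s t \<omega> = extend g (killed W t \<omega>)"
  "reward_at W f g h s s \<omega> = extend h (killed W s \<omega>)"
  by (auto simp: reward_at_def)

lemma payoff_eq_reward_at:
  "payoff P W f g h x \<tau> \<sigma> = (\<integral>\<omega>. reward_at W f g h (\<tau> \<omega>) (\<sigma> \<omega>) \<omega> \<partial>completion (P x))"
  by (simp add: payoff_def reward_at_def)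

lemma rewardsD:
  assumes "rewards f g h" and "\<phi> \<in> {f, g, h}"
  shows "continuous_on {0..1} \<phi>" "\<phi> 0 = 0" "\<phi> 1 = 0"
  using assms unfolding rewards_def by auto

lemma rewards_le:
  assumes "rewards f g h" "x \<in> {0..1}"
  shows "f x \<le> h x" "h x \<le> g x"
  using assms unfolding rewards_def by auto

context brownian_family
begin

lemma extend_killed:
  "extend \<phi> (killed W t \<omega>) = (if t < lifetime W \<omega> then \<phi> (W (enn2real t) \<omega>) else 0)"
  by (simp add: extend_def killed_def)

lemma alive_position:
  assumes "t < lifetime W \<omega>"
  shows "W (enn2real t) \<omega> \<in> {0<..<1}"
proof -
  have "t < top" using assms by (rule order.strict_trans2) simp
  then show ?thesis
    using not_in_before_hit_time[of "enn2real t" W "- {0<..<1}" \<omega>] assms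
    by (simp add: lifetime_eq_hit_time)
qed

lemma extend_killed_integrable:
  assumes \<phi>: "continuous_on {0..1} \<phi>" and \<tau>[measurable]: "\<tau> \<in> borel_measurable (completion (P x))"
  shows "(\<lambda>\<omega>. extend \<phi> (killed W (\<tau> \<omega>) \<omega>)) \<in> borel_measurable (completion (P x))"
    and "\<exists>B. \<forall>t \<omega>. \<bar>extend \<phi> (killed W t \<omega>)\<bar> \<le> B"
proof -
  have [measurable]: "lifetime W \<in> borel_measurable (completion (P x))"
    unfolding lifetime_eq_hit_time
    by (intro measurable_stopping_times stopping_time_hit closed_Compl_Ioo) (auto intro: exI[of _ 2])
  have [measurable]: "(\<lambda>\<omega>. W (enn2real (\<tau> \<omega>)) \<omega>) \<in> borel_measurable (completion (P x))"
    by (rule measurable_random_time) auto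
  \<comment> \<open>Nothing is known of \<phi> off [0,1]. Cutting it off there is harmless, since a
    living path lies in (0,1).\<close>
  have [measurable]: "(\<lambda>w. indicator {0..1} w *\<^sub>R \<phi> w) \<in> borel_measurable borel"
    using \<phi> by (intro borel_measurable_continuous_on_indicator) auto
  have "extend \<phi> (killed W (\<tau> \<omega>) \<omega>)
      = (indicator {0..1} (W (enn2real (\<tau> \<omega>)) \<omega>) *\<^sub>R \<phi> (W (enn2real (\<tau> \<omega>)) \<omega>)) * of_bool (\<tau> \<omega> < lifetime W \<omega>)" for \<omega>
    using alive_position[of "\<tau> \<omega>" \<omega>] by (auto simp: extend_killed indicator_def)
  moreover have "(\<lambda>\<omega>. (indicator {0..1} (W (enn2real (\<tau> \<omega>)) \<omega>) *\<^sub>R \<phi> (W (enn2real (\<tau> \<omega>)) \<omega>))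
      * of_bool (\<tau> \<omega> < lifetime W \<omega>)) \<in> borel_measurable (completion (P x))"
    by measurable
  ultimately show "(\<lambda>\<omega>. extend \<phi> (killed W (\<tau> \<omega>) \<omega>)) \<in> borel_measurable (completion (P x))"
    by presburger
  obtain B where B: "\<forall>w\<in>{0..1}. \<bar>\<phi> w\<bar> \<le> B"
    using compact_imp_bounded[OF compact_continuous_image[OF \<phi> compact_Icc]] by (auto simp: bounded_iff)
  have "\<bar>extend \<phi> (killed W t \<omega>)\<bar> \<le> max B 0" for t \<omega>
  proof (cases "t < lifetime W \<omega>")
    case True
    then have "\<bar>\<phi> (W (enn2real t) \<omega>)\<bar> \<le> B"
      using alive_position[OF True] B by auto
    then show ?thesis using True by (simp add: extend_killed)
  qed (simp add: extend_killed)
  then show "\<exists>B. \<forall>t \<omega>. \<bar>extend \<phi> (killed W t \<omega>)\<bar> \<le> B" by blast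
qed

lemma reward_at_integrable:
  assumes r: "rewards f g h" and \<tau>: "\<tau> \<in> stopping_times P G" and \<sigma>: "\<sigma> \<in> stopping_times P G"
  shows "integrable (completion (P x)) (\<lambda>\<omega>. reward_at W f g h (\<tau> \<omega>) (\<sigma> \<omega>) \<omega>)"
proof -
  interpret C: prob_space "completion (P x)" by (rule prob_space_completion_P)
  note [measurable] = measurable_stopping_times[OF \<tau>] measurable_stopping_times[OF \<sigma>]
  note ek = extend_killed_integrable[OF rewardsD(1)[OF r]]
  have [measurable]: "(\<lambda>\<omega>. extend f (killed W (\<tau> \<omega>) \<omega>)) \<in> borel_measurable (completion (P x))"
    "(\<lambda>\<omega>. extend g (killed W (\<sigma> \<omega>) \<omega>)) \<in> borel_measurable (completion (P x))"
    "(\<lambda>\<omega>. extend h (killed W (\<tau> \<omega>) \<omega>)) \<in> borel_measurable (completion (P x))"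
    using ek(1)[of f \<tau> x] ek(1)[of g \<sigma> x] ek(1)[of h \<tau> x] by simp_all
  obtain B1 B2 B3 where B: "\<And>t \<omega>. \<bar>extend f (killed W t \<omega>)\<bar> \<le> B1"
    "\<And>t \<omega>. \<bar>extend g (killed W t \<omega>)\<bar> \<le> B2" "\<And>t \<omega>. \<bar>extend h (killed W t \<omega>)\<bar> \<le> B3"
    using ek(2)[of f \<tau> x] ek(2)[of g \<sigma> x] ek(2)[of h \<tau> x] by auto
  have "\<bar>reward_at W f g h s t \<omega>\<bar> \<le> B1 + B2 + B3" for s t \<omega>
    using B(1)[of s \<omega>] B(2)[of t \<omega>] B(3)[of s \<omega>]
    by (auto simp: reward_at_def of_bool_def)
  then show ?thesis
    by (intro C.integrable_const_bound[of _ "B1 + B2 + B3"] AE_I2) (simp_all add: reward_at_def)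
qed

lemma payoff_AE_const:
  assumes "rewards f g h" "\<tau> \<in> stopping_times P G" "\<sigma> \<in> stopping_times P G"
    and "AE \<omega> in completion (P x). reward_at W f g h (\<tau> \<omega>) (\<sigma> \<omega>) \<omega> = v"
  shows "payoff P W f g h x \<tau> \<sigma> = v"
proof -
  interpret C: prob_space "completion (P x)" by (rule prob_space_completion_P)
  have "(\<integral>\<omega>. reward_at W f g h (\<tau> \<omega>) (\<sigma> \<omega>) \<omega> \<partial>completion (P x)) = (\<integral>\<omega>. v \<partial>completion (P x))"
    using reward_at_integrable[OF assms(1-3), of x] assms(4) by (intro integral_cong_AE) auto
  then show ?thesis
    using prob_space.prob_space[OF prob_space_P, of x] by (simp add: payoff_eq_reward_at)
qed

lemma gap_exit:
  assumes gap: "gap S c d" and \<omega>: "\<omega> \<in> space M" "W 0 \<omega> \<in> {c<..<d}"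
  shows "entry_time W S \<omega> = hit_time W (- {c<..<d}) \<omega>"
  unfolding entry_time_eq_hit_time
  using gap by (intro hit_time_eq_exit continuous_paths \<omega>) (auto simp: gap_def)

lemma exit_le_lifetime:
  assumes "0 \<le> c" "d \<le> 1"
  shows "hit_time W (- {c<..<d}) \<omega> \<le> lifetime W \<omega>"
  unfolding lifetime_eq_hit_time using assms by (intro hit_time_antimono) auto

text \<open>Leaving the gap at 0 or 1 is death and leaving it elsewhere is not. As \<phi> vanishes
  at 0 and 1, the killed reward agrees with \<phi> at the unkilled exit point in both cases.\<close>

lemma exit_value:
  assumes cd: "0 \<le> c" "d \<le> 1" and \<omega>: "\<omega> \<in> space M" "W 0 \<omega> \<in> {c<..<d}"
    and fin: "hit_time W (- {c<..<d}) \<omega> < \<infinity>" and \<phi>: "\<phi> 0 = 0" "\<phi> 1 = 0"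
  defines "e \<equiv> hit_time W (- {c<..<d}) \<omega>"
  shows "W (enn2real e) \<omega> \<in> {c, d}"
    and "extend \<phi> (killed W e \<omega>) = \<phi> (W (enn2real e) \<omega>)"
    and "e < lifetime W \<omega> \<longleftrightarrow> W (enn2real e) \<omega> \<in> {0<..<1}"
proof -
  obtain t where t: "0 \<le> t" "e = ennreal t" "W t \<omega> = c \<or> W t \<omega> = d"
    using exit_position[where W=W and \<omega>=\<omega>, OF continuous_paths[OF \<omega>(1)] \<omega>(2) fin] by (auto simp: e_def)
  then show pos: "W (enn2real e) \<omega> \<in> {c, d}" by auto
  show iff: "e < lifetime W \<omega> \<longleftrightarrow> W (enn2real e) \<omega> \<in> {0<..<1}"
  proof
    assume pos: "W (enn2real e) \<omega> \<in> {0<..<1}"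
    have "e \<le> lifetime W \<omega>" unfolding e_def using cd by (rule exit_le_lifetime)
    moreover have "e \<noteq> lifetime W \<omega>"
    proof
      assume "e = lifetime W \<omega>"
      moreover obtain s where "0 \<le> s" "lifetime W \<omega> = ennreal s" "W s \<omega> \<in> - {0<..<1}"
        using hit_time_attained[where W=W and \<omega>=\<omega>, OF closed_Compl_Ioo continuous_paths[OF \<omega>(1)]]
          fin calculation unfolding lifetime_eq_hit_time e_def by metis
      ultimately show False using pos by simp
    qed
    ultimately show "e < lifetime W \<omega>" by simp
  qed (rule alive_position)
  show "extend \<phi> (killed W e \<omega>) = \<phi> (W (enn2real e) \<omega>)"
  proof (cases "e < lifetime W \<omega>")
    case False
    then have "W (enn2real e) \<omega> = 0 \<or> W (enn2real e) \<omega> = 1"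
      using iff pos cd \<omega>(2) by auto
    then show ?thesis using False \<phi> by (auto simp: extend_killed)
  qed (simp add: extend_killed)
qed

text \<open>A verification argument: u is followed up to the earlier of \<tau> and the exit from the
  gap, and dominates the reward there. Before the exit the reward is f, at the exit it is g, or in a
  tie h, which is at most g; hence g is compared with u only at the two ends.\<close>

lemma payoff_le_superharmonic:
  assumes r: "rewards f g h" and \<tau>: "\<tau> \<in> stopping_times P G" and S: "closed S"
    and gap: "gap S c d" and x: "x \<in> {c<..<d}"
    and super: "\<And>w w'. u w' - u w \<le> p w * (w' - w)"
    and p: "p \<in> borel_measurable borel" and K: "\<And>w. \<bar>p w\<bar> \<le> K"
    and f_le: "\<And>w. w \<in> {c<..<d} \<Longrightarrow> f w \<le> u w" and g_le: "g c \<le> u c" "g d \<le> u d"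
  shows "payoff P W f g h x \<tau> (entry_time W S) \<le> u x"
proof -
  let ?e = "hit_time W (- {c<..<d})"
  let ?\<rho> = "\<lambda>\<omega>. min (\<tau> \<omega>) (?e \<omega>)"
  have cd: "0 \<le> c" "d \<le> 1" using gap by (auto simp: gap_def)
  have "(2::real) \<in> - {c<..<d}" using cd by simp
  then have "?e \<in> stopping_times P G"
    by (intro stopping_time_hit closed_Compl_Ioo) auto
  then have \<rho>: "?\<rho> \<in> stopping_times P G"
    using \<tau> by (rule stopping_times_min[rotated])
  have exit: "?\<rho> \<omega> \<le> ?e \<omega>" for \<omega> by simp
  note stopped = supermartingale_stopped[OF \<rho> exit x super p K]
  have "AE \<omega> in completion (P x). reward_at W f g h (\<tau> \<omega>) (entry_time W S \<omega>) \<omega> \<le> u (W (enn2real (?\<rho> \<omega>)) \<omega>)"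
    using AE_start AE_exit_finite[of c d x]
  proof eventually_elim
    case (elim \<omega>)
    have \<omega>: "\<omega> \<in> space M" "W 0 \<omega> \<in> {c<..<d}" using elim x by auto
    have e: "entry_time W S \<omega> = ?e \<omega>" by (rule gap_exit[OF gap \<omega>])
    note ev = exit_value[OF cd \<omega>, of _, OF elim(2)]
    show ?case
    proof (cases "\<tau> \<omega>" "?e \<omega>" rule: linorder_cases)
      case less
      then have "\<tau> \<omega> < lifetime W \<omega>"
        using exit_le_lifetime[OF cd] by (rule order.strict_trans2)
      moreover have "W (enn2real (\<tau> \<omega>)) \<omega> \<in> {c<..<d}"
        using not_in_before_hit_time[of "enn2real (\<tau> \<omega>)" W "- {c<..<d}" \<omega>] less elim(2)
        by auto
      ultimately show ?thesis
        using less f_le by (simp add: reward_at_cases e extend_killed min_absorb1 less_imp_le del: not_less)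
    next
      case greater
      have "g (W (enn2real (?e \<omega>)) \<omega>) \<le> u (W (enn2real (?e \<omega>)) \<omega>)"
        using ev(1)[of g] rewardsD[OF r, of g] g_le by auto
      then show ?thesis
        using greater ev(2)[of g] rewardsD[OF r, of g] by (simp add: reward_at_cases e min_absorb2 less_imp_le)
    next
      case equal
      have "h (W (enn2real (?e \<omega>)) \<omega>) \<le> u (W (enn2real (?e \<omega>)) \<omega>)"
        using ev(1)[of g] rewardsD[OF r, of g] g_le rewards_le(2)[OF r, of c] rewards_le(2)[OF r, of d] cd x by auto
      then show ?thesis
        using equal ev(2)[of h] rewardsD[OF r, of h] by (simp add: reward_at_cases e)
    qed
  qed
  then have "payoff P W f g h x \<tau> (entry_time W S) \<le> (\<integral>\<omega>. u (W (enn2real (?\<rho> \<omega>)) \<omega>) \<partial>completion (P x))"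
    unfolding payoff_eq_reward_at
    by (intro integral_mono_AE reward_at_integrable r \<tau> stopping_time_entry S stopped(1))
  also have "\<dots> \<le> u x" by (rule stopped(2))
  finally show ?thesis .
qed

text \<open>The target is closed and not yet missed at t, so the position at t alone decides. This
  identifies which player stops on exit from a common gap.\<close>

lemma entry_time_eq_iff:
  assumes "closed S" "\<omega> \<in> space M" "t < \<infinity>" "t \<le> entry_time W S \<omega>"
  shows "entry_time W S \<omega> = t \<longleftrightarrow> W (enn2real t) \<omega> \<in> S \<union> - {0<..<1}"
proof
  assume eq: "entry_time W S \<omega> = t"
  then show "W (enn2real t) \<omega> \<in> S \<union> - {0<..<1}"
    using assms(3) unfolding entry_time_eq_hit_time
    by (metis hit_time_attained[where W=W and \<omega>=\<omega>, OF closed_Un[OF assms(1) closed_Compl_Ioo] continuous_paths[OF assms(2)]]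
        enn2real_ennreal)
next
  assume "W (enn2real t) \<omega> \<in> S \<union> - {0<..<1}"
  then have "hit_time W (S \<union> - {0<..<1}) \<omega> \<le> ennreal (enn2real t)"
    by (intro hit_time_le) auto
  then show "entry_time W S \<omega> = t"
    using assms(3,4) by (simp add: entry_time_eq_hit_time)
qed

text \<open>Neither player stops inside the common gap, so the reward depends on the exit point
  alone. It agrees at both ends with an affine function, whose stopped value is a
  martingale.\<close>

lemma payoff_affine:
  assumes r: "rewards f g h" and S: "closed S" "closed S'" "S \<inter> S' = {}"
    and gap: "gap (S \<union> S') c d" and x: "x \<in> {c<..<d}"
    and val: "\<And>y. y \<in> {c, d} \<Longrightarrow> \<alpha> * y + \<beta> = (if y \<in> S then f y else g y)"
  shows "payoff P W f g h x (entry_time W S) (entry_time W S') = \<alpha> * x + \<beta>"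
proof -
  let ?e = "hit_time W (- {c<..<d})"
  let ?X = "\<lambda>\<omega>. W (enn2real (?e \<omega>)) \<omega>"
  have cd: "0 \<le> c" "d \<le> 1" using gap by (auto simp: gap_def)
  have "(2::real) \<in> - {c<..<d}" using cd by simp
  then have e: "?e \<in> stopping_times P G"
    by (intro stopping_time_hit closed_Compl_Ioo) auto
  have "AE \<omega> in completion (P x). reward_at W f g h (entry_time W S \<omega>) (entry_time W S' \<omega>) \<omega> = \<alpha> * ?X \<omega> + \<beta>"
    using AE_start AE_exit_finite[of c d x]
  proof eventually_elim
    case (elim \<omega>)
    have \<omega>: "\<omega> \<in> space M" "W 0 \<omega> \<in> {c<..<d}" using elim x by auto
    note ev = exit_value[OF cd \<omega>, of _, OF elim(2)]
    have le: "?e \<omega> \<le> entry_time W S \<omega>" "?e \<omega> \<le> entry_time W S' \<omega>"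
      unfolding entry_time_eq_hit_time using gap by (auto simp: gap_def intro!: hit_time_antimono)
    have iff: "entry_time W S \<omega> = ?e \<omega> \<longleftrightarrow> ?X \<omega> \<in> S \<union> - {0<..<1}"
      "entry_time W S' \<omega> = ?e \<omega> \<longleftrightarrow> ?X \<omega> \<in> S' \<union> - {0<..<1}"
      using entry_time_eq_iff[OF _ \<omega>(1) elim(2)] S le by auto
    have X: "?X \<omega> \<in> {c, d}" using ev(1)[of g] rewardsD[OF r, of g] by auto
    have val': "\<alpha> * ?X \<omega> + \<beta> = (if ?X \<omega> \<in> S then f (?X \<omega>) else g (?X \<omega>))"
      using val[OF X] .
    show ?case
    proof (cases "?X \<omega> \<in> {0<..<1}")
      \<comment> \<open>At 0 or 1 both entry times end together with the lifetime, so this is a tie,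
        and all three rewards vanish there.\<close>
      case False
      then have "?X \<omega> = 0 \<or> ?X \<omega> = 1" using X cd x by auto
      then show ?thesis
        using False iff val' ev(2)[of h] rewardsD[OF r, of f] rewardsD[OF r, of g] rewardsD[OF r, of h]
        by (auto simp: reward_at_cases)
    next
      case True
      then have "?X \<omega> \<in> S \<union> S'" using X gap by (auto simp: gap_def)
      then consider "?X \<omega> \<in> S" "?X \<omega> \<notin> S'" | "?X \<omega> \<in> S'" "?X \<omega> \<notin> S" using S(3) by blast
      then show ?thesis
      proof cases
        case 1
        then have "entry_time W S \<omega> = ?e \<omega>" "?e \<omega> < entry_time W S' \<omega>"
          using iff le True by (auto simp: order_less_le)
        then show ?thesis
          using 1 val' ev(2)[of f] rewardsD[OF r, of f] by (simp add: reward_at_cases)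
      next
        case 2
        then have "entry_time W S' \<omega> = ?e \<omega>" "?e \<omega> < entry_time W S \<omega>"
          using iff le True by (auto simp: order_less_le)
        then show ?thesis
          using 2 val' ev(2)[of g] rewardsD[OF r, of g] by (simp add: reward_at_cases)
      qed
    qed
  qed
  \<comment> \<open>Only the supermartingale inequality is available; used for both signs of the
    coefficients it yields equality.\<close>
  moreover have lin: "integrable (completion (P x)) (\<lambda>\<omega>. a * ?X \<omega> + b)"
      "(\<integral>\<omega>. a * ?X \<omega> + b \<partial>completion (P x)) \<le> a * x + b" for a b
    by (rule supermartingale_stopped[OF e _ x, where p="\<lambda>_. a" and K="\<bar>a\<bar>" and u="\<lambda>w. a * w + b"];
        simp add: algebra_simps)+
  ultimately have "payoff P W f g h x (entry_time W S) (entry_time W S') = (\<integral>\<omega>. \<alpha> * ?X \<omega> + \<beta> \<partial>completion (P x))"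
    unfolding payoff_eq_reward_at
    using reward_at_integrable[OF r stopping_time_entry[OF S(1)] stopping_time_entry[OF S(2)], of x]
    by (intro integral_cong_AE) (auto dest: borel_measurable_integrable)
  moreover have "(\<integral>\<omega>. - \<alpha> * ?X \<omega> + - \<beta> \<partial>completion (P x)) = - (\<integral>\<omega>. \<alpha> * ?X \<omega> + \<beta> \<partial>completion (P x))"
    by (subst Bochner_Integration.integral_minus[symmetric]) (simp add: algebra_simps)
  ultimately show ?thesis
    using lin(2)[of \<alpha> \<beta>] lin(2)[of "- \<alpha>" "- \<beta>"] by simp
qed

lemma entry_time_start:
  assumes "closed S" "\<omega> \<in> space M" "W 0 \<omega> \<in> {0<..<1}"
  shows "entry_time W S \<omega> = 0 \<longleftrightarrow> W 0 \<omega> \<in> S"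
  using entry_time_eq_iff[OF assms(1,2), of 0] assms(3) by auto

lemma extend_killed_start:
  assumes "\<omega> \<in> space M" "W 0 \<omega> \<in> {0<..<1}"
  shows "extend \<phi> (killed W 0 \<omega>) = \<phi> (W 0 \<omega>)"
proof -
  \<comment> \<open>The lifetime is the entry time of the empty set, so
    \<open>entry_time_start\<close> applies to it.\<close>
  have "lifetime W \<omega> \<noteq> 0"
    using entry_time_start[OF closed_empty assms] by (simp add: entry_time_eq_hit_time lifetime_eq_hit_time)
  then have "0 < lifetime W \<omega>" by (simp add: zero_less_iff_neq_zero)
  then show ?thesis by (simp add: extend_killed)
qed

lemma payoff_stop_now:
  assumes "rewards f g h" "\<tau> \<in> stopping_times P G" "closed S'" "x \<in> {0<..<1}" "x \<notin> S'"
    and "AE \<omega> in completion (P x). \<tau> \<omega> = 0"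
  shows "payoff P W f g h x \<tau> (entry_time W S') = f x"
proof (rule payoff_AE_const[OF assms(1,2) stopping_time_entry[OF assms(3)]])
  show "AE \<omega> in completion (P x). reward_at W f g h (\<tau> \<omega>) (entry_time W S' \<omega>) \<omega> = f x"
    using assms(6) AE_start
  proof eventually_elim
    case (elim \<omega>)
    then have "0 < entry_time W S' \<omega>"
      using entry_time_start[of S' \<omega>] assms by (auto simp: zero_less_iff_neq_zero)
    then show ?case
      using elim extend_killed_start[of \<omega> f] assms(4) by (simp add: reward_at_cases)
  qed
qed

lemma payoff_in_own_set:
  assumes "rewards f g h" "closed S" "closed S'" "x \<in> {0<..<1}" "x \<in> S" "x \<notin> S'"
  shows "payoff P W f g h x (entry_time W S) (entry_time W S') = f x"
proof (rule payoff_stop_now[OF assms(1) stopping_time_entry[OF assms(2)] assms(3,4,6)])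
  show "AE \<omega> in completion (P x). entry_time W S \<omega> = 0"
    using AE_start by eventually_elim (use assms entry_time_start in auto)
qed

text \<open>The opponent ends the game at once: waiting earns g x, a tie earns h x, and h is at most
  g.\<close>

lemma payoff_in_opponent_set:
  assumes r: "rewards f g h" and \<tau>: "\<tau> \<in> stopping_times P G" and S: "closed S" "closed S'"
    and x: "x \<in> {0<..<1}" "x \<in> S'"
  shows "payoff P W f g h x \<tau> (entry_time W S') \<le> g x"
    and "x \<notin> S \<Longrightarrow> payoff P W f g h x (entry_time W S) (entry_time W S') = g x"
proof -
  interpret C: prob_space "completion (P x)" by (rule prob_space_completion_P)
  have "AE \<omega> in completion (P x). reward_at W f g h (\<tau> \<omega>) (entry_time W S' \<omega>) \<omega> \<le> g x"
    using AE_start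
  proof eventually_elim
    case (elim \<omega>)
    then have 0: "entry_time W S' \<omega> = 0"
      using entry_time_start[of S' \<omega>] S x by auto
    show ?case
      using elim extend_killed_start[of \<omega> g] extend_killed_start[of \<omega> h] x rewards_le(2)[OF r, of x]
      by (cases "\<tau> \<omega> = 0") (auto simp: reward_at_cases 0 zero_less_iff_neq_zero)
  qed
  then have "(\<integral>\<omega>. reward_at W f g h (\<tau> \<omega>) (entry_time W S' \<omega>) \<omega> \<partial>completion (P x)) \<le> (\<integral>\<omega>. g x \<partial>completion (P x))"
    by (intro integral_mono_AE reward_at_integrable r \<tau> stopping_time_entry S) auto
  then show "payoff P W f g h x \<tau> (entry_time W S') \<le> g x"
    using prob_space.prob_space[OF prob_space_P, of x] by (simp add: payoff_eq_reward_at)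
  assume "x \<notin> S"
  show "payoff P W f g h x (entry_time W S) (entry_time W S') = g x"
  proof (rule payoff_AE_const[OF r stopping_time_entry stopping_time_entry], rule S, rule S)
    show "AE \<omega> in completion (P x). reward_at W f g h (entry_time W S \<omega>) (entry_time W S' \<omega>) \<omega> = g x"
      using AE_start
    proof eventually_elim
      case (elim \<omega>)
      then have "entry_time W S' \<omega> = 0" "entry_time W S \<omega> \<noteq> 0"
        using entry_time_start[of S' \<omega>] entry_time_start[of S \<omega>] S x \<open>x \<notin> S\<close> by auto
      then show ?case
        using elim extend_killed_start[of \<omega> g] x by (simp add: reward_at_cases zero_less_iff_neq_zero)
    qed
  qed
qed

end

section \<open>Concave majorants\<close>

lemma D01_has_derivative:
  assumes "\<phi> differentiable_on {0..1}" "x \<in> {0..1}"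
  shows "(\<phi> has_real_derivative D01 \<phi> x) (at x within {0..1})"
  using assms unfolding D01_def differentiable_on_def has_real_derivative_iff_has_vector_derivative
  by (simp flip: vector_derivative_works)

lemma C2_01D:
  assumes "C2_01 \<phi>"
  shows "x \<in> {0..1} \<Longrightarrow> (\<phi> has_real_derivative D01 \<phi> x) (at x within {0..1})"
    and "x \<in> {0..1} \<Longrightarrow> (D01 \<phi> has_real_derivative D01 (D01 \<phi>) x) (at x within {0..1})"
    and "continuous_on {0..1} (D01 \<phi>)"
  using assms unfolding C2_01_def
  by (auto intro: D01_has_derivative differentiable_imp_continuous_on)

text \<open>Difference quotients along a segment from x are at most the chord increment, which gives
  the weak inequality. Applying it at the midpoint, which lies strictly below the chord, makes it
  strict. The derivative is taken within T so that one-sided tangents at end points are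
  covered.\<close>

lemma strictly_convex_tangent:
  assumes conv: "strictly_convex_on S \<phi>" and ST: "S \<subseteq> T"
    and deriv: "(\<phi> has_real_derivative D) (at x within T)"
    and x: "x \<in> S" and x': "x' \<in> S" and ne: "x \<noteq> x'"
  shows "\<phi> x + D * (x' - x) < \<phi> x'"
proof -
  have convS: "convex S" using conv by (simp add: strictly_convex_on_def)
  have chord: "\<phi> ((1 - u) * x + u * y) < (1 - u) * \<phi> x + u * \<phi> y"
    if "0 < u" "u < 1" "y \<in> S" "x \<noteq> y" for u y
    using conv x that by (simp add: strictly_convex_on_def)
  have weak: "D * (y - x) \<le> \<phi> y - \<phi> x" if y: "y \<in> S" "x \<noteq> y" for y
  proof -
    define \<psi> where "\<psi> u = \<phi> (x + u * (y - x))" for u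
    have "(\<psi> has_real_derivative D * (y - x)) (at 0 within {0..1})"
      unfolding \<psi>_def
    proof (rule DERIV_image_chain[of \<phi> D "\<lambda>u. x + u * (y - x)", unfolded o_def])
      have "(\<lambda>u. x + u * (y - x)) ` {0..1} \<subseteq> T"
      proof clarify
        fix u :: real assume "u \<in> {0..1}"
        then have "(1 - u) *\<^sub>R x + u *\<^sub>R y \<in> S"
          using convexD_alt[OF convS x y(1)] by simp
        then show "x + u * (y - x) \<in> T" using ST by (auto simp: algebra_simps)
      qed
      then show "(\<phi> has_real_derivative D) (at (x + 0 * (y - x)) within (\<lambda>u. x + u * (y - x)) ` {0..1})"
        using deriv by (auto intro: has_field_derivative_subset)
    qed (auto intro!: derivative_eq_intros)
    then have "((\<lambda>u. (\<psi> u - \<psi> 0) / (u - 0)) \<longlongrightarrow> D * (y - x)) (at 0 within {0..1})"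
      unfolding has_field_derivative_iff .
    then have "((\<lambda>u. (\<psi> u - \<psi> 0) / (u - 0)) \<longlongrightarrow> D * (y - x)) (at 0 within {0<..<1})"
      by (rule tendsto_within_subset) auto
    moreover have "\<forall>\<^sub>F u in at 0 within {0<..<1}. (\<psi> u - \<psi> 0) / (u - 0) \<le> \<phi> y - \<phi> x"
      unfolding eventually_at_filter
    proof (intro always_eventually allI impI)
      fix u :: real assume "u \<in> {0<..<1}"
      then have u: "0 < u" "u < 1" by auto
      have "\<psi> u - \<psi> 0 \<le> u * (\<phi> y - \<phi> x)"
        using chord[OF u y] by (simp add: \<psi>_def algebra_simps)
      then show "(\<psi> u - \<psi> 0) / (u - 0) \<le> \<phi> y - \<phi> x"
        using u by (simp add: field_simps)
    qed
    moreover have "at (0::real) within {0<..<1} \<noteq> bot"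
      by (simp add: at_within_eq_bot_iff)
    ultimately show ?thesis by (rule tendsto_upperbound)
  qed
  define mid where "mid = (x + x') / 2"
  have "(1 - 1/2) *\<^sub>R x + (1/2) *\<^sub>R x' \<in> S"
    using convexD_alt[OF convS x x', of "1/2"] by simp
  then have mid: "mid \<in> S" "x \<noteq> mid" using ne by (auto simp: mid_def field_simps)
  have "D * (mid - x) \<le> \<phi> mid - \<phi> x" using mid by (rule weak)
  also have "\<phi> mid < (1 - 1/2) * \<phi> x + 1/2 * \<phi> x'"
    using chord[of "1/2" x'] x' ne by (simp add: mid_def add_divide_distrib)
  finally show ?thesis by (simp add: mid_def field_simps)
qed

text \<open>
  The value function \<open>u\<close> of a player with rewards \<open>f, g\<close> on an interval \<open>(c,d)\<close> bounded by the
  opponent's stopping set, with superdifferential \<open>p\<close>: the player may stop in \<open>I\<close>, it is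
  optimal to stop in \<open>K\<close>, and \<open>u\<close> lies strictly above its chords over points of \<open>Z\<close>.
\<close>

definition value_function :: "(real \<Rightarrow> real) \<Rightarrow> (real \<Rightarrow> real) \<Rightarrow> real set \<Rightarrow> real set \<Rightarrow> real set \<Rightarrow>
    real \<Rightarrow> real \<Rightarrow> (real \<Rightarrow> real) \<Rightarrow> (real \<Rightarrow> real) \<Rightarrow> bool" where
  "value_function f g I K Z c d u p \<longleftrightarrow>
     (\<forall>w w'. u w' - u w \<le> p w * (w' - w)) \<and> continuous_on UNIV p \<and> (\<exists>B. \<forall>w. \<bar>p w\<bar> \<le> B) \<and>
     (\<forall>w\<in>{c..d}. f w \<le> u w) \<and> u c = g c \<and> u d = g d \<and>
     closed K \<and> K \<subseteq> {c..d} \<and> (\<forall>w\<in>K. u w = f w) \<and>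
     (\<forall>s t. c \<le> s \<and> s < t \<and> t \<le> d \<and> {s<..<t} \<inter> K = {} \<longrightarrow> (\<exists>\<alpha> \<beta>. \<forall>w\<in>{s..t}. u w = \<alpha> * w + \<beta>)) \<and>
     (\<forall>w\<in>I \<inter> {c<..<d} - K. f w < u w) \<and>
     (\<forall>z\<in>Z. \<forall>s t \<alpha> \<beta>. c \<le> s \<and> s < z \<and> z < t \<and> t \<le> d \<and> \<alpha> * s + \<beta> \<le> u s \<and> \<alpha> * t + \<beta> \<le> u t
        \<longrightarrow> \<alpha> * z + \<beta> < u z)"

lemma value_functionD:
  assumes "value_function f g I K Z c d u p"
  shows "u w' - u w \<le> p w * (w' - w)" "continuous_on UNIV p" "\<exists>B. \<forall>w. \<bar>p w\<bar> \<le> B"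
    "w \<in> {c..d} \<Longrightarrow> f w \<le> u w" "u c = g c" "u d = g d"
    "closed K" "K \<subseteq> {c..d}" "w \<in> K \<Longrightarrow> u w = f w"
    "c \<le> s \<Longrightarrow> s < t \<Longrightarrow> t \<le> d \<Longrightarrow> {s<..<t} \<inter> K = {} \<Longrightarrow> \<exists>\<alpha> \<beta>. \<forall>w\<in>{s..t}. u w = \<alpha> * w + \<beta>"
    "w \<in> I \<Longrightarrow> w \<in> {c<..<d} \<Longrightarrow> w \<notin> K \<Longrightarrow> f w < u w"
    "z \<in> Z \<Longrightarrow> c \<le> s \<Longrightarrow> s < z \<Longrightarrow> z < t \<Longrightarrow> t \<le> d \<Longrightarrow> \<alpha> * s + \<beta> \<le> u s \<Longrightarrow> \<alpha> * t + \<beta> \<le> u t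
      \<Longrightarrow> \<alpha> * z + \<beta> < u z"
  using assms unfolding value_function_def by simp_all

text \<open>Reflection swaps the ends of the interval, turns \<alpha> w + \<beta> into -\<alpha> w +
  (\<alpha> + \<beta>) and, by the chain rule, reverses the sign of the superdifferential.\<close>

lemma value_function_reflect:
  assumes "value_function f g I K Z c d u p"
  shows "value_function (\<lambda>w. f (1 - w)) (\<lambda>w. g (1 - w)) ((\<lambda>w. 1 - w) -` I) ((\<lambda>w. 1 - w) -` K)
    ((\<lambda>w. 1 - w) -` Z) (1 - d) (1 - c) (\<lambda>w. u (1 - w)) (\<lambda>w. - p (1 - w))"
  unfolding value_function_def
proof (intro conjI)
  note vf = value_functionD[OF assms]
  show "\<forall>w w'. u (1 - w') - u (1 - w) \<le> - p (1 - w) * (w' - w)"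
  proof (intro allI)
    fix w w'
    have "u (1 - w') - u (1 - w) \<le> p (1 - w) * ((1 - w') - (1 - w))" by (rule vf(1))
    then show "u (1 - w') - u (1 - w) \<le> - p (1 - w) * (w' - w)" by (simp add: algebra_simps)
  qed
  show "continuous_on UNIV (\<lambda>w. - p (1 - w))"
    by (intro continuous_intros continuous_on_compose2[OF vf(2)]) auto
  show "\<exists>B. \<forall>w. \<bar>- p (1 - w)\<bar> \<le> B" using vf(3) by auto
  show "\<forall>w\<in>{1 - d..1 - c}. f (1 - w) \<le> u (1 - w)" using vf(4) by auto
  show "u (1 - (1 - d)) = g (1 - (1 - d))" "u (1 - (1 - c)) = g (1 - (1 - c))" using vf(5,6) by auto
  have "continuous_on UNIV (\<lambda>w::real. 1 - w)" by (intro continuous_intros)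
  then show "closed ((\<lambda>w. 1 - w) -` K)" using vf(7) by (intro closed_vimage)
  show "(\<lambda>w. 1 - w) -` K \<subseteq> {1 - d..1 - c}" using vf(8) by force
  show "\<forall>w\<in>(\<lambda>w. 1 - w) -` K. u (1 - w) = f (1 - w)" using vf(9) by auto
  show "\<forall>s t. 1 - d \<le> s \<and> s < t \<and> t \<le> 1 - c \<and> {s<..<t} \<inter> (\<lambda>w. 1 - w) -` K = {} \<longrightarrow>
      (\<exists>\<alpha> \<beta>. \<forall>w\<in>{s..t}. u (1 - w) = \<alpha> * w + \<beta>)"
  proof clarify
    fix s t assume st: "1 - d \<le> s" "s < t" "t \<le> 1 - c" "{s<..<t} \<inter> (\<lambda>w. 1 - w) -` K = {}"
    have "{1 - t<..<1 - s} \<inter> K = {}"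
    proof safe
      fix w assume "w \<in> {1 - t<..<1 - s}" "w \<in> K"
      then have "1 - w \<in> {s<..<t} \<inter> (\<lambda>w. 1 - w) -` K" by auto
      then show "w \<in> {}" using st by simp
    qed
    then obtain \<alpha> \<beta> where "\<forall>w\<in>{1 - t..1 - s}. u w = \<alpha> * w + \<beta>"
      using vf(10)[of "1 - t" "1 - s"] st by auto
    then have "\<forall>w\<in>{s..t}. u (1 - w) = (- \<alpha>) * w + (\<alpha> + \<beta>)" by (auto simp: algebra_simps)
    then show "\<exists>\<alpha> \<beta>. \<forall>w\<in>{s..t}. u (1 - w) = \<alpha> * w + \<beta>" by blast
  qed
  show "\<forall>w\<in>(\<lambda>w. 1 - w) -` I \<inter> {1 - d<..<1 - c} - (\<lambda>w. 1 - w) -` K. f (1 - w) < u (1 - w)"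
    using vf(11) by auto
  show "\<forall>z\<in>(\<lambda>w. 1 - w) -` Z. \<forall>s t \<alpha> \<beta>. 1 - d \<le> s \<and> s < z \<and> z < t \<and> t \<le> 1 - c \<and>
      \<alpha> * s + \<beta> \<le> u (1 - s) \<and> \<alpha> * t + \<beta> \<le> u (1 - t) \<longrightarrow> \<alpha> * z + \<beta> < u (1 - z)"
  proof clarify
    fix z s t \<alpha> \<beta>
    assume *: "1 - z \<in> Z" "1 - d \<le> s" "s < z" "z < t" "t \<le> 1 - c"
      "\<alpha> * s + \<beta> \<le> u (1 - s)" "\<alpha> * t + \<beta> \<le> u (1 - t)"
    have "(- \<alpha>) * (1 - z) + (\<alpha> + \<beta>) < u (1 - z)"
      by (rule vf(12)[of "1 - z" "1 - t" "1 - s"]) (use * in \<open>auto simp: algebra_simps\<close>)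
    then show "\<alpha> * z + \<beta> < u (1 - z)" by (simp add: algebra_simps)
  qed
qed

section \<open>The one-player problem\<close>

text \<open>The derivative is a parameter so that the second player becomes an instance, with the
  reflected derivative -D01 f (1 - w) in its place.\<close>

locale one_sided =
  fixes f f' g :: "real \<Rightarrow> real" and a :: real
  assumes a: "0 < a" "a < 1"
    and f0: "f 0 = 0" and g0: "g 0 = 0"
    and f_le_g: "\<And>x. x \<in> {0..1} \<Longrightarrow> f x \<le> g x"
    and deriv: "\<And>x. x \<in> {0..1} \<Longrightarrow> (f has_real_derivative f' x) (at x within {0..1})"
    and f'_cont: "continuous_on {0..1} f'"
    and g_cont: "continuous_on {0..1} g"
    and concave: "strictly_concave_on {0..a} f"
    and convex: "strictly_convex_on {a..1} f"
begin

text \<open>\<open>slope_gap x y = (y - x)\<^sup>2 * \<partial>\<^sub>x U1(x, y)\<close>\<close>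

definition slope_gap :: "real \<Rightarrow> real \<Rightarrow> real" where
  "slope_gap x y = f x + f' x * (y - x) - g y"

lemma tangent_above: "x \<in> {0..a} \<Longrightarrow> x' \<in> {0..a} \<Longrightarrow> x \<noteq> x' \<Longrightarrow> f x' < f x + f' x * (x' - x)"
  using strictly_convex_tangent[OF concave[unfolded strictly_concave_on_def] _ DERIV_minus[OF deriv[of x]], of x'] a
  by simp

lemma tangent_above_le: "x \<in> {0..a} \<Longrightarrow> x' \<in> {0..a} \<Longrightarrow> f x' \<le> f x + f' x * (x' - x)"
  using tangent_above[of x x'] by (cases "x = x'") auto

lemma f'_decreasing:
  assumes "x \<in> {0..a}" "x' \<in> {0..a}" "x < x'"
  shows "f' x' < f' x"
proof -
  have "f' x' * (x' - x) < f' x * (x' - x)"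
    using tangent_above[of x x'] tangent_above[of x' x] assms by (simp add: algebra_simps)
  then show ?thesis using assms by simp
qed

text \<open>The point a also belongs to the convex part, so the tangent there lies strictly below f
  at y, and f is at most g.\<close>

lemma slope_gap_at_a:
  assumes "y \<in> {a<..1}"
  shows "slope_gap a y < 0"
proof -
  have "f a + f' a * (y - a) < f y"
    using strictly_convex_tangent[OF convex _ deriv] assms a by auto
  also have "\<dots> \<le> g y" using assms a by (intro f_le_g) auto
  finally show ?thesis by (simp add: slope_gap_def)
qed

text \<open>The tangent at 0 lies above f on the concave part. If f exceeds the line from the origin
  to (y, g y) at some x, the tangent is therefore steeper than that line.\<close>

lemma slope_gap_at_0:
  assumes "0 < y" "x \<in> {0<..a}" "g y * (x / y) < f x"
  shows "0 < slope_gap 0 y"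
proof -
  have "g y * (x / y) < f' 0 * x"
    using tangent_above[of 0 x] assms a f0 by auto
  then have "g y * x < (f' 0 * y) * x" using assms by (simp add: field_simps)
  then have "g y < f' 0 * y" using assms by simp
  then show ?thesis by (simp add: slope_gap_def f0)
qed

lemma slope_gap_root_interior:
  assumes "l \<in> {0..a}" "slope_gap l y = 0" "y \<in> {a<..1}" "0 < slope_gap 0 y"
  shows "l \<in> {0<..<a}"
proof -
  have "l \<noteq> 0" "l \<noteq> a" using assms slope_gap_at_a[of y] by auto
  then show ?thesis using assms(1) by simp
qed

lemma f_cont: "continuous_on {0..1} f"
  using deriv by (rule DERIV_continuous_on)

lemma slope_gap_root_exists:
  assumes "y \<in> {a<..1}" "0 < slope_gap 0 y"
  shows "\<exists>l\<in>{0<..<a}. slope_gap l y = 0"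
proof -
  have sub: "{0..a} \<subseteq> {0..1}" using a by auto
  have "continuous_on {0..a} (\<lambda>x. slope_gap x y)"
    unfolding slope_gap_def using continuous_on_subset[OF f_cont sub] continuous_on_subset[OF f'_cont sub]
    by (intro continuous_intros)
  then obtain l where "0 \<le> l" "l \<le> a" "slope_gap l y = 0"
    using IVT2'[of "\<lambda>x. slope_gap x y" a 0 0] slope_gap_at_a[OF assms(1)] assms(2) a by auto
  then show ?thesis using slope_gap_root_interior assms by auto
qed

text \<open>
  \<open>y * U1 x y\<close> is the intercept at \<open>0\<close> of the line through \<open>(x, f x)\<close> and \<open>(y, g y)\<close>; when
  \<open>slope_gap l y = 0\<close>, that line is tangent to the concave part of \<open>f\<close> at \<open>l\<close>.
\<close>

lemma U1_less_at_root:
  assumes l: "l \<in> {0..a}" "slope_gap l y = 0" and y: "y \<in> {a<..1}" and x: "x \<in> {0..a}" "x \<noteq> l"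
  shows "U1 f g x y < U1 f g l y"
proof -
  define k where "k = f l - f' l * l"
  have gy: "g y = k + f' l * y" using l(2) by (simp add: slope_gap_def k_def algebra_simps)
  have pos: "0 < y" "0 < y - x" "0 < y - l" using y x l a by auto
  \<comment> \<open>Splits off the tangent at l, which also passes through (y, g y) and contributes
    the constant k / y; the other term has the sign of f minus the tangent.\<close>
  have U: "U1 f g z y = (f z - (k + f' l * z)) / (y - z) + k / y" if "z \<in> {0..a}" for z
    using that y pos(1) by (simp add: U1_def gy field_simps)
  have "f x - (k + f' l * x) < 0"
    using tangent_above[of l x] x l by (simp add: k_def algebra_simps)
  then have "U1 f g x y < k / y"
    using pos by (simp add: U[OF x(1)] divide_neg_pos)
  also have "\<dots> = U1 f g l y"
    by (subst U[OF l(1)]) (simp add: k_def)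
  finally show ?thesis .
qed

text \<open>
  \<open>val l\<close> equals \<open>f\<close> on \<open>[0,l]\<close> and is continued by the tangents at \<open>0\<close> and \<open>l\<close>, so
  that it is concave and Lipschitz on the whole line.
\<close>

definition clamp :: "real \<Rightarrow> real \<Rightarrow> real" where
  "clamp l w = max 0 (min l w)"

definition val :: "real \<Rightarrow> real \<Rightarrow> real" where
  "val l w = f (clamp l w) + f' (clamp l w) * (w - clamp l w)"

text \<open>The tangent at m dominates f at m', which leaves (f' m' - f' m) (w' - m') to be shown
  nonpositive. The second factor is nonzero only for w' left of 0 or right of l, where f' m' is the
  smallest factor of its sign: the largest slope on [0,l] in the first case, the smallest in the
  second.\<close>

lemma val_superdifferential:
  assumes l: "l \<in> {0..a}"
  shows "val l w' - val l w \<le> f' (clamp l w) * (w' - w)"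
proof -
  define m m' where "m = clamp l w" and "m' = clamp l w'"
  have m: "m \<in> {0..a}" "m' \<in> {0..a}" "m \<in> {0..l}" "m' \<in> {0..l}"
    using l by (auto simp: m_def m'_def clamp_def)
  have mono: "f' s \<le> f' t" if "t \<le> s" "s \<in> {0..l}" "t \<in> {0..l}" for s t
    using f'_decreasing[of t s] that l by (cases "s = t") auto
  have "(f' m' - f' m) * (w' - m') \<le> 0"
  proof (cases w' m' rule: linorder_cases)
    case less
    then have "m' = 0" by (auto simp: m'_def clamp_def)
    then show ?thesis using mono[of m' m] m less by (intro mult_nonneg_nonpos) auto
  next
    case greater
    then have "m' = l" using l by (auto simp: m'_def clamp_def min_def max_def split: if_splits)
    then show ?thesis using mono[of m m'] m greater by (intro mult_nonpos_nonneg) auto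
  qed simp
  then show ?thesis
    using tangent_above_le[OF m(1,2)] unfolding val_def m_def[symmetric] m'_def[symmetric]
    by (simp add: algebra_simps)
qed

lemma val_left: "w \<in> {0..l} \<Longrightarrow> val l w = f w"
  by (simp add: val_def clamp_def)

lemma val_right: "0 \<le> l \<Longrightarrow> l \<le> w \<Longrightarrow> val l w = f l + f' l * (w - l)"
  by (simp add: val_def clamp_def)

text \<open>On [0,a] the tangent at l dominates f by concavity. On [a,y] the convex f lies below its
  chord, and both ends of that chord are dominated, at y because f is at most g and the tangent ends
  at g y.\<close>

lemma value_function_val:
  assumes l: "l \<in> {0<..<a}" and y: "y \<in> {a<..1}" and root: "slope_gap l y = 0"
  shows "value_function f g {0..a} {0..l} {0<..<l} 0 y (val l) (\<lambda>w. f' (clamp l w))"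
  unfolding value_function_def
proof (intro conjI)
  have la: "l \<in> {0..a}" using l by auto
  show "\<forall>w w'. val l w' - val l w \<le> f' (clamp l w) * (w' - w)"
    using val_superdifferential[OF la] by blast
  have range: "clamp l w \<in> {0..1}" for w using l a by (auto simp: clamp_def)
  have "continuous_on UNIV (clamp l)"
    unfolding clamp_def by (intro continuous_intros)
  then show "continuous_on UNIV (\<lambda>w. f' (clamp l w))"
    using range by (intro continuous_on_compose2[OF f'_cont]) auto
  obtain B where "\<forall>w\<in>{0..1}. \<bar>f' w\<bar> \<le> B"
    using compact_imp_bounded[OF compact_continuous_image[OF f'_cont compact_Icc]] by (auto simp: bounded_iff)
  then show "\<exists>B. \<forall>w. \<bar>f' (clamp l w)\<bar> \<le> B" using range by blast
  have val_y: "val l y = g y"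
    using root l y by (simp add: val_right slope_gap_def)
  show "val l 0 = g 0" using l f0 g0 by (simp add: val_left)
  show "val l y = g y" by (rule val_y)
  have strict: "f w < val l w" if "w \<in> {l<..a}" for w
    using tangent_above[of l w] that l by (simp add: val_right)
  show "\<forall>w\<in>{0..a} \<inter> {0<..<y} - {0..l}. f w < val l w"
    using strict by auto
  have le_a: "f w \<le> val l w" if "w \<in> {0..a}" for w
    using strict[of w] val_left[of w l] that by (cases "w \<le> l") auto
  show "\<forall>w\<in>{0..y}. f w \<le> val l w"
  proof
    fix w assume w: "w \<in> {0..y}"
    consider "w \<le> a" | "w = y" | "a < w" "w < y" using w by fastforce
    then show "f w \<le> val l w"
    proof cases
      case 1
      then show ?thesis using le_a w by auto
    next
      case 2
      then show ?thesis using val_y f_le_g[of y] y a by auto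
    next
      case 3
      define u where "u = (w - a) / (y - a)"
      have u: "0 < u" "u < 1" using 3 y by (auto simp: u_def field_simps)
      have "u * (y - a) = w - a" using 3 by (simp add: u_def)
      then have w_eq: "w = (1 - u) * a + u * y" by (simp add: algebra_simps)
      have "f ((1 - u) * a + u * y) < (1 - u) * f a + u * f y"
        using convex u y a unfolding strictly_convex_on_def by auto
      also have "\<dots> \<le> (1 - u) * val l a + u * val l y"
        using u le_a[of a] val_y f_le_g[of y] y a by (intro add_mono mult_left_mono) auto
      also have "\<dots> = val l w"
        using l y 3 by (simp add: val_right) (simp add: w_eq algebra_simps)
      finally show ?thesis using w_eq by simp
    qed
  qed
  show "closed {0..l}" "{0..l} \<subseteq> {0..y}" "\<forall>w\<in>{0..l}. val l w = f w"
    using l y by (auto simp: val_left)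
  show "\<forall>s t. 0 \<le> s \<and> s < t \<and> t \<le> y \<and> {s<..<t} \<inter> {0..l} = {} \<longrightarrow> (\<exists>\<alpha> \<beta>. \<forall>w\<in>{s..t}. val l w = \<alpha> * w + \<beta>)"
  proof clarify
    fix s t assume st: "0 \<le> s" "s < t" "t \<le> y" "{s<..<t} \<inter> {0..l} = {}"
    have "l \<le> s"
    proof (rule ccontr)
      assume "\<not> l \<le> s"
      then obtain w where "s < w" "w < min l t" using st dense[of s "min l t"] by auto
      then have "w \<in> {s<..<t} \<inter> {0..l}" using st by auto
      then show False using st by simp
    qed
    then have "\<forall>w\<in>{s..t}. val l w = f' l * w + (f l - f' l * l)"
      using l by (auto simp: val_right algebra_simps)
    then show "\<exists>\<alpha> \<beta>. \<forall>w\<in>{s..t}. val l w = \<alpha> * w + \<beta>" by blast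
  qed
  show "\<forall>z\<in>{0<..<l}. \<forall>s t \<alpha> \<beta>. 0 \<le> s \<and> s < z \<and> z < t \<and> t \<le> y \<and> \<alpha> * s + \<beta> \<le> val l s \<and>
      \<alpha> * t + \<beta> \<le> val l t \<longrightarrow> \<alpha> * z + \<beta> < val l z"
  proof clarify
    fix z s t \<alpha> \<beta>
    assume z: "z \<in> {0<..<l}" and st: "0 \<le> s" "s < z" "z < t" "t \<le> y"
      and le: "\<alpha> * s + \<beta> \<le> val l s" "\<alpha> * t + \<beta> \<le> val l t"
    have cz: "clamp l z = z" using z by (simp add: clamp_def)
    \<comment> \<open>As s < z < l, both points lie in the strictly concave part, so this inequality
      is strict; t may already lie on the tangent. One strict side is enough.\<close>
    have vs: "val l s < val l z + f' z * (s - z)"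
      using tangent_above[of z s] z st l by (simp add: val_left)
    have vt: "val l t \<le> val l z + f' z * (t - z)"
      using val_superdifferential[OF la, of t z] cz by simp
    show "\<alpha> * z + \<beta> < val l z"
    proof (rule ccontr)
      assume "\<not> \<alpha> * z + \<beta> < val l z"
      then have "\<alpha> * (s - z) < f' z * (s - z)" "\<alpha> * (t - z) \<le> f' z * (t - z)"
        using vs vt le by (simp_all add: algebra_simps)
      then show False using st by simp
    qed
  qed
qed

end

section \<open>Solutions of the tangency equations\<close>

lemma strictly_convex_on_reflect:
  fixes c d :: real
  assumes "strictly_convex_on {c..d} \<phi>"
  shows "strictly_convex_on {1 - d..1 - c} (\<lambda>w. \<phi> (1 - w))"
  unfolding strictly_convex_on_def
proof (intro conjI allI impI)
  fix u x y :: real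
  assume *: "0 < u \<and> u < 1 \<and> x \<in> {1 - d..1 - c} \<and> y \<in> {1 - d..1 - c} \<and> x \<noteq> y"
  have "\<phi> ((1 - u) * (1 - x) + u * (1 - y)) < (1 - u) * \<phi> (1 - x) + u * \<phi> (1 - y)"
    using assms * unfolding strictly_convex_on_def by auto
  moreover have "(1 - u) * (1 - x) + u * (1 - y) = 1 - ((1 - u) * x + u * y)" by algebra
  ultimately show "\<phi> (1 - ((1 - u) * x + u * y)) < (1 - u) * \<phi> (1 - x) + u * \<phi> (1 - y)" by simp
qed simp

lemma one_sided_left:
  assumes "rewards f g h" "C2_01 f" "a \<in> {0<..<1}"
    "strictly_concave_on {0..a} f" "strictly_convex_on {a..1} f"
  shows "one_sided f (D01 f) g a"
proof
  show "f x \<le> g x" if "x \<in> {0..1}" for x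
    using rewards_le[OF assms(1) that] by simp
qed (use assms C2_01D[OF assms(2)] in \<open>auto simp: rewards_def\<close>)

lemma one_sided_right:
  assumes "rewards f g h" "C2_01 f" "b \<in> {0<..<1}"
    "strictly_convex_on {0..b} f" "strictly_concave_on {b..1} f"
  shows "one_sided (\<lambda>w. f (1 - w)) (\<lambda>w. - D01 f (1 - w)) (\<lambda>w. g (1 - w)) (1 - b)"
proof
  have img: "(\<lambda>w::real. 1 - w) ` {0..1} = {0..1}" by (auto intro: image_eqI[of _ _ "1 - _"])
  have refl: "continuous_on {0..1} (\<lambda>w. \<phi> (1 - w))" if "continuous_on {0..1} \<phi>" for \<phi> :: "real \<Rightarrow> real"
    by (rule continuous_on_compose2[OF that]) (auto intro!: continuous_intros)
  show "f (1 - x) \<le> g (1 - x)" if "x \<in> {0..1}" for x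
    using rewards_le[OF assms(1), of "1 - x"] that by simp
  show "((\<lambda>w. f (1 - w)) has_real_derivative - D01 f (1 - x)) (at x within {0..1})" if "x \<in> {0..1}" for x
  proof -
    have "((f \<circ> (\<lambda>w. 1 - w)) has_real_derivative D01 f (1 - x) * (- 1)) (at x within {0..1})"
      using C2_01D(1)[OF assms(2), of "1 - x"] that
      by (intro DERIV_image_chain) (auto simp: img intro!: derivative_eq_intros)
    then show ?thesis by (simp add: o_def)
  qed
  show "continuous_on {0..1} (\<lambda>w. - D01 f (1 - w))"
    using refl[OF C2_01D(3)[OF assms(2)]] by (rule continuous_on_minus)
  show "continuous_on {0..1} (\<lambda>w. g (1 - w))"
    using assms(1) by (intro refl) (simp add: rewards_def)
  show "strictly_concave_on {0..1 - b} (\<lambda>w. f (1 - w))"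
    using strictly_convex_on_reflect[OF assms(5)[unfolded strictly_concave_on_def]]
    by (simp add: strictly_concave_on_def)
  show "strictly_convex_on {1 - b..1} (\<lambda>w. f (1 - w))"
    using strictly_convex_on_reflect[OF assms(4)] by simp
qed (use assms in \<open>auto simp: rewards_def\<close>)

context one_sided
begin

text \<open>A root exists and beats every other point strictly, so stationarity singles out the
  global maximiser.\<close>

lemma maximiser_iff:
  assumes y: "y \<in> {a<..1}" and pos: "0 < slope_gap 0 y" and x: "x \<in> {0..a}"
  shows "ereal (U1 f g x y) = (SUP s\<in>{0..a}. ereal (U1 f g s y)) \<longleftrightarrow> slope_gap x y = 0"
proof
  assume root: "slope_gap x y = 0"
  have "U1 f g s y \<le> U1 f g x y" if "s \<in> {0..a}" for s
    using U1_less_at_root[OF x root y that] by (cases "s = x") auto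
  then show "ereal (U1 f g x y) = (SUP s\<in>{0..a}. ereal (U1 f g s y))"
    using x by (intro antisym SUP_upper SUP_least) auto
next
  assume eq: "ereal (U1 f g x y) = (SUP s\<in>{0..a}. ereal (U1 f g s y))"
  obtain l where l: "l \<in> {0<..<a}" "slope_gap l y = 0"
    using slope_gap_root_exists[OF y pos] by auto
  then have "ereal (U1 f g l y) \<le> ereal (U1 f g x y)"
    unfolding eq by (intro SUP_upper) auto
  then show "slope_gap x y = 0"
    using U1_less_at_root[OF _ l(2) y x] l by (cases "x = l") auto
qed

lemma continuous_on_slope_gap:
  "continuous_on ({0..1} \<times> {0..1}) (\<lambda>z. slope_gap (fst z) (snd z))"
  unfolding slope_gap_def
  by (intro continuous_intros continuous_on_compose2[OF f_cont] continuous_on_compose2[OF f'_cont]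
      continuous_on_compose2[OF g_cont]) auto

end

lemma gnep_sections:
  assumes "a < b"
  shows "y \<in> {b..1} \<Longrightarrow> {s. (s, y) \<in> gnep_set a b} = {0..a}"
    and "x \<in> {0..a} \<Longrightarrow> {s. (x, s) \<in> gnep_set a b} = {b..1}"
  using assms by (auto simp: gnep_set_def)

lemma U2_reflect:
  "U2 f g x y = U1 (\<lambda>w. f (1 - w)) (\<lambda>w. g (1 - w)) (1 - y) (1 - x)"
  by (simp add: U1_def U2_def)

section \<open>Existence of a common root\<close>

lemma clamp_fixed:
  fixes c0 c1 x \<delta> :: real
  assumes "x \<in> {c0..c1}" "max c0 (min c1 (x + \<delta>)) = x"
  shows "0 < \<delta> \<Longrightarrow> x = c1" "\<delta> < 0 \<Longrightarrow> x = c0"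
  using assms by (auto simp: max_def min_def split: if_splits)

text \<open>Brouwer is applied to z + (A z, B z) projected back onto the rectangle. At a fixed point
  a nonzero component would have to push outwards across a side, whereas the sign conditions make it
  point inwards.\<close>

lemma poincare_miranda:
  fixes A B :: "real \<times> real \<Rightarrow> real"
  assumes cd: "c0 \<le> c1" "d0 \<le> d1"
    and A: "continuous_on ({c0..c1} \<times> {d0..d1}) A" and B: "continuous_on ({c0..c1} \<times> {d0..d1}) B"
    and Aside: "\<And>y. y \<in> {d0..d1} \<Longrightarrow> 0 < A (c0, y)" "\<And>y. y \<in> {d0..d1} \<Longrightarrow> A (c1, y) < 0"
    and Bside: "\<And>x. x \<in> {c0..c1} \<Longrightarrow> 0 < B (x, d0)" "\<And>x. x \<in> {c0..c1} \<Longrightarrow> B (x, d1) < 0"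
  obtains x y where "x \<in> {c0..c1}" "y \<in> {d0..d1}" "A (x, y) = 0" "B (x, y) = 0"
proof -
  let ?R = "{c0..c1} \<times> {d0..d1}"
  define \<Phi> where "\<Phi> z = (max c0 (min c1 (fst z + A z)), max d0 (min d1 (snd z + B z)))" for z
  obtain z where z: "z \<in> ?R" "\<Phi> z = z"
  proof (rule brouwer[of ?R \<Phi>])
    show "compact ?R" "convex ?R" by (auto intro: compact_Times convex_Times)
    show "?R \<noteq> {}" using cd by auto
    show "continuous_on ?R \<Phi>"
      unfolding \<Phi>_def by (intro continuous_intros A B)
    show "\<Phi> \<in> ?R \<rightarrow> ?R" using cd by (auto simp: \<Phi>_def)
  qed
  obtain x y where xy: "z = (x, y)" by (cases z)
  have x: "x \<in> {c0..c1}" "max c0 (min c1 (x + A (x, y))) = x"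
    and y: "y \<in> {d0..d1}" "max d0 (min d1 (y + B (x, y))) = y"
    using z xy by (auto simp: \<Phi>_def)
  have "A (x, y) = 0"
  proof (rule ccontr)
    assume "A (x, y) \<noteq> 0"
    then consider "0 < A (x, y)" "x = c1" | "A (x, y) < 0" "x = c0"
      using clamp_fixed[OF x] by linarith
    then show False using Aside[OF y(1)] by cases auto
  qed
  moreover have "B (x, y) = 0"
  proof (rule ccontr)
    assume "B (x, y) \<noteq> 0"
    then consider "0 < B (x, y)" "y = d1" | "B (x, y) < 0" "y = d0"
      using clamp_fixed[OF y] by linarith
    then show False using Bside[OF x(1)] by cases auto
  qed
  ultimately show thesis using x(1) y(1) by (intro that)
qed

text \<open>Multiplying by 4 A completes the square. The discriminant condition excludes A = 0, and
  the argument works for either sign of A.\<close>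

lemma definite_quadratic_form:
  fixes A B C s t :: real
  assumes "A * s\<^sup>2 + B * s * t + C * t\<^sup>2 = 0" and disc: "0 < 4 * A * C - B\<^sup>2"
  shows "s = 0 \<and> t = 0"
proof -
  have "(2 * A * s + B * t)\<^sup>2 + (4 * A * C - B\<^sup>2) * t\<^sup>2 = 4 * A * (A * s\<^sup>2 + B * s * t + C * t\<^sup>2)"
    by algebra
  then have "(2 * A * s + B * t)\<^sup>2 + (4 * A * C - B\<^sup>2) * t\<^sup>2 = 0" using assms(1) by simp
  moreover have "0 \<le> (4 * A * C - B\<^sup>2) * t\<^sup>2" using disc by simp
  ultimately have "(4 * A * C - B\<^sup>2) * t\<^sup>2 = 0" by (smt (verit) zero_le_power2)
  then have "t = 0" using disc by simp
  moreover have "A \<noteq> 0" using disc by (auto simp: power2_eq_square)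
  ultimately show ?thesis using assms(1) by simp
qed

text \<open>
  Rosen's argument: along the segment between two solutions, the weighted pseudogradient applied
  to the direction of the segment vanishes at both ends, but its derivative is a definite form.
\<close>

lemma first_order_conditions_unique:
  fixes f1 g1 f2 g2 :: "real \<Rightarrow> real"
  defines "F1 x y \<equiv> f1 x + D01 f1 x * (y - x) - g1 y"
  defines "F2 x y \<equiv> f2 y - D01 f2 y * (y - x) - g2 x"
  assumes ab: "0 < a" "a < b" "b < 1"
    and C2: "C2_01 f1" "C2_01 g1" "C2_01 f2" "C2_01 g2"
    and disc: "\<And>x y. x \<in> {0..a} \<Longrightarrow> y \<in> {b..1} \<Longrightarrow>
          4 * r1 * r2 * H1 f1 g1 x y * H2 f2 g2 x y
            - (r1 * H3 f1 g1 x y + r2 * H4 f2 g2 x y)\<^sup>2 > 0"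
    and p: "x \<in> {0<..<a}" "y \<in> {b<..<1}" "F1 x y = 0" "F2 x y = 0"
    and q: "x' \<in> {0<..<a}" "y' \<in> {b<..<1}" "F1 x' y' = 0" "F2 x' y' = 0"
  shows "x = x' \<and> y = y'"
proof -
  define s t where "s = x' - x" and "t = y' - y"
  define X Y where "X \<theta> = x + \<theta> * s" and "Y \<theta> = y + \<theta> * t" for \<theta>
  \<comment> \<open>Divided by (y - x)^2, \<open>F1\<close> and -\<open>F2\<close> are the partial
    derivatives of U1 in x and of U2 in y, so \<Phi> is the weighted pseudogradient in the direction
    (s, t). The matching derivative is \<open>Q\<close> over (Y - X)^3.\<close>
  define \<Phi> where "\<Phi> \<theta> = (r1 * s * F1 (X \<theta>) (Y \<theta>) - r2 * t * F2 (X \<theta>) (Y \<theta>)) / (Y \<theta> - X \<theta>)\<^sup>2" for \<theta>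
  define Q where "Q \<theta> = (r1 * H1 f1 g1 (X \<theta>) (Y \<theta>)) * s\<^sup>2
      + (r1 * H3 f1 g1 (X \<theta>) (Y \<theta>) + r2 * H4 f2 g2 (X \<theta>) (Y \<theta>)) * s * t
      + (r2 * H2 f2 g2 (X \<theta>) (Y \<theta>)) * t\<^sup>2" for \<theta>
  have XY: "X \<theta> \<in> {0<..<a}" "Y \<theta> \<in> {b<..<1}" if "\<theta> \<in> {0..1}" for \<theta>
  proof -
    have "(1 - \<theta>) *\<^sub>R x + \<theta> *\<^sub>R x' \<in> {0<..<a}" "(1 - \<theta>) *\<^sub>R y + \<theta> *\<^sub>R y' \<in> {b<..<1}"
      using that p(1,2) q(1,2) by (intro convexD_alt[rule_format]; simp)+
    then show "X \<theta> \<in> {0<..<a}" "Y \<theta> \<in> {b<..<1}"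
      by (auto simp: X_def Y_def s_def t_def algebra_simps)
  qed
  have at: "(\<phi> has_real_derivative D01 \<phi> w) (at w)" "(D01 \<phi> has_real_derivative D01 (D01 \<phi>) w) (at w)"
    if "C2_01 \<phi>" "w \<in> {0<..<1}" for \<phi> w
    using C2_01D(1,2)[OF that(1), of w] that(2) at_within_Icc_at[of 0 w 1] by auto
  have deriv: "(\<Phi> has_real_derivative Q \<theta> / (Y \<theta> - X \<theta>) ^ 3) (at \<theta>)" if \<theta>: "\<theta> \<in> {0..1}" for \<theta>
  proof -
    have X: "X \<theta> \<in> {0<..<1}" and Y: "Y \<theta> \<in> {0<..<1}" and pos: "Y \<theta> - X \<theta> \<noteq> 0"
      using XY[OF \<theta>] ab by auto
    have dX: "(X has_real_derivative s) (at \<theta>)" and dY: "(Y has_real_derivative t) (at \<theta>)"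
      unfolding X_def Y_def by (auto intro!: derivative_eq_intros)
    note chain = DERIV_chain2[OF at(1)[OF C2(1) X] dX] DERIV_chain2[OF at(2)[OF C2(1) X] dX]
      DERIV_chain2[OF at(1)[OF C2(2) Y] dY] DERIV_chain2[OF at(1)[OF C2(3) Y] dY]
      DERIV_chain2[OF at(2)[OF C2(3) Y] dY] DERIV_chain2[OF at(1)[OF C2(4) X] dX]
    let ?F1 = "F1 (X \<theta>) (Y \<theta>)" and ?F2 = "F2 (X \<theta>) (Y \<theta>)" and ?d = "Y \<theta> - X \<theta>"
    define N where "N = r1 * s * (D01 (D01 f1) (X \<theta>) * s * ?d + D01 f1 (X \<theta>) * t - D01 g1 (Y \<theta>) * t)
        - r2 * t * (D01 f2 (Y \<theta>) * t - D01 (D01 f2) (Y \<theta>) * t * ?d - D01 f2 (Y \<theta>) * (t - s) - D01 g2 (X \<theta>) * s)"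
    have num: "((\<lambda>\<theta>. r1 * s * F1 (X \<theta>) (Y \<theta>) - r2 * t * F2 (X \<theta>) (Y \<theta>)) has_real_derivative N) (at \<theta>)"
      unfolding F1_def F2_def N_def
      by (rule derivative_eq_intros chain dX dY refl)+ (simp add: algebra_simps)
    have den: "((\<lambda>\<theta>. (Y \<theta> - X \<theta>)\<^sup>2) has_real_derivative 2 * ?d * (t - s)) (at \<theta>)"
      by (rule derivative_eq_intros dX dY refl)+ simp
    have "(\<Phi> has_real_derivative (N * ?d\<^sup>2 - (r1 * s * ?F1 - r2 * t * ?F2) * (2 * ?d * (t - s))) / (?d\<^sup>2 * ?d\<^sup>2)) (at \<theta>)"
      unfolding \<Phi>_def using pos by (intro DERIV_divide num den) simp
    moreover have Q_eq: "Q \<theta> = N * ?d - (r1 * s * ?F1 - r2 * t * ?F2) * (2 * (t - s))"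
      unfolding N_def Q_def H1_def H2_def H3_def H4_def F1_def F2_def by algebra
    have "N * ?d\<^sup>2 - (r1 * s * ?F1 - r2 * t * ?F2) * (2 * ?d * (t - s)) = ?d * Q \<theta>"
      unfolding Q_eq by algebra
    moreover have "(d * q) / (d\<^sup>2 * d\<^sup>2) = q / d ^ 3" if "d \<noteq> 0" for d q :: real
      using that by (simp add: power2_eq_square power3_eq_cube)
    ultimately show ?thesis using pos by simp
  qed
  have "\<exists>\<theta>. 0 < \<theta> \<and> \<theta> < 1 \<and> DERIV \<Phi> \<theta> :> 0"
  proof (rule Rolle)
    have "X 1 = x'" "Y 1 = y'" "X 0 = x" "Y 0 = y" by (simp_all add: X_def Y_def s_def t_def)
    then show "\<Phi> 0 = \<Phi> 1" using p q by (simp add: \<Phi>_def)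
    show "continuous_on {0..1} \<Phi>"
      by (rule DERIV_continuous_on[OF has_field_derivative_at_within[OF deriv]])
    show "\<Phi> differentiable (at \<theta>)" if "0 < \<theta>" "\<theta> < 1" for \<theta>
      using deriv[of \<theta>] that real_differentiable_def by auto
  qed simp
  then obtain \<theta> where \<theta>: "0 < \<theta>" "\<theta> < 1" "DERIV \<Phi> \<theta> :> 0" by auto
  have "Q \<theta> / (Y \<theta> - X \<theta>) ^ 3 = 0"
    using DERIV_unique[OF deriv \<theta>(3)] \<theta> by auto
  moreover have "Y \<theta> - X \<theta> \<noteq> 0" using XY[of \<theta>] \<theta> ab by auto
  ultimately have "Q \<theta> = 0" by simp
  moreover have "0 < 4 * (r1 * H1 f1 g1 (X \<theta>) (Y \<theta>)) * (r2 * H2 f2 g2 (X \<theta>) (Y \<theta>))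
      - (r1 * H3 f1 g1 (X \<theta>) (Y \<theta>) + r2 * H4 f2 g2 (X \<theta>) (Y \<theta>))\<^sup>2"
    using disc[of "X \<theta>" "Y \<theta>"] XY[of \<theta>] \<theta> by (simp add: mult_ac)
  ultimately have "s = 0 \<and> t = 0"
    unfolding Q_def by (rule definite_quadratic_form)
  then show ?thesis by (simp add: s_def t_def)
qed

section \<open>Equilibria of the Dynkin game\<close>

lemma gap_around:
  assumes T: "closed T" and x: "x \<in> {0<..<1}" "x \<notin> T"
  obtains s t where "gap T s t" "s < x" "x < t"
proof -
  have cl: "closed (T \<union> {0, 1})" using T by (intro closed_Un) auto
  have "\<exists>s\<in>(T \<union> {0, 1}) \<inter> {0..x}. \<forall>w\<in>(T \<union> {0, 1}) \<inter> {0..x}. w \<le> s"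
    using x by (intro compact_attains_sup closed_Int_compact cl) auto
  moreover have "\<exists>t\<in>(T \<union> {0, 1}) \<inter> {x..1}. \<forall>w\<in>(T \<union> {0, 1}) \<inter> {x..1}. t \<le> w"
    using x by (intro compact_attains_inf closed_Int_compact cl) auto
  ultimately obtain s t where s: "s \<in> (T \<union> {0, 1}) \<inter> {0..x}" "\<And>w. w \<in> (T \<union> {0, 1}) \<inter> {0..x} \<Longrightarrow> w \<le> s"
    and t: "t \<in> (T \<union> {0, 1}) \<inter> {x..1}" "\<And>w. w \<in> (T \<union> {0, 1}) \<inter> {x..1} \<Longrightarrow> t \<le> w"
    by blast
  have "s < x" "x < t"
    using s(1) t(1) x by (auto simp: order_less_le)
  moreover have "T \<inter> {s<..<t} = {}"
  proof (intro equals0I)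
    fix w assume w: "w \<in> T \<inter> {s<..<t}"
    then show False using s(1) s(2)[of w] t(1) t(2)[of w] by (cases "w \<le> x") auto
  qed
  then have "gap T s t"
    using s(1) t(1) by (auto simp: gap_def)
  ultimately show thesis by (intro that)
qed

text \<open>Adding K to the opponent's set can only shorten the gap around x, and an end that K did
  not create is an end of the original gap.\<close>

lemma gap_inside:
  assumes gap: "gap S' c d" and sub: "gap (K \<union> S') s t" and x: "x \<in> {c<..<d}" "x \<in> {s<..<t}"
  shows "c \<le> s" "t \<le> d" and "y \<in> {s, t} \<Longrightarrow> y \<notin> K \<Longrightarrow> y \<in> {c, d}"
proof -
  show cs: "c \<le> s"
  proof (rule ccontr)
    assume "\<not> c \<le> s"
    then have "c \<in> {s<..<t}" "c \<noteq> 0" "c \<noteq> 1" using x sub gap by (auto simp: gap_def)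
    then show False using gap sub by (auto simp: gap_def)
  qed
  show td: "t \<le> d"
  proof (rule ccontr)
    assume "\<not> t \<le> d"
    then have "d \<in> {s<..<t}" "d \<noteq> 0" "d \<noteq> 1" using x sub gap by (auto simp: gap_def)
    then show False using gap sub by (auto simp: gap_def)
  qed
  assume y: "y \<in> {s, t}" "y \<notin> K"
  show "y \<in> {c, d}"
  proof (rule ccontr)
    assume "y \<notin> {c, d}"
    then have "y \<in> {c<..<d}" using y cs td x by auto
    moreover have "y \<in> K \<union> S' \<union> {0, 1}" using y sub by (auto simp: gap_def)
    moreover have "0 \<le> c" "d \<le> 1" "S' \<inter> {c<..<d} = {}" using gap by (auto simp: gap_def)
    ultimately show False using y(2) by auto
  qed
qed

lemma ereal_SUP_eq_iff:
  assumes "\<tau> \<in> A"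
  shows "ereal (p \<tau>) = (SUP \<sigma>\<in>A. ereal (p \<sigma>)) \<longleftrightarrow> (\<forall>\<sigma>\<in>A. p \<sigma> \<le> p \<tau>)"
proof
  assume eq: "ereal (p \<tau>) = (SUP \<sigma>\<in>A. ereal (p \<sigma>))"
  show "\<forall>\<sigma>\<in>A. p \<sigma> \<le> p \<tau>"
  proof
    fix \<sigma> assume "\<sigma> \<in> A"
    then have "ereal (p \<sigma>) \<le> ereal (p \<tau>)" unfolding eq by (rule SUP_upper)
    then show "p \<sigma> \<le> p \<tau>" by simp
  qed
next
  assume "\<forall>\<sigma>\<in>A. p \<sigma> \<le> p \<tau>"
  then show "ereal (p \<tau>) = (SUP \<sigma>\<in>A. ereal (p \<sigma>))"
    using assms by (intro antisym SUP_upper SUP_least) auto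
qed

context brownian_family
begin

lemma payoff_le_value:
  assumes vf: "value_function f g I K Z c d u p" and r: "rewards f g h"
    and \<tau>: "\<tau> \<in> stopping_times P G" and S': "closed S'" and gap: "gap S' c d" and x: "x \<in> {c<..<d}"
  shows "payoff P W f g h x \<tau> (entry_time W S') \<le> u x"
proof -
  note vfD = value_functionD[OF vf]
  obtain B where B: "\<And>w. \<bar>p w\<bar> \<le> B" using vfD(3) by auto
  have "p \<in> borel_measurable borel"
    using vfD(2) by (rule borel_measurable_continuous_onI)
  then show ?thesis
    using vfD(4-6) by (intro payoff_le_superharmonic[OF r \<tau> S' gap x vfD(1) _ B]) auto
qed

text \<open>On K the player collects f = u at once. Off K, u is affine on the gap left by both sets
  and has the collected rewards as end values, as the payoff does.\<close>

lemma payoff_eq_value: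
  assumes vf: "value_function f g I K Z c d u p" and r: "rewards f g h"
    and S': "closed S'" "K \<inter> S' = {}" and gap: "gap S' c d" and x: "x \<in> {c<..<d}"
  shows "payoff P W f g h x (entry_time W K) (entry_time W S') = u x"
proof -
  note vfD = value_functionD[OF vf]
  have x01: "x \<in> {0<..<1}" and "x \<notin> S'" using gap x by (auto simp: gap_def)
  show ?thesis
  proof (cases "x \<in> K")
    case True
    then show ?thesis
      using payoff_in_own_set[OF r vfD(7) S'(1) x01 True \<open>x \<notin> S'\<close>] vfD(9) by simp
  next
    case False
    then obtain s t where st: "gap (K \<union> S') s t" "s < x" "x < t"
      using gap_around[of "K \<union> S'" x] vfD(7) S'(1) x01 \<open>x \<notin> S'\<close> by auto
    have x_st: "x \<in> {s<..<t}" using st by simp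
    note inside = gap_inside[OF gap st(1) x x_st]
    have "{s<..<t} \<inter> K = {}" using st(1) by (auto simp: gap_def)
    then obtain \<alpha> \<beta> where affine: "\<And>w. w \<in> {s..t} \<Longrightarrow> u w = \<alpha> * w + \<beta>"
      using vfD(10)[of s t] inside st by auto
    have "payoff P W f g h x (entry_time W K) (entry_time W S') = \<alpha> * x + \<beta>"
    proof (rule payoff_affine[OF r vfD(7) S' st(1) x_st])
      fix y assume y: "y \<in> {s, t}"
      then have "\<alpha> * y + \<beta> = u y" using affine[of y] st by auto
      also have "\<dots> = (if y \<in> K then f y else g y)"
        using vfD(5,6,9) inside(3)[OF y] by auto
      finally show "\<alpha> * y + \<beta> = (if y \<in> K then f y else g y)" .
    qed
    then show ?thesis using affine[of x] st by simp
  qed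
qed

lemma optimal_stopping_set:
  assumes vf: "value_function f g I K Z c d u p" and r: "rewards f g h"
    and S: "closed S" "S \<subseteq> I" and S': "closed S'" "S \<inter> S' = {}" and gap: "gap S' c d"
    and opt: "\<And>x. x \<in> {c<..<d} \<Longrightarrow> u x \<le> payoff P W f g h x (entry_time W S) (entry_time W S')"
  shows "Z \<inter> {c<..<d} \<subseteq> S" and "S \<inter> {c<..<d} \<subseteq> K"
proof -
  note vfD = value_functionD[OF vf]
  show "S \<inter> {c<..<d} \<subseteq> K"
  proof (clarify, rule ccontr)
    fix z assume z: "z \<in> S" "z \<in> {c<..<d}" "z \<notin> K"
    have "payoff P W f g h z (entry_time W S) (entry_time W S') = f z"
      using z gap S S' by (intro payoff_in_own_set[OF r]) (auto simp: gap_def)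
    then show False using opt[OF z(2)] vfD(11)[of z] z S(2) by auto
  qed
  show "Z \<inter> {c<..<d} \<subseteq> S"
  proof (clarify, rule ccontr)
    fix z assume z: "z \<in> Z" "z \<in> {c<..<d}" "z \<notin> S"
    have z01: "z \<in> {0<..<1}" "z \<notin> S \<union> S'" using gap z by (auto simp: gap_def)
    obtain s t where st: "gap (S \<union> S') s t" "s < z" "z < t"
      using gap_around[of "S \<union> S'" z] S(1) S'(1) z01 by auto
    have z_st: "z \<in> {s<..<t}" using st by simp
    note inside = gap_inside[OF gap st(1) z(2) z_st]
    \<comment> \<open>What is collected on exit from the common gap. An end outside S is c or d,
      where u equals g, so A never exceeds u.\<close>
    define A where "A y = (if y \<in> S then f y else g y)" for y
    have A_le: "A y \<le> u y" if "y \<in> {s, t}" for y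
    proof (cases "y \<in> S")
      case True
      have "y \<in> {c..d}" using that inside(1,2) st by auto
      then show ?thesis using True vfD(4) by (simp add: A_def)
    next
      case False
      then show ?thesis using inside(3)[OF that] vfD(5,6) by (auto simp: A_def)
    qed
    define \<alpha> where "\<alpha> = (A t - A s) / (t - s)"
    define \<beta> where "\<beta> = A s - \<alpha> * s"
    have "\<alpha> * (t - s) = A t - A s" using st by (simp add: \<alpha>_def)
    then have ends: "\<alpha> * s + \<beta> = A s" "\<alpha> * t + \<beta> = A t"
      by (auto simp: \<beta>_def algebra_simps)
    have "payoff P W f g h z (entry_time W S) (entry_time W S') = \<alpha> * z + \<beta>"
      by (rule payoff_affine[OF r S(1) S' st(1) z_st]) (use ends in \<open>auto simp: A_def\<close>)
    also have "\<dots> < u z"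
      using vfD(12)[OF z(1) inside(1) st(2,3) inside(2)] A_le[of s] A_le[of t] ends by simp
    finally show False using opt[OF z(2)] by simp
  qed
qed

text \<open>The value functions settle the starting points outside the opponent's set; inside it the
  game ends at time 0, and waiting, which earns g, is optimal.\<close>

lemma dp_solutionI:
  assumes S: "closed S1" "closed S2" "S1 \<inter> S2 = {}"
    and vf1: "value_function f1 g1 I1 S1 Z1 0 r u1 p1" and r1: "rewards f1 g1 h1"
    and vf2: "value_function f2 g2 I2 S2 Z2 l 1 u2 p2" and r2: "rewards f2 g2 h2"
    and S1: "S1 = {0..l}" and S2: "S2 = {r..1}" and lr: "0 \<le> l" "l < r" "r \<le> 1"
  shows "dp_solution P G W f1 g1 h1 f2 g2 h2 (entry_time W S1) (entry_time W S2)"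
proof -
  have gap1: "gap S2 0 r" and gap2: "gap S1 l 1"
    using lr unfolding S1 S2 by (auto simp: gap_def)
  have st: "entry_time W S1 \<in> stopping_times P G" "entry_time W S2 \<in> stopping_times P G"
    by (rule stopping_time_entry, rule S)+
  have le1: "payoff P W f1 g1 h1 x \<tau> (entry_time W S2) \<le> payoff P W f1 g1 h1 x (entry_time W S1) (entry_time W S2)"
    if x: "x \<in> {0<..<1}" and \<tau>: "\<tau> \<in> stopping_times P G" for x \<tau>
  proof (cases "x < r")
    case True
    then have xr: "x \<in> {0<..<r}" using x by simp
    show ?thesis
      using payoff_le_value[OF vf1 r1 \<tau> S(2) gap1 xr] payoff_eq_value[OF vf1 r1 S(2,3) gap1 xr] by simp
  next
    case False
    then have "x \<in> S2" "x \<notin> S1" using x lr unfolding S1 S2 by auto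
    then show ?thesis
      using payoff_in_opponent_set[OF r1 \<tau> S(1,2) x] by simp
  qed
  have le2: "payoff P W f2 g2 h2 x \<tau> (entry_time W S1) \<le> payoff P W f2 g2 h2 x (entry_time W S2) (entry_time W S1)"
    if x: "x \<in> {0<..<1}" and \<tau>: "\<tau> \<in> stopping_times P G" for x \<tau>
  proof (cases "l < x")
    case True
    then have xr: "x \<in> {l<..<1}" using x by simp
    have "S2 \<inter> S1 = {}" using S(3) by auto
    then show ?thesis
      using payoff_le_value[OF vf2 r2 \<tau> S(1) gap2 xr] payoff_eq_value[OF vf2 r2 S(1) _ gap2 xr] by simp
  next
    case False
    then have "x \<in> S1" "x \<notin> S2" using x lr unfolding S1 S2 by auto
    then show ?thesis
      using payoff_in_opponent_set[OF r2 \<tau> S(2,1) x] by simp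
  qed
  show ?thesis
    unfolding dp_solution_def
  proof (intro conjI ballI st)
    fix x :: real assume x: "x \<in> {0<..<1}"
    show "ereal (payoff P W f1 g1 h1 x (entry_time W S1) (entry_time W S2))
        = (SUP \<tau>\<in>stopping_times P G. ereal (payoff P W f1 g1 h1 x \<tau> (entry_time W S2)))"
      by (rule ereal_SUP_eq_iff[where p="\<lambda>\<tau>. payoff P W f1 g1 h1 x \<tau> (entry_time W S2)", THEN iffD2, OF st(1)])
        (use le1[OF x] in blast)
    show "ereal (payoff P W f2 g2 h2 x (entry_time W S2) (entry_time W S1))
        = (SUP \<tau>\<in>stopping_times P G. ereal (payoff P W f2 g2 h2 x \<tau> (entry_time W S1)))"
      by (rule ereal_SUP_eq_iff[where p="\<lambda>\<tau>. payoff P W f2 g2 h2 x \<tau> (entry_time W S1)", THEN iffD2, OF st(2)])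
        (use le2[OF x] in blast)
  qed
qed

lemma dp_solutionD:
  assumes "dp_solution P G W f1 g1 h1 f2 g2 h2 \<tau>1 \<tau>2" "x \<in> {0<..<1}" "\<tau> \<in> stopping_times P G"
  shows "payoff P W f1 g1 h1 x \<tau> \<tau>2 \<le> payoff P W f1 g1 h1 x \<tau>1 \<tau>2"
    and "payoff P W f2 g2 h2 x \<tau> \<tau>1 \<le> payoff P W f2 g2 h2 x \<tau>2 \<tau>1"
proof -
  have st: "\<tau>1 \<in> stopping_times P G" "\<tau>2 \<in> stopping_times P G"
    and eq: "ereal (payoff P W f1 g1 h1 x \<tau>1 \<tau>2) = (SUP \<tau>\<in>stopping_times P G. ereal (payoff P W f1 g1 h1 x \<tau> \<tau>2))"
      "ereal (payoff P W f2 g2 h2 x \<tau>2 \<tau>1) = (SUP \<tau>\<in>stopping_times P G. ereal (payoff P W f2 g2 h2 x \<tau> \<tau>1))"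
    using assms(1,2) unfolding dp_solution_def by blast+
  show "payoff P W f1 g1 h1 x \<tau> \<tau>2 \<le> payoff P W f1 g1 h1 x \<tau>1 \<tau>2"
    using ereal_SUP_eq_iff[where p="\<lambda>\<tau>. payoff P W f1 g1 h1 x \<tau> \<tau>2", THEN iffD1, OF st(1) eq(1)] assms(3) by blast
  show "payoff P W f2 g2 h2 x \<tau> \<tau>1 \<le> payoff P W f2 g2 h2 x \<tau>2 \<tau>1"
    using ereal_SUP_eq_iff[where p="\<lambda>\<tau>. payoff P W f2 g2 h2 x \<tau> \<tau>1", THEN iffD1, OF st(2) eq(2)] assms(3) by blast
qed

text \<open>Stopping on K is an admissible competitor that attains u, so an optimal S must attain u
  as well.\<close>

lemma best_response_stopping_set:
  assumes vf: "value_function f g I K Z c d u p" and r: "rewards f g h"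
    and S: "closed S" "S \<subseteq> I" and S': "closed S'" "S \<inter> S' = {}" "K \<inter> S' = {}" and gap: "gap S' c d"
    and opt: "\<And>x \<tau>. x \<in> {0<..<1} \<Longrightarrow> \<tau> \<in> stopping_times P G \<Longrightarrow>
      payoff P W f g h x \<tau> (entry_time W S') \<le> payoff P W f g h x (entry_time W S) (entry_time W S')"
  shows "Z \<inter> {c<..<d} \<subseteq> S" and "S \<inter> {c<..<d} \<subseteq> K"
proof -
  have "u x \<le> payoff P W f g h x (entry_time W S) (entry_time W S')" if x: "x \<in> {c<..<d}" for x
    using payoff_eq_value[OF vf r S'(1,3) gap x] gap x
      opt[OF _ stopping_time_entry[OF value_functionD(7)[OF vf]], of x] by (auto simp: gap_def)
  then show "Z \<inter> {c<..<d} \<subseteq> S" "S \<inter> {c<..<d} \<subseteq> K"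
    using optimal_stopping_set[OF vf r S S'(1,2) gap] by blast+
qed

end

section \<open>Existence and uniqueness of the threshold equilibrium\<close>

theorem theorem5p8:
  fixes M :: "'w measure" and P :: "real \<Rightarrow> 'w measure" and G :: "ennreal \<Rightarrow> 'w measure"
    and W :: "real \<Rightarrow> 'w \<Rightarrow> real"
    and f1 g1 h1 f2 g2 h2 :: "real \<Rightarrow> real"
    and a b :: real
  assumes BM: "brownian_family M P G W"
    and rewards1: "rewards f1 g1 h1" and rewards2: "rewards f2 g2 h2"
    and a: "a \<in> {0<..<1}" and b: "b \<in> {0<..<1}" and ab: "a < b"
    and f1_concave: "strictly_concave_on {0..a} f1" and f1_convex: "strictly_convex_on {a..1} f1"
    and f2_convex: "strictly_convex_on {0..b} f2" and f2_concave: "strictly_concave_on {b..1} f2"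
    and smooth: "C2_01 f1" "C2_01 g1" "C2_01 f2" "C2_01 g2"
    and profitable: "\<forall>x\<in>{0..a}. \<forall>y\<in>{b..1}. \<exists>x'\<in>{0<..a}. \<exists>y'\<in>{b..<1}.
          f1 x' > g1 y * (x' / y) \<and> f2 y' > g2 x * ((1 - y') / (1 - x))"
    and f1_bound: "\<forall>x\<in>{0<..<a}. \<forall>y\<in>{b..1}.
          D01 (D01 f1) x \<le> - 2 * ((f1 x + D01 f1 x * (y - x) - g1 y) / (y - x)\<^sup>2)"
    and f2_bound: "\<forall>x\<in>{0..a}. \<forall>y\<in>{b<..<1}.
          D01 (D01 f2) y \<le> - 2 * ((f2 y - D01 f2 y * (y - x) - g2 x) / (y - x)\<^sup>2)"
    and diagonal: "\<exists>r1\<ge>0. \<exists>r2\<ge>0. \<forall>x\<in>{0..a}. \<forall>y\<in>{b..1}.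
          4 * r1 * r2 * H1 f1 g1 x y * H2 f2 g2 x y
            - (r1 * H3 f1 g1 x y + r2 * H4 f2 g2 x y)\<^sup>2 > 0"
  shows "\<exists>l\<in>{0..a}. \<exists>r\<in>{b..1}.
      gnep_solution a b f1 g1 f2 g2 (l, r) \<and>
      (\<forall>s. gnep_solution a b f1 g1 f2 g2 s \<longrightarrow> s = (l, r)) \<and>
      dp_solution P G W f1 g1 h1 f2 g2 h2 (entry_time W {0..l}) (entry_time W {r..1}) \<and>
      (\<forall>S1 S2. closed S1 \<and> S1 \<subseteq> {0..a} \<and> closed S2 \<and> S2 \<subseteq> {b..1} \<and>
         dp_solution P G W f1 g1 h1 f2 g2 h2 (entry_time W S1) (entry_time W S2) \<longrightarrow>
         (\<forall>x\<in>{0<..<1}. AE \<omega> in P x.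
            entry_time W S1 \<omega> = entry_time W {0..l} \<omega> \<and>
            entry_time W S2 \<omega> = entry_time W {r..1} \<omega>))"
proof -
  interpret brownian_family M P G W by (rule BM)
  interpret p1: one_sided f1 "D01 f1" g1 a
    using rewards1 smooth(1) a f1_concave f1_convex by (rule one_sided_left)
  interpret p2: one_sided "\<lambda>w. f2 (1 - w)" "\<lambda>w. - D01 f2 (1 - w)" "\<lambda>w. g2 (1 - w)" "1 - b"
    using rewards2 smooth(3) b f2_convex f2_concave by (rule one_sided_right)
  \<comment> \<open>The inequality for x' does not involve x, so the choice x = 0 serves.\<close>
  have pos1: "0 < p1.slope_gap 0 y" if y: "y \<in> {b..1}" for y
  proof -
    obtain x' where "x' \<in> {0<..a}" "g1 y * (x' / y) < f1 x'"
      using profitable[rule_format, OF _ y, of 0] a by auto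
    then show ?thesis using y b by (intro p1.slope_gap_at_0) auto
  qed
  have pos2: "0 < p2.slope_gap 0 (1 - x)" if x: "x \<in> {0..a}" for x
  proof -
    obtain y' where "y' \<in> {b..<1}" "g2 x * ((1 - y') / (1 - x)) < f2 y'"
      using profitable[rule_format, OF x, of b] b by auto
    then show ?thesis using x a by (intro p2.slope_gap_at_0[of _ "1 - y'"]) auto
  qed
  have y_in: "y \<in> {a<..1}" if "y \<in> {b..1}" for y using that ab by auto
  have x_in: "1 - x \<in> {1 - b<..1}" if "x \<in> {0..a}" for x using that ab by auto
  \<comment> \<open>As a < b, both suprema run over full intervals. Up to reflection U2 as a
    function of y is an instance of U1, so either maximisation is a tangency condition.\<close>
  have gnep_iff: "gnep_solution a b f1 g1 f2 g2 (x, y) \<longleftrightarrow>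
      x \<in> {0..a} \<and> y \<in> {b..1} \<and> p1.slope_gap x y = 0 \<and> p2.slope_gap (1 - y) (1 - x) = 0" for x y
  proof (cases "x \<in> {0..a} \<and> y \<in> {b..1}")
    case True
    then have x: "x \<in> {0..a}" and y: "y \<in> {b..1}" by auto
    have img: "{b..1} = (\<lambda>w. 1 - w) ` {0..1 - b}"
      by (auto intro!: image_eqI[of _ _ "1 - _"])
    have "(SUP s\<in>{b..1}. ereal (U2 f2 g2 x s))
        = (SUP s\<in>{0..1 - b}. ereal (U1 (\<lambda>w. f2 (1 - w)) (\<lambda>w. g2 (1 - w)) s (1 - x)))"
      unfolding img image_image by (simp add: U2_reflect)
    moreover have "1 - y \<in> {0..1 - b}" using y by simp
    ultimately have "ereal (U2 f2 g2 x y) = (SUP s\<in>{b..1}. ereal (U2 f2 g2 x s))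
        \<longleftrightarrow> p2.slope_gap (1 - y) (1 - x) = 0"
      using p2.maximiser_iff[OF x_in[OF x] pos2[OF x], of "1 - y"] by (simp add: U2_reflect)
    moreover have "(x, y) \<in> gnep_set a b" using x y ab by (auto simp: gnep_set_def)
    ultimately show ?thesis
      using x y p1.maximiser_iff[OF y_in[OF y] pos1[OF y] x]
      by (simp only: gnep_solution_def gnep_sections[OF ab] prod.case simp_thms)
  qed (auto simp: gnep_solution_def gnep_set_def)
  have interior1: "x \<in> {0<..<a}" if "x \<in> {0..a}" "y \<in> {b..1}" "p1.slope_gap x y = 0" for x y
    using p1.slope_gap_root_interior[OF that(1,3) y_in[OF that(2)] pos1[OF that(2)]] .
  have interior2: "y \<in> {b<..<1}" if "x \<in> {0..a}" "y \<in> {b..1}" "p2.slope_gap (1 - y) (1 - x) = 0" for x y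
    using p2.slope_gap_root_interior[OF _ that(3) x_in[OF that(1)] pos2[OF that(1)]] that(2) by auto
  \<comment> \<open>Reflection reverses the direction of y, whence the minus sign: b goes to 1 - b,
    where the second slope gap is negative, and 1 goes to 0, where it is positive.\<close>
  obtain l r where l: "l \<in> {0..a}" and r: "r \<in> {b..1}"
    and root1: "p1.slope_gap l r = 0" and root2: "p2.slope_gap (1 - r) (1 - l) = 0"
  proof (rule poincare_miranda[of 0 a b 1 "\<lambda>z. p1.slope_gap (fst z) (snd z)"
        "\<lambda>z. - p2.slope_gap (1 - snd z) (1 - fst z)"])
    show "continuous_on ({0..a} \<times> {b..1}) (\<lambda>z. p1.slope_gap (fst z) (snd z))"
      by (rule continuous_on_subset[OF p1.continuous_on_slope_gap]) (use a b in auto)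
    have "continuous_on ({0..a} \<times> {b..1}) (\<lambda>z. p2.slope_gap (fst (1 - snd z, 1 - fst z)) (snd (1 - snd z, 1 - fst z)))"
      by (rule continuous_on_compose2[OF p2.continuous_on_slope_gap])
        (use a b in \<open>auto intro!: continuous_intros\<close>)
    then show "continuous_on ({0..a} \<times> {b..1}) (\<lambda>z. - p2.slope_gap (1 - snd z) (1 - fst z))"
      by (auto intro: continuous_on_minus)
    show "0 < - p2.slope_gap (1 - snd (x, b)) (1 - fst (x, b))" if "x \<in> {0..a}" for x
      using p2.slope_gap_at_a[OF x_in[OF that]] by simp
  qed (use a b pos1 pos2 p1.slope_gap_at_a y_in in auto)
  have unique: "x = l \<and> y = r"
    if xy: "x \<in> {0..a}" "y \<in> {b..1}" and "p1.slope_gap x y = 0" "p2.slope_gap (1 - y) (1 - x) = 0" for x y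
  proof -
    obtain r1 r2 where disc: "\<And>x y. x \<in> {0..a} \<Longrightarrow> y \<in> {b..1} \<Longrightarrow>
          4 * r1 * r2 * H1 f1 g1 x y * H2 f2 g2 x y
            - (r1 * H3 f1 g1 x y + r2 * H4 f2 g2 x y)\<^sup>2 > 0"
      using diagonal by blast
    have F2: "p2.slope_gap (1 - t) (1 - s) = f2 t - D01 f2 t * (t - s) - g2 s" for s t
      by (simp add: p2.slope_gap_def)
    have "0 < a" "b < 1" using a b by auto
    then show ?thesis
      by (intro first_order_conditions_unique[OF _ ab _ smooth disc])
        (use that interior1[OF xy] interior2[OF xy] interior1[OF l r root1] interior2[OF l r root2] root1 root2
          in \<open>simp_all add: p1.slope_gap_def F2\<close>)
  qed
  have vf1: "value_function f1 g1 {0..a} {0..x} {0<..<x} 0 y (p1.val x) (\<lambda>w. D01 f1 (p1.clamp x w))"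
    if "x \<in> {0<..<a}" "y \<in> {b..1}" "p1.slope_gap x y = 0" for x y
    by (rule p1.value_function_val[OF that(1) y_in[OF that(2)] that(3)])
  have vf2: "value_function f2 g2 {b..1} {y..1} {y<..<1} x 1
      (\<lambda>w. p2.val (1 - y) (1 - w)) (\<lambda>w. - (- D01 f2 (1 - p2.clamp (1 - y) (1 - w))))"
    if "x \<in> {0..a}" "y \<in> {b<..<1}" "p2.slope_gap (1 - y) (1 - x) = 0" for x y
  proof -
    have "1 - y \<in> {0<..<1 - b}" using that(2) by auto
    note vf = value_function_reflect[OF p2.value_function_val[OF this x_in[OF that(1)] that(3)]]
    have "(\<lambda>w. 1 - w) -` {0..1 - b} = {b..1}" "(\<lambda>w. 1 - w) -` {0..1 - y} = {y..1}"
      "(\<lambda>w. 1 - w) -` {0<..<1 - y} = {y<..<1}" by auto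
    then show ?thesis using vf by simp
  qed
  have l': "l \<in> {0<..<a}" and r': "r \<in> {b<..<1}"
    using interior1[OF l r root1] interior2[OF l r root2] by auto
  have equilibrium: "dp_solution P G W f1 g1 h1 f2 g2 h2 (entry_time W {0..l}) (entry_time W {r..1})"
    by (rule dp_solutionI[OF _ _ _ vf1[OF l' r root1] rewards1 vf2[OF l r' root2] rewards2])
      (use l r ab in auto)
  have equilibrium_unique: "entry_time W S1 = entry_time W {0..l} \<and> entry_time W S2 = entry_time W {r..1}"
    if S1: "closed S1" "S1 \<subseteq> {0..a}" and S2: "closed S2" "S2 \<subseteq> {b..1}"
      and dp: "dp_solution P G W f1 g1 h1 f2 g2 h2 (entry_time W S1) (entry_time W S2)" for S1 S2
  proof -
    \<comment> \<open>Inserting 1 and 0 covers empty stopping sets: against such an opponent the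
      process is followed until it is killed at that end.\<close>
    define y where "y = Inf (insert 1 S2)"
    define x where "x = Sup (insert 0 S1)"
    have bdd: "bdd_below (insert 1 S2)" "bdd_above (insert 0 S1)"
      using S1(2) S2(2) by (auto intro: bdd_below_mono bdd_above_mono)
    have y_mem: "y \<in> insert 1 S2"
      unfolding y_def using S2(1) by (intro closed_contains_Inf bdd closed_insert) auto
    have x_mem: "x \<in> insert 0 S1"
      unfolding x_def using S1(1) by (intro closed_contains_Sup bdd closed_insert) auto
    have y_le: "y \<le> w" if "w \<in> S2" for w
      unfolding y_def using that by (intro cInf_lower bdd) simp
    have x_ge: "w \<le> x" if "w \<in> S1" for w
      unfolding x_def using that by (intro cSup_upper bdd) simp
    have x: "x \<in> {0..a}" and y: "y \<in> {b..1}"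
      using x_mem y_mem S1(2) S2(2) a b by auto
    have gap1: "gap S2 0 y" and gap2: "gap S1 x 1"
      using x y y_mem y_le x_mem x_ge S1(2) S2(2) a by (force simp: gap_def)+
    \<comment> \<open>Of the opponent's set only the point nearest to the player matters, so x0 and
      y0 are the thresholds of the best responses to y and to x.\<close>
    obtain x0 where x0: "x0 \<in> {0<..<a}" "p1.slope_gap x0 y = 0"
      using p1.slope_gap_root_exists[OF y_in[OF y] pos1[OF y]] by auto
    obtain y1 where y1: "y1 \<in> {0<..<1 - b}" "p2.slope_gap y1 (1 - x) = 0"
      using p2.slope_gap_root_exists[OF x_in[OF x] pos2[OF x]] by auto
    define y0 where "y0 = 1 - y1"
    have y0: "y0 \<in> {b<..<1}" "p2.slope_gap (1 - y0) (1 - x) = 0"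
      using y1 by (auto simp: y0_def)
    have disj: "S1 \<inter> S2 = {}" "S2 \<inter> S1 = {}" "{0..x0} \<inter> S2 = {}" "{y0..1} \<inter> S1 = {}"
      using S1(2) S2(2) ab x0(1) y0(1) by force+
    have "{0<..<x0} \<inter> {0<..<y} \<subseteq> S1" "S1 \<inter> {0<..<y} \<subseteq> {0..x0}"
      using best_response_stopping_set[OF vf1[OF x0(1) y x0(2)] rewards1 S1 S2(1) disj(1,3) gap1 dp_solutionD(1)[OF dp]]
      by blast+
    then have A1: "{0<..<x0} \<subseteq> S1" "S1 \<subseteq> {0..x0}"
      using x0(1) y S1(2) ab a by force+
    have "{y0<..<1} \<inter> {x<..<1} \<subseteq> S2" "S2 \<inter> {x<..<1} \<subseteq> {y0..1}"
      using best_response_stopping_set[OF vf2[OF x y0] rewards2 S2 S1(1) disj(2,4) gap2 dp_solutionD(2)[OF dp]]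
      by blast+
    then have A2: "{y0<..<1} \<subseteq> S2" "S2 \<subseteq> {y0..1}"
      using y0(1) x S2(2) ab b by force+
    have "closure {0<..<x0} \<subseteq> S1" "closure {y0<..<1} \<subseteq> S2"
      using A1(1) A2(1) S1(1) S2(1) by (auto intro: closure_minimal[THEN subsetD])
    then have "{0..x0} \<subseteq> S1" "{y0..1} \<subseteq> S2"
      using x0(1) y0(1) by (simp_all add: closure_greaterThanLessThan)
    then have eq: "S1 = {0..x0}" "S2 = {y0..1}" using A1(2) A2(2) by auto
    \<comment> \<open>The extreme points of the stopping sets are the best-response thresholds
      themselves, so (x, y) solves both tangency equations.\<close>
    have "x = x0" "y = y0"
      using x0(1) y0(1) by (simp_all add: x_def y_def eq insert_absorb)
    then have "x0 = l \<and> y0 = r"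
      using unique[OF x y] x0(2) y0(2) by simp
    then show ?thesis using eq by simp
  qed
  show ?thesis
  proof (intro bexI[OF _ l] bexI[OF _ r] conjI allI impI ballI)
    show "gnep_solution a b f1 g1 f2 g2 (l, r)"
      using l r root1 root2 by (simp only: gnep_iff simp_thms)
    show "s = (l, r)" if "gnep_solution a b f1 g1 f2 g2 s" for s
    proof (cases s)
      case (Pair x y)
      then show ?thesis using that unique[of x y] by (simp only: gnep_iff simp_thms prod.inject)
    qed
    show "dp_solution P G W f1 g1 h1 f2 g2 h2 (entry_time W {0..l}) (entry_time W {r..1})"
      by (rule equilibrium)
    fix S1 S2 x
    assume S: "closed S1 \<and> S1 \<subseteq> {0..a} \<and> closed S2 \<and> S2 \<subseteq> {b..1} \<and>
      dp_solution P G W f1 g1 h1 f2 g2 h2 (entry_time W S1) (entry_time W S2)"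
    have "entry_time W S1 = entry_time W {0..l}" "entry_time W S2 = entry_time W {r..1}"
      using equilibrium_unique[of S1 S2] S by blast+
    then show "AE \<omega> in P x. entry_time W S1 \<omega> = entry_time W {0..l} \<omega> \<and>
        entry_time W S2 \<omega> = entry_time W {r..1} \<omega>" by simp
  qed
qed

end
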